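(* Let $\psi$ be a semicocycle in $\mathbb{E}$ over $(\mathcal{Q},\vartheta)$ which, with respect to one family of quadratic forms $V_q$ as described in the context, satisfies the negative squeezing property, the strengthened positive squeezing property, the uniform Lipschitz property, the bounded projectors property and the differentiability property. Let $q\in\mathcal{Q}$, $v_0\in\mathbb{E}$ and $\mathfrak{V}:=[v_0]^+(q)$. Then $\mathfrak{V}$ is a $C^1$-differentiable submanifold in $\mathbb{E}$. Moreover: (1) The map $\Phi_{\mathfrak{V}}\colon\mathbb{E}^+(q)\to\mathbb{E}$ is $C^1$-differentiable (in the Fr\'echet sense) and its differential at $\zeta\in\mathbb{E}^+(q)$ is $\Phi'_{\mathfrak{V}}(\Phi_{\mathfrak{V}}(\zeta))$. (2) The tangent space to $\mathfrak{V}$ at $v\in\mathfrak{V}$ is $\mathfrak{V}'(v)$. (3) For any $t\ge\tau_Q$ the map $\psi^t(q,\cdot)\colon[v_0]^+(q)\to[\psi^t(q,v_0)]^+(\vartheta^t(q))$ is $C^1$-differentiable and its differential at $v\in[v_0]^+(q)$ is $$L(t;q,v)\colon[0]^+(q,v)\to[0]^+(\vartheta^t(q),\psi^t(q,v)).$$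
   Context: Setting. $\mathbb{R}_+=[0,\infty)$; $\mathcal{Q}$ is a complete metric space; $\vartheta=\{\vartheta^t\}_{t\ge 0}$ is a semiflow on $\mathcal{Q}$ ($\vartheta^0=\mathrm{id}$, $\vartheta^{t+s}=\vartheta^t\circ\vartheta^s$, jointly continuous in $(t,q)$); $\mathbb{E}$ is a real or complex Banach space continuously embedded in a Hilbert space $\mathbb{H}$ with norm $|\cdot|_{\mathbb{H}}$. A semicocycle $\psi$ in $\mathbb{E}$ over $(\mathcal{Q},\vartheta)$ is a family of maps $\psi^t(q,\cdot)\colon\mathbb{E}\to\mathbb{E}$, $t\ge0$, $q\in\mathcal{Q}$, with $\psi^0(q,v)=v$, $\psi^{t+s}(q,v)=\psi^t(\vartheta^s(q),\psi^s(q,v))$ and $(t,q,v)\mapsto\psi^t(q,v)$ continuous. Its skew-product semiflow on $\mathcal{Q}\times\mathbb{E}$ is $\pi^t(q,v)=(\vartheta^t(q),\psi^t(q,v))$. Quadratic forms. $\langle v,f\rangle$ is the pairing of $v\in\mathbb{E}$, $f\in\mathbb{E}^*$ (in the complex case $\mathbb{E}^*$ consists of conjugate-linear functionals). For each $q\in\mathcal{Q}$ there are an operator $Q(q)\in\mathcal{L}(\mathbb{E};\mathbb{E}^* )$, symmetric ($\langle v_1,Q(q)v_2\rangle=\overline{\langle v_2,Q(q)v_1\rangle}$), and a direct sum splitting of $\mathbb{E}$ into a closed subspace and a subspace $\mathbb{E}^-(q)$ of dimension $j$ (a fixed integer $j\ge0$) such that $V_q(v):=\langle v,Q(q)v\rangle$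 is positive for nonzero $v$ in the former and negative for nonzero $v\in\mathbb{E}^-(q)$; moreover $\sup_q\|Q(q)\|<\infty$. The $V_q$-orthogonal projector $\Pi_q\colon\mathbb{E}\to\mathbb{E}^-(q)$ is the bounded projector determined by $\langle w,Q(q)v\rangle=\langle w,Q(q)\Pi_qv\rangle$ for all $w\in\mathbb{E}^-(q)$, $v\in\mathbb{E}$. Put $\Pi^+_q=I-\Pi_q$, $\mathbb{E}^+(q)=\operatorname{Ker}\Pi_q$. Negative squeezing property: there are constants $-\infty<\alpha^-<\alpha^+<\infty$, $\delta_Q>0$, $\tau_Q\ge0$ and a Borel function $\alpha_0\colon\mathcal{Q}\to[\alpha^-,\alpha^+]$ such that, with $\alpha(t;q)=\int_0^t\alpha_0(\vartheta^s(q))ds$, $$e^{2\alpha(r;q)}V_{\vartheta^r(q)}(\psi^r(q,v_1)-\psi^r(q,v_2))-V_q(v_1-v_2)\le-\delta_Q\int_0^re^{2\alpha(s;q)}|\psi^s(q,v_1)-\psi^s(q,v_2)|^2_{\mathbb{H}}ds$$ for all $q\in\mathcal{Q}$, $r\ge\tau_Q$ and $v_1,v_2\in\mathbb{E}$ with $V_q(v_1-v_2)\le0$. Positive squeezing property: for the same operators, spaces, $\delta_Q$ and $\tau_Q$, there are constants $-\infty<\beta^-<\beta^+<\infty$ and a Borel function $\beta_0\colon\mathcal{Q}\to[\beta^-,\beta^+]$ such that, with $\beta(t;q)=\int_0^t\beta_0(\vartheta^s(q))ds$, $$e^{2\beta(r;q)}V_{\vartheta^r(q)}(\psi^r(q,v_1)-\psi^r(q,v_2))-V_q(v_1-v_2)\le-\delta_Q\int_0^re^{2\beta(s;q)}|\psi^s(q,v_1)-\psi^s(q,v_2)|^2_{\mathbb{H}}ds$$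 for all $q\in\mathcal{Q}$, $r\ge\tau_Q$ and $v_1,v_2\in\mathbb{E}$ with $V_{\vartheta^r(q)}(\psi^r(q,v_1)-\psi^r(q,v_2))\ge0$. Strengthened positive squeezing property: the positive squeezing property holds and at least one of the following is satisfied: (i) the negative squeezing, positive squeezing and differentiability properties hold with $\tau_Q=0$; (ii) the inequality of the positive squeezing property holds for all $q\in\mathcal{Q}$, $r\ge\tau_Q$, $v_1,v_2\in\mathbb{E}$ without the restriction $V_{\vartheta^r(q)}(\psi^r(q,v_1)-\psi^r(q,v_2))\ge0$; (iii) for all $q\in\mathcal{Q}$, $v\in\mathbb{E}$, $r\ge\tau_Q$ and $\xi\in\mathbb{E}$ with $V_{\vartheta^r(q)}(L(r;q,v)\xi)\ge0$ (with $L$ from the differentiability property), $$e^{2\beta(r;q)}V_{\vartheta^r(q)}(L(r;q,v)\xi)-V_q(\xi)\le-\delta_Q\int_0^re^{2\beta(s;q)}|L(s;q,v)\xi|^2_{\mathbb{H}}ds.$$ Uniform Lipschitz property: there is $\tau_S\ge0$ such that for every $T>0$ there is $L_T>0$ with $\|\psi^t(q,v_1)-\psi^t(q,v_2)\|_{\mathbb{E}}\le L_T|v_1-v_2|_{\mathbb{H}}$ for $t\in[\tau_S,\tau_S+T]$ and $\|\psi^t(q,v_1)-\psi^t(q,v_2)\|_{\mathbb{E}}\le L_T\|v_1-v_2\|_{\mathbb{E}}$ for $t\in[0,T]$, for all $q,v_1,v_2$. Bounded projectors property: $\sup_{q}\|\Pi_q\|<\infty$. Asymptotic compactness with exponent $\gamma^+$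 (of a semicocycle with base $\mathcal{P}$): for every compact $\mathcal{C}\subset\mathcal{P}$ there is $\gamma_0\colon\mathbb{R}_+\to\mathbb{R}_+$ with $\gamma_0(t)\to0$ as $t\to+\infty$ such that the time-$t$ image of $\mathcal{C}\times\mathcal{B}$ has Kuratowski measure of noncompactness at most $\gamma_0(t)e^{-\gamma^+t}\alpha_K(\mathcal{B})$ for all $t\ge0$ and bounded $\mathcal{B}\subset\mathbb{E}$, where $\alpha_K$ is the Kuratowski measure of noncompactness. Differentiability property: there is a linear semicocycle $\Xi$ in $\mathbb{E}$ over the skew-product semiflow $(\mathcal{Q}\times\mathbb{E},\pi)$, given by linear maps $\Xi^t(q,v,\cdot)=L(t;q,v)\colon\mathbb{E}\to\mathbb{E}$, which itself satisfies the uniform Lipschitz property and asymptotic compactness with exponent $\alpha^+$ (base $\mathcal{Q}\times\mathbb{E}$), and such that for all $q\in\mathcal{Q}$, $v_0,\xi\in\mathbb{E}$ $$\lim_{h\to0}\frac{\psi^t(q,v_0+h\xi)-\psi^t(q,v_0)}{h}=L(t;q,v_0)\xi,$$ where: for $t\ge0$ the limit holds in the norm of $\mathbb{H}$, uniformly in $t$ from compact subsets of $[0,\infty)$ and $\xi$ from bounded subsets of $\mathbb{E}$; and for $t\ge\tau_Q$ it holds in the norm of $\mathbb{E}$, uniformly in $t$ from compact subsets of $[\tau_Q,\infty)$ and $\xi$ from bounded subsets of $\mathbb{E}$. Moreover, for any $t\ge0$, $q\in\mathcal{Q}$ the map $\mathbb{E}\ni v\mapsto L(t;q,v)\in\mathcal{L}(\mathbb{E};\mathbb{H})$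 is continuous. Positive equivalence. $[v_0]^+(q)$ is the set of all $v\in\mathbb{E}$ with $V_{\vartheta^t(q)}(\psi^t(q,v)-\psi^t(q,v_0))\ge0$ for all $t\ge0$. The map $\Pi_q^+\colon\mathfrak{V}\to\mathbb{E}^+(q)$ is a homeomorphism, and $\Phi_{\mathfrak{V}}$ denotes its inverse. For $v\in\mathbb{E}$, $[0]^+(q,v)$ is the positive equivalence class of zero for $\Xi$, i.e. the set of $\xi\in\mathbb{E}$ with $V_{\vartheta^t(q)}(L(t;q,v)\xi)\ge0$ for all $t\ge0$. For $v\in\mathfrak{V}$ put $\mathfrak{V}'(v):=[0]^+(q,v)$; $\Pi_q^+\colon\mathfrak{V}'(v)\to\mathbb{E}^+(q)$ is a linear homeomorphism and $\Phi'_{\mathfrak{V}}(v)\colon\mathbb{E}^+(q)\to\mathfrak{V}'(v)$ is its inverse.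
   Formalization: In (3), the differential L(t;q,v) is shown continuous in v only as a map into L(E;H), and jointly in (v,ξ) in E, since norm continuity into L(E;E) can fail; that positive equivalence over q is an equivalence relation is an explicit assumption. *)

theory Defs
  imports "HOL-Analysis.Analysis"
begin

section \<open>Real or complex scalars\<close>

text \<open>
  The library has no complex normed spaces. The real and the complex case are treated together:
  the scalar field is a set \<open>K\<close> of complex numbers which is either \<open>\<real>\<close> or \<open>UNIV\<close>, and it acts on a
  real normed space by a map \<open>scl\<close> extending \<^term>\<open>scaleR\<close>, of which only the values at scalars
  in \<open>K\<close> matter. All \<open>K\<close>-valued pairings are complex-valued functions with values in \<open>K\<close>;
  on \<open>\<real>\<close> the conjugation \<^term>\<open>cnj\<close> is the identity.
\<close>

definition normed_space_over :: "complex set \<Rightarrow> (complex \<Rightarrow> 'a::real_normed_vector \<Rightarrow> 'a) \<Rightarrow> bool"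
  where "normed_space_over K scl \<longleftrightarrow>
    (K = \<real> \<or> K = UNIV) \<and>
    (\<forall>a\<in>K. \<forall>b\<in>K. \<forall>v. scl (a + b) v = scl a v + scl b v) \<and>
    (\<forall>a\<in>K. \<forall>v w. scl a (v + w) = scl a v + scl a w) \<and>
    (\<forall>a\<in>K. \<forall>b\<in>K. \<forall>v. scl (a * b) v = scl a (scl b v)) \<and>
    (\<forall>r v. scl (complex_of_real r) v = r *\<^sub>R v) \<and>
    (\<forall>a\<in>K. \<forall>v. norm (scl a v) = cmod a * norm v)"

text \<open>A Hilbert space over \<open>K\<close>: a \<open>K\<close>-valued inner product whose real part is the inner product of
  the type class (so that both induce the same norm).\<close>

definition hilbert_space_over ::
    "complex set \<Rightarrow> (complex \<Rightarrow> 'h::{real_inner,complete_space} \<Rightarrow> 'h) \<Rightarrow> bool"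
  where "hilbert_space_over K scl \<longleftrightarrow> normed_space_over K scl \<and>
    (\<exists>ip :: 'h \<Rightarrow> 'h \<Rightarrow> complex.
      (\<forall>x y. ip x y \<in> K) \<and>
      (\<forall>x y z. ip (x + y) z = ip x z + ip y z) \<and>
      (\<forall>a\<in>K. \<forall>x y. ip (scl a x) y = a * ip x y) \<and>
      (\<forall>x y. ip y x = cnj (ip x y)) \<and>
      (\<forall>x y. Re (ip x y) = x \<bullet> y))"

definition linear_over :: "complex set \<Rightarrow> (complex \<Rightarrow> 'a \<Rightarrow> 'a) \<Rightarrow> (complex \<Rightarrow> 'b \<Rightarrow> 'b) \<Rightarrow>
    ('a::real_normed_vector \<Rightarrow> 'b::real_normed_vector) \<Rightarrow> bool"
  where "linear_over K sa sb f \<longleftrightarrow>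
    (\<forall>v w. f (v + w) = f v + f w) \<and> (\<forall>a\<in>K. \<forall>v. f (sa a v) = sb a (f v))"

definition subspace_over :: "complex set \<Rightarrow> (complex \<Rightarrow> 'a \<Rightarrow> 'a) \<Rightarrow> 'a::real_normed_vector set \<Rightarrow> bool"
  where "subspace_over K scl S \<longleftrightarrow>
    0 \<in> S \<and> (\<forall>v\<in>S. \<forall>w\<in>S. v + w \<in> S) \<and> (\<forall>a\<in>K. \<forall>v\<in>S. scl a v \<in> S)"

text \<open>\<open>S\<close> is a subspace with a \<open>K\<close>-basis of \<open>j\<close> vectors.\<close>

definition has_dim_over ::
    "complex set \<Rightarrow> (complex \<Rightarrow> 'a \<Rightarrow> 'a) \<Rightarrow> 'a::real_normed_vector set \<Rightarrow> nat \<Rightarrow> bool"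
  where "has_dim_over K scl S j \<longleftrightarrow> (\<exists>b :: nat \<Rightarrow> 'a.
    S = {v. \<exists>c. (\<forall>i<j. c i \<in> K) \<and> v = (\<Sum>i<j. scl (c i) (b i))} \<and>
    (\<forall>c. (\<forall>i<j. c i \<in> K) \<and> (\<Sum>i<j. scl (c i) (b i)) = 0 \<longrightarrow> (\<forall>i<j. c i = 0)))"

definition direct_sum_over :: "complex set \<Rightarrow> (complex \<Rightarrow> 'a \<Rightarrow> 'a) \<Rightarrow>
    'a::real_normed_vector set \<Rightarrow> 'a set \<Rightarrow> bool"
  where "direct_sum_over K scl X Y \<longleftrightarrow>
    subspace_over K scl X \<and> closed X \<and> subspace_over K scl Y \<and> closed Y \<and>
    X \<inter> Y = {0} \<and> (\<forall>v. \<exists>x\<in>X. \<exists>y\<in>Y. v = x + y)"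

definition continuous_embedding :: "complex set \<Rightarrow> (complex \<Rightarrow> 'e \<Rightarrow> 'e) \<Rightarrow>
    (complex \<Rightarrow> 'h \<Rightarrow> 'h) \<Rightarrow> ('e::real_normed_vector \<Rightarrow> 'h::real_normed_vector) \<Rightarrow> bool"
  where "continuous_embedding K scl sclH \<iota> \<longleftrightarrow>
    bounded_linear \<iota> \<and> linear_over K scl sclH \<iota> \<and> inj \<iota>"


section \<open>Semiflows and semicocycles\<close>

text \<open>Time is a real number; only times \<open>t \<ge> 0\<close> matter.\<close>

definition semiflow :: "(real \<Rightarrow> 'p::topological_space \<Rightarrow> 'p) \<Rightarrow> bool"
  where "semiflow \<theta> \<longleftrightarrow>
    (\<forall>q. \<theta> 0 q = q) \<and>
    (\<forall>t\<ge>0. \<forall>s\<ge>0. \<forall>q. \<theta> (t + s) q = \<theta> t (\<theta> s q)) \<and>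
    continuous_on ({0..} \<times> UNIV) (\<lambda>(t, q). \<theta> t q)"

definition semicocycle :: "(real \<Rightarrow> 'p::topological_space \<Rightarrow> 'p) \<Rightarrow>
    (real \<Rightarrow> 'p \<Rightarrow> 'e::topological_space \<Rightarrow> 'e) \<Rightarrow> bool"
  where "semicocycle \<theta> \<psi> \<longleftrightarrow>
    (\<forall>q v. \<psi> 0 q v = v) \<and>
    (\<forall>t\<ge>0. \<forall>s\<ge>0. \<forall>q v. \<psi> (t + s) q v = \<psi> t (\<theta> s q) (\<psi> s q v)) \<and>
    continuous_on ({0..} \<times> UNIV \<times> UNIV) (\<lambda>(t, q, v). \<psi> t q v)"

definition skew_product ::
    "(real \<Rightarrow> 'p \<Rightarrow> 'p) \<Rightarrow> (real \<Rightarrow> 'p \<Rightarrow> 'e \<Rightarrow> 'e) \<Rightarrow> real \<Rightarrow> 'p \<times> 'e \<Rightarrow> 'p \<times> 'e"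
  where "skew_product \<theta> \<psi> t = (\<lambda>(q, v). (\<theta> t q, \<psi> t q v))"

definition uniform_lipschitz :: "('e::real_normed_vector \<Rightarrow> 'h::real_normed_vector) \<Rightarrow>
    (real \<Rightarrow> 'p \<Rightarrow> 'e \<Rightarrow> 'e) \<Rightarrow> bool"
  where "uniform_lipschitz \<iota> \<psi> \<longleftrightarrow> (\<exists>\<tau>S\<ge>0. \<forall>T>0. \<exists>L>0. \<forall>q v1 v2.
    (\<forall>t\<in>{\<tau>S..\<tau>S + T}. norm (\<psi> t q v1 - \<psi> t q v2) \<le> L * norm (\<iota> v1 - \<iota> v2)) \<and>
    (\<forall>t\<in>{0..T}. norm (\<psi> t q v1 - \<psi> t q v2) \<le> L * norm (v1 - v2)))"

definition kuratowski :: "'e::metric_space set \<Rightarrow> real"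
  where "kuratowski B =
    Inf {d. d > 0 \<and> (\<exists>F. finite F \<and> B \<subseteq> \<Union>F \<and> (\<forall>S\<in>F. bounded S \<and> diameter S \<le> d))}"

text \<open>The boundedness clause says that the measure of noncompactness of the image is finite
  (\<^const>\<open>kuratowski\<close> is meaningful on bounded sets only).\<close>

definition asymptotically_compact ::
    "real \<Rightarrow> (real \<Rightarrow> 'p::topological_space \<Rightarrow> 'e::metric_space \<Rightarrow> 'e) \<Rightarrow> bool"
  where "asymptotically_compact \<gamma> \<psi> \<longleftrightarrow> (\<forall>C. compact C \<longrightarrow>
    (\<exists>\<gamma>0 :: real \<Rightarrow> real. (\<forall>t\<ge>0. \<gamma>0 t \<ge> 0) \<and> (\<gamma>0 \<longlongrightarrow> 0) at_top \<and>
      (\<forall>t\<ge>0. \<forall>B. bounded B \<longrightarrow>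
        bounded ((\<lambda>(p, v). \<psi> t p v) ` (C \<times> B)) \<and>
        kuratowski ((\<lambda>(p, v). \<psi> t p v) ` (C \<times> B)) \<le> \<gamma>0 t * exp (- \<gamma> * t) * kuratowski B)))"


section \<open>Quadratic forms\<close>

text \<open>
  Elements of the (anti)dual of \<open>E\<close> are the conjugate-linear \<open>K\<close>-valued ones among the bounded
  real-linear maps \<open>E \<Rightarrow> \<complex>\<close>; the operator norms agree.
\<close>

definition antidual :: "complex set \<Rightarrow> (complex \<Rightarrow> 'e \<Rightarrow> 'e) \<Rightarrow>
    ('e::real_normed_vector \<Rightarrow>\<^sub>L complex) set"
  where "antidual K scl = {f. \<forall>v. blinfun_apply f v \<in> K \<and>
    (\<forall>a\<in>K. blinfun_apply f (scl a v) = cnj a * blinfun_apply f v)}"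

definition pairing :: "'e::real_normed_vector \<Rightarrow> ('e \<Rightarrow>\<^sub>L complex) \<Rightarrow> complex"
  where "pairing v f = blinfun_apply f v"

text \<open>The pairing below is real, by symmetry of \<open>Q q\<close>.\<close>

definition Vform :: "('q \<Rightarrow> 'e::real_normed_vector \<Rightarrow>\<^sub>L ('e \<Rightarrow>\<^sub>L complex)) \<Rightarrow> 'q \<Rightarrow> 'e \<Rightarrow> real"
  where "Vform Q q v = Re (pairing v (blinfun_apply (Q q) v))"

definition quadratic_forms :: "complex set \<Rightarrow> (complex \<Rightarrow> 'e \<Rightarrow> 'e) \<Rightarrow> nat \<Rightarrow>
    ('q \<Rightarrow> 'e::real_normed_vector \<Rightarrow>\<^sub>L ('e \<Rightarrow>\<^sub>L complex)) \<Rightarrow> ('q \<Rightarrow> 'e set) \<Rightarrow> bool"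
  where "quadratic_forms K scl j Q Em \<longleftrightarrow>
    (\<forall>q v. blinfun_apply (Q q) v \<in> antidual K scl) \<and>
    (\<forall>q. \<forall>a\<in>K. \<forall>v w. pairing w (blinfun_apply (Q q) (scl a v)) = a * pairing w (blinfun_apply (Q q) v)) \<and>
    (\<forall>q v1 v2. pairing v1 (blinfun_apply (Q q) v2) = cnj (pairing v2 (blinfun_apply (Q q) v1))) \<and>
    (\<forall>q. has_dim_over K scl (Em q) j \<and> (\<forall>v\<in>Em q. v \<noteq> 0 \<longrightarrow> Vform Q q v < 0) \<and>
      (\<exists>Ep. direct_sum_over K scl Ep (Em q) \<and> (\<forall>v\<in>Ep. v \<noteq> 0 \<longrightarrow> Vform Q q v > 0))) \<and>
    bdd_above (range (\<lambda>q. norm (Q q)))"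

definition proj :: "('q \<Rightarrow> 'e::real_normed_vector \<Rightarrow>\<^sub>L ('e \<Rightarrow>\<^sub>L complex)) \<Rightarrow> ('q \<Rightarrow> 'e set) \<Rightarrow>
    'q \<Rightarrow> 'e \<Rightarrow> 'e"
  where "proj Q Em q v = (THE u. u \<in> Em q \<and>
    (\<forall>w\<in>Em q. pairing w (blinfun_apply (Q q) v) = pairing w (blinfun_apply (Q q) u)))"

definition proj_plus :: "('q \<Rightarrow> 'e::real_normed_vector \<Rightarrow>\<^sub>L ('e \<Rightarrow>\<^sub>L complex)) \<Rightarrow> ('q \<Rightarrow> 'e set) \<Rightarrow>
    'q \<Rightarrow> 'e \<Rightarrow> 'e"
  where "proj_plus Q Em q v = v - proj Q Em q v"

definition E_plus :: "('q \<Rightarrow> 'e::real_normed_vector \<Rightarrow>\<^sub>L ('e \<Rightarrow>\<^sub>L complex)) \<Rightarrow> ('q \<Rightarrow> 'e set) \<Rightarrow>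
    'q \<Rightarrow> 'e set"
  where "E_plus Q Em q = {v. proj Q Em q v = 0}"

definition bounded_projectors ::
    "('q \<Rightarrow> 'e::real_normed_vector \<Rightarrow>\<^sub>L ('e \<Rightarrow>\<^sub>L complex)) \<Rightarrow> ('q \<Rightarrow> 'e set) \<Rightarrow> bool"
  where "bounded_projectors Q Em \<longleftrightarrow>
    (\<forall>q. bounded_linear (proj Q Em q)) \<and> bdd_above (range (\<lambda>q. onorm (proj Q Em q)))"


section \<open>Squeezing\<close>

definition exponent_int :: "('q \<Rightarrow> real) \<Rightarrow> (real \<Rightarrow> 'q \<Rightarrow> 'q) \<Rightarrow> real \<Rightarrow> 'q \<Rightarrow> real"
  where "exponent_int a \<theta> t q = (LBINT s:{0..t}. a (\<theta> s q))"

text \<open>The squeezing inequality on \<open>[0, r]\<close> for a curve \<open>D\<close> of differences starting over \<open>q\<close>.\<close>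

definition squeeze :: "('e::real_normed_vector \<Rightarrow> 'h::real_normed_vector) \<Rightarrow> (real \<Rightarrow> 'q \<Rightarrow> 'q) \<Rightarrow>
    ('q \<Rightarrow> 'e \<Rightarrow>\<^sub>L ('e \<Rightarrow>\<^sub>L complex)) \<Rightarrow> real \<Rightarrow> ('q \<Rightarrow> real) \<Rightarrow> 'q \<Rightarrow> real \<Rightarrow> (real \<Rightarrow> 'e) \<Rightarrow> bool"
  where "squeeze \<iota> \<theta> Q \<delta> a q r D \<longleftrightarrow>
    exp (2 * exponent_int a \<theta> r q) * Vform Q (\<theta> r q) (D r) - Vform Q q (D 0)
      \<le> - \<delta> * (LBINT s:{0..r}. exp (2 * exponent_int a \<theta> s q) * (norm (\<iota> (D s)))\<^sup>2)"

definition negative_squeezing :: "('e::real_normed_vector \<Rightarrow> 'h::real_normed_vector) \<Rightarrow>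
    (real \<Rightarrow> 'q::topological_space \<Rightarrow> 'q) \<Rightarrow> (real \<Rightarrow> 'q \<Rightarrow> 'e \<Rightarrow> 'e) \<Rightarrow>
    ('q \<Rightarrow> 'e \<Rightarrow>\<^sub>L ('e \<Rightarrow>\<^sub>L complex)) \<Rightarrow> real \<Rightarrow> real \<Rightarrow> real \<Rightarrow> real \<Rightarrow> ('q \<Rightarrow> real) \<Rightarrow> bool"
  where "negative_squeezing \<iota> \<theta> \<psi> Q \<delta> \<tau> am ap \<alpha>0 \<longleftrightarrow>
    \<delta> > 0 \<and> \<tau> \<ge> 0 \<and> am < ap \<and> \<alpha>0 \<in> borel_measurable borel \<and> (\<forall>q. \<alpha>0 q \<in> {am..ap}) \<and>
    (\<forall>q. \<forall>r\<ge>\<tau>. \<forall>v1 v2. Vform Q q (v1 - v2) \<le> 0 \<longrightarrow>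
      squeeze \<iota> \<theta> Q \<delta> \<alpha>0 q r (\<lambda>s. \<psi> s q v1 - \<psi> s q v2))"

definition positive_squeezing :: "('e::real_normed_vector \<Rightarrow> 'h::real_normed_vector) \<Rightarrow>
    (real \<Rightarrow> 'q::topological_space \<Rightarrow> 'q) \<Rightarrow> (real \<Rightarrow> 'q \<Rightarrow> 'e \<Rightarrow> 'e) \<Rightarrow>
    ('q \<Rightarrow> 'e \<Rightarrow>\<^sub>L ('e \<Rightarrow>\<^sub>L complex)) \<Rightarrow> real \<Rightarrow> real \<Rightarrow> real \<Rightarrow> real \<Rightarrow> ('q \<Rightarrow> real) \<Rightarrow> bool"
  where "positive_squeezing \<iota> \<theta> \<psi> Q \<delta> \<tau> bm bp \<beta>0 \<longleftrightarrow>
    \<delta> > 0 \<and> \<tau> \<ge> 0 \<and> bm < bp \<and> \<beta>0 \<in> borel_measurable borel \<and> (\<forall>q. \<beta>0 q \<in> {bm..bp}) \<and>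
    (\<forall>q. \<forall>r\<ge>\<tau>. \<forall>v1 v2. Vform Q (\<theta> r q) (\<psi> r q v1 - \<psi> r q v2) \<ge> 0 \<longrightarrow>
      squeeze \<iota> \<theta> Q \<delta> \<beta>0 q r (\<lambda>s. \<psi> s q v1 - \<psi> s q v2))"


section \<open>Differentiability\<close>

text \<open>The increment \<open>h\<close> ranges over the scalar field \<open>K\<close>.\<close>

definition diff_quotient :: "(complex \<Rightarrow> 'e \<Rightarrow> 'e) \<Rightarrow> (real \<Rightarrow> 'q \<Rightarrow> 'e \<Rightarrow> 'e) \<Rightarrow>
    real \<Rightarrow> 'q \<Rightarrow> 'e::real_normed_vector \<Rightarrow> complex \<Rightarrow> 'e \<Rightarrow> 'e"
  where "diff_quotient scl \<psi> t q v0 h \<xi> =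
    scl (inverse h) (\<psi> t q (v0 + scl h \<xi>) - \<psi> t q v0)"

definition differentiability :: "complex set \<Rightarrow> (complex \<Rightarrow> 'e \<Rightarrow> 'e) \<Rightarrow>
    ('e::real_normed_vector \<Rightarrow> 'h::real_normed_vector) \<Rightarrow>
    (real \<Rightarrow> 'q::metric_space \<Rightarrow> 'q) \<Rightarrow> (real \<Rightarrow> 'q \<Rightarrow> 'e \<Rightarrow> 'e) \<Rightarrow>
    real \<Rightarrow> real \<Rightarrow> (real \<Rightarrow> 'q \<Rightarrow> 'e \<Rightarrow> 'e \<Rightarrow> 'e) \<Rightarrow> bool"
  where "differentiability K scl \<iota> \<theta> \<psi> \<tau> \<gamma> L \<longleftrightarrow>
    (let \<Xi> = (\<lambda>t p. L t (fst p) (snd p)) in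
      semicocycle (skew_product \<theta> \<psi>) \<Xi> \<and>
      uniform_lipschitz \<iota> \<Xi> \<and>
      asymptotically_compact \<gamma> \<Xi>) \<and>
    (\<forall>t\<ge>0. \<forall>q v. linear_over K scl scl (L t q v)) \<and>
    (\<forall>q v0 T B. compact T \<and> T \<subseteq> {0..} \<and> bounded B \<longrightarrow>
      uniform_limit (T \<times> B) (\<lambda>h (t, \<xi>). \<iota> (diff_quotient scl \<psi> t q v0 h \<xi>))
        (\<lambda>(t, \<xi>). \<iota> (L t q v0 \<xi>)) (at 0 within K)) \<and>
    (\<forall>q v0 T B. compact T \<and> T \<subseteq> {\<tau>..} \<and> bounded B \<longrightarrow>
      uniform_limit (T \<times> B) (\<lambda>h (t, \<xi>). diff_quotient scl \<psi> t q v0 h \<xi>)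
        (\<lambda>(t, \<xi>). L t q v0 \<xi>) (at 0 within K)) \<and>
    (\<forall>t\<ge>0. \<forall>q. continuous_on UNIV (\<lambda>v. Blinfun (\<lambda>\<xi>. \<iota> (L t q v \<xi>))))"

definition strengthened_positive_squeezing :: "complex set \<Rightarrow> (complex \<Rightarrow> 'e \<Rightarrow> 'e) \<Rightarrow>
    ('e::real_normed_vector \<Rightarrow> 'h::real_normed_vector) \<Rightarrow>
    (real \<Rightarrow> 'q::metric_space \<Rightarrow> 'q) \<Rightarrow> (real \<Rightarrow> 'q \<Rightarrow> 'e \<Rightarrow> 'e) \<Rightarrow>
    ('q \<Rightarrow> 'e \<Rightarrow>\<^sub>L ('e \<Rightarrow>\<^sub>L complex)) \<Rightarrow> real \<Rightarrow> real \<Rightarrow> real \<Rightarrow> real \<Rightarrow> ('q \<Rightarrow> real) \<Rightarrow>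
    real \<Rightarrow> real \<Rightarrow> ('q \<Rightarrow> real) \<Rightarrow> (real \<Rightarrow> 'q \<Rightarrow> 'e \<Rightarrow> 'e \<Rightarrow> 'e) \<Rightarrow> bool"
  where "strengthened_positive_squeezing K scl \<iota> \<theta> \<psi> Q \<delta> \<tau> am ap \<alpha>0 bm bp \<beta>0 L \<longleftrightarrow>
    positive_squeezing \<iota> \<theta> \<psi> Q \<delta> \<tau> bm bp \<beta>0 \<and>
    ((negative_squeezing \<iota> \<theta> \<psi> Q \<delta> 0 am ap \<alpha>0 \<and>
      positive_squeezing \<iota> \<theta> \<psi> Q \<delta> 0 bm bp \<beta>0 \<and>
      differentiability K scl \<iota> \<theta> \<psi> 0 ap L) \<or>
     (\<forall>q. \<forall>r\<ge>\<tau>. \<forall>v1 v2. squeeze \<iota> \<theta> Q \<delta> \<beta>0 q r (\<lambda>s. \<psi> s q v1 - \<psi> s q v2)) \<or>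
     (\<forall>q v. \<forall>r\<ge>\<tau>. \<forall>\<xi>. Vform Q (\<theta> r q) (L r q v \<xi>) \<ge> 0 \<longrightarrow>
        squeeze \<iota> \<theta> Q \<delta> \<beta>0 q r (\<lambda>s. L s q v \<xi>)))"


section \<open>Positive equivalence\<close>

definition pos_class :: "(real \<Rightarrow> 'q \<Rightarrow> 'q) \<Rightarrow> (real \<Rightarrow> 'q \<Rightarrow> 'e \<Rightarrow> 'e) \<Rightarrow>
    ('q \<Rightarrow> 'e::real_normed_vector \<Rightarrow>\<^sub>L ('e \<Rightarrow>\<^sub>L complex)) \<Rightarrow> 'q \<Rightarrow> 'e \<Rightarrow> 'e set"
  where "pos_class \<theta> \<psi> Q q v0 = {v. \<forall>t\<ge>0. Vform Q (\<theta> t q) (\<psi> t q v - \<psi> t q v0) \<ge> 0}"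

definition lin_pos_class :: "(real \<Rightarrow> 'q \<Rightarrow> 'q) \<Rightarrow> (real \<Rightarrow> 'q \<Rightarrow> 'e \<Rightarrow> 'e \<Rightarrow> 'e) \<Rightarrow>
    ('q \<Rightarrow> 'e::real_normed_vector \<Rightarrow>\<^sub>L ('e \<Rightarrow>\<^sub>L complex)) \<Rightarrow> 'q \<Rightarrow> 'e \<Rightarrow> 'e set"
  where "lin_pos_class \<theta> L Q q v = {\<xi>. \<forall>t\<ge>0. Vform Q (\<theta> t q) (L t q v \<xi>) \<ge> 0}"

definition Phi :: "(real \<Rightarrow> 'q \<Rightarrow> 'q) \<Rightarrow> (real \<Rightarrow> 'q \<Rightarrow> 'e \<Rightarrow> 'e) \<Rightarrow>
    ('q \<Rightarrow> 'e::real_normed_vector \<Rightarrow>\<^sub>L ('e \<Rightarrow>\<^sub>L complex)) \<Rightarrow> ('q \<Rightarrow> 'e set) \<Rightarrow>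
    'q \<Rightarrow> 'e \<Rightarrow> 'e \<Rightarrow> 'e"
  where "Phi \<theta> \<psi> Q Em q v0 = the_inv_into (pos_class \<theta> \<psi> Q q v0) (proj_plus Q Em q)"

definition lin_Phi :: "(real \<Rightarrow> 'q \<Rightarrow> 'q) \<Rightarrow> (real \<Rightarrow> 'q \<Rightarrow> 'e \<Rightarrow> 'e \<Rightarrow> 'e) \<Rightarrow>
    ('q \<Rightarrow> 'e::real_normed_vector \<Rightarrow>\<^sub>L ('e \<Rightarrow>\<^sub>L complex)) \<Rightarrow> ('q \<Rightarrow> 'e set) \<Rightarrow>
    'q \<Rightarrow> 'e \<Rightarrow> 'e \<Rightarrow> 'e"
  where "lin_Phi \<theta> L Q Em q v = the_inv_into (lin_pos_class \<theta> L Q q v) (proj_plus Q Em q)"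


section \<open>Differentiable maps and submanifolds\<close>

text \<open>
  \<open>f'\<close> is a norm-continuous Frechet derivative of \<open>f\<close> on \<open>S\<close>, relative to \<open>S\<close>. It is used with \<open>S\<close>
  open, and with \<open>S\<close> the range of a bounded projector; in the latter case the derivative, a bounded
  operator on the subspace \<open>S\<close>, is precomposed with the projector to get an operator on the whole
  space, which affects neither differentiability nor norm continuity.
\<close>

definition C1_on :: "complex set \<Rightarrow> (complex \<Rightarrow> 'a \<Rightarrow> 'a) \<Rightarrow> (complex \<Rightarrow> 'b \<Rightarrow> 'b) \<Rightarrow>
    'a set \<Rightarrow> ('a::real_normed_vector \<Rightarrow> 'b::real_normed_vector) \<Rightarrow> ('a \<Rightarrow> 'a \<Rightarrow> 'b) \<Rightarrow> bool"
  where "C1_on K sa sb S f f' \<longleftrightarrow>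
    (\<forall>x\<in>S. (f has_derivative f' x) (at x within S) \<and> linear_over K sa sb (f' x)) \<and>
    continuous_on S (\<lambda>x. Blinfun (f' x))"

definition C1_submanifold :: "complex set \<Rightarrow> (complex \<Rightarrow> 'e \<Rightarrow> 'e) \<Rightarrow>
    'e::real_normed_vector set \<Rightarrow> bool"
  where "C1_submanifold K scl S \<longleftrightarrow> (\<forall>p\<in>S. \<exists>U W X Y h g h' g'.
    open U \<and> open W \<and> p \<in> U \<and> direct_sum_over K scl X Y \<and>
    homeomorphism U W h g \<and> C1_on K scl scl U h h' \<and> C1_on K scl scl W g g' \<and>
    h ` (U \<inter> S) = W \<inter> X)"

definition tangent_space :: "'e::real_normed_vector set \<Rightarrow> 'e \<Rightarrow> 'e set"
  where "tangent_space S v = {\<xi>. \<exists>\<epsilon>>0. \<exists>\<gamma> :: real \<Rightarrow> 'e.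
    \<gamma> C1_differentiable_on {-\<epsilon><..<\<epsilon>} \<and> \<gamma> ` {-\<epsilon><..<\<epsilon>} \<subseteq> S \<and> \<gamma> 0 = v \<and>
    (\<gamma> has_vector_derivative \<xi>) (at 0)}"

text \<open>
  A map \<open>f\<close> of the submanifold \<open>S\<close> into \<open>S1\<close> which is Frechet differentiable in \<open>E\<close> relative to \<open>S\<close>,
  the differential at \<open>v \<in> S\<close> being the restriction of \<open>A v\<close> to the tangent space \<open>T v\<close>, with values
  in \<open>T1 (f v)\<close>. The differential depends continuously on the point in the sense that the tangent
  map \<open>(v, \<xi>) \<mapsto> A v \<xi>\<close> is continuous in \<open>E\<close> and \<open>v \<mapsto> A v\<close> is continuous for the operator norm
  from \<open>E\<close> to \<open>H\<close>, the topology in which \<^const>\<open>differentiability\<close> provides continuity.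
\<close>

definition C1_between :: "complex set \<Rightarrow> (complex \<Rightarrow> 'e \<Rightarrow> 'e) \<Rightarrow>
    ('e::real_normed_vector \<Rightarrow> 'h::real_normed_vector) \<Rightarrow> 'e set \<Rightarrow> ('e \<Rightarrow> 'e set) \<Rightarrow>
    'e set \<Rightarrow> ('e \<Rightarrow> 'e set) \<Rightarrow> ('e \<Rightarrow> 'e) \<Rightarrow> ('e \<Rightarrow> 'e \<Rightarrow> 'e) \<Rightarrow> bool"
  where "C1_between K scl \<iota> S T S1 T1 f A \<longleftrightarrow>
    f ` S \<subseteq> S1 \<and>
    (\<forall>v\<in>S. (f has_derivative A v) (at v within S) \<and> linear_over K scl scl (A v) \<and>
       A v ` T v \<subseteq> T1 (f v)) \<and>
    continuous_on (SIGMA v:S. T v) (\<lambda>(v, \<xi>). A v \<xi>) \<and>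
    continuous_on S (\<lambda>v. Blinfun (\<lambda>\<xi>. \<iota> (A v \<xi>)))"

end

theory Submission
  imports Defs
begin

text \<open>
  Write \<open>W\<^sub>t(\<xi>) = V(L(t;q,v) \<xi>)\<close>, the form taken at the point of the base reached at time \<open>t\<close>. The
  linear positive class of \<open>v\<close> consists of the vectors on which all \<open>W\<^sub>t\<close> are nonnegative.
  Dividing the negative squeezing inequality for the points \<open>v + h \<xi>\<close> and \<open>v\<close> by \<open>h\<^sup>2\<close> and letting
  \<open>h\<close> tend to \<open>0\<close> shows that, along a time step of a fixed length \<open>d\<close>, the cones \<open>W \<le> 0\<close> increase
  strictly: \<open>W\<^sub>t(\<xi>) \<le> 0\<close> implies \<open>W\<^bsub>t+d\<^esub>(\<xi>) + c S(\<xi>) \<le> 0\<close>, where \<open>S\<close> is the squared Hilbert norm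
  of \<open>L \<xi>\<close> at an intermediate time and, by the smoothing part of the Lipschitz property, bounds
  \<open>|W\<^bsub>t+d\<^esub>|\<close> from above (lemma \<open>one_step_squeezing\<close>).

  For quadratic forms such an inclusion of cones is an inequality of ratios: if \<open>A \<le> 0\<close> implies
  \<open>B \<le> 0\<close>, then \<open>B/A\<close> is at most as large at a vector where \<open>A\<close> is positive as at a vector where
  \<open>A\<close> is negative (\<open>cone_inclusion_ratio\<close>, a form of the S-lemma). Iterating, a vector of the
  positive class is dominated at a geometric rate by every vector on which the form is negative
  (\<open>dominated\<close>). The rate depends neither on the base point nor on the vectors. Everything else is
  a consequence of this domination, of the parallelogram identity and of the finite dimension of
  \<open>E\<^sup>-(q)\<close>, which makes the shells \<open>\<epsilon> \<le> |y| \<le> R\<close> of \<open>E\<^sup>-(q)\<close> compact.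

  If two vectors of the linear class had a difference \<open>y\<close> outside the class, then \<open>W\<close> of their sum
  would be at least \<open>-W(y)\<close> and also negligible against it; hence the class is a linear space. It
  meets \<open>E\<^sup>-(q)\<close> in \<open>0\<close>, and limits of difference quotients of \<open>\<Phi>\<close> lie in it, so it is a graph
  over \<open>E\<^sup>+(q)\<close>. The same argument with an error term shows that a vector which differs from the
  linear class by an element of \<open>E\<^sup>-(q)\<close> of norm at least \<open>\<epsilon>\<close> has \<open>W\<^sub>T \<le> -\<mu>\<close> at one time \<open>T\<close>
  (\<open>class_gap\<close>). Difference quotients of \<open>\<Phi>\<close>, on the other hand, have \<open>W\<^sub>T\<close> almost nonnegative,
  uniformly in the direction, because nonlinear differences inside the class have nonnegative
  form; so \<open>\<Phi>\<close> is Frechet differentiable with the differential \<open>\<Phi>'\<close>. For the norm continuity of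
  the differential, only continuity of \<open>L\<close> into the operators from \<open>E\<close> to the Hilbert space is at
  hand; it suffices since domination also holds for the energies \<open>S\<close>, which are continuous in that
  topology (\<open>class_stability\<close>).

  Finally \<open>v \<mapsto> v - \<Pi> \<Phi>(\<Pi>\<^sup>+ v)\<close> is a global chart which flattens the class onto \<open>E\<^sup>+(q)\<close>, and the
  tangent spaces are found by differentiating \<open>\<gamma> = \<Phi>(\<Pi>\<^sup>+ \<gamma>)\<close> along curves \<open>\<gamma>\<close> in the class.
\<close>

section \<open>Quadratic forms and nested cones\<close>

definition quadratic_form :: "('a::real_vector \<Rightarrow> real) \<Rightarrow> bool"
  where "quadratic_form f \<longleftrightarrow>
    (\<exists>b. bilinear b \<and> (\<forall>x y. b x y = b y x) \<and> (\<forall>x. f x = b x x))"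

lemma quadratic_formE:
  assumes "quadratic_form f"
  obtains b where "\<And>x y s. f (x + s *\<^sub>R y) = f x + 2 * s * b x y + s\<^sup>2 * f y"
proof -
  obtain b where b: "bilinear b" "\<And>x y. b x y = b y x" "\<And>x. f x = b x x"
    using assms unfolding quadratic_form_def by blast
  have "f (x + s *\<^sub>R y) = f x + 2 * s * b x y + s\<^sup>2 * f y" for x y s
    using b(2)[of x y]
    by (simp add: b(3) bilinear_ladd[OF b(1)] bilinear_radd[OF b(1)] bilinear_lmul[OF b(1)]
        bilinear_rmul[OF b(1)] power2_eq_square algebra_simps)
  thus ?thesis using that by blast
qed

lemma quadratic_form_parallelogram:
  assumes "quadratic_form f"
  shows "f (x + y) + f (x - y) = 2 * f x + 2 * f y"
proof -
  obtain b where "\<And>x y s. f (x + s *\<^sub>R y) = f x + 2 * s * b x y + s\<^sup>2 * f y"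
    using quadratic_formE[OF assms] by blast
  from this[of x 1 y] this[of x "-1" y] show ?thesis by simp
qed

lemma quadratic_form_add_scaled:
  assumes "quadratic_form f" "quadratic_form g"
  shows "quadratic_form (\<lambda>x. f x + c * g x)"
proof -
  obtain b where b: "bilinear b" "\<And>x y. b x y = b y x" "\<And>x. f x = b x x"
    using assms(1) unfolding quadratic_form_def by blast
  obtain d where d: "bilinear d" "\<And>x y. d x y = d y x" "\<And>x. g x = d x x"
    using assms(2) unfolding quadratic_form_def by blast
  have "bilinear (\<lambda>x y. b x y + c * d x y)"
    using b(1) d(1) unfolding bilinear_def linear_iff
    by (simp add: algebra_simps)
  thus ?thesis unfolding quadratic_form_def using b(2,3) d(2,3)
    by (intro exI[of _ "\<lambda>x y. b x y + c * d x y"]) simp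
qed

text \<open>
  Let \<open>A x > 0\<close>. On the line \<open>x + s y\<close> the form \<open>A\<close> is a quadratic polynomial in \<open>s\<close> with two
  roots of opposite sign, and \<open>B \<le> 0\<close> at both. The positive combination of these two inequalities
  which eliminates the mixed term of \<open>B\<close> is the claim.
\<close>

lemma cone_inclusion_ratio:
  fixes A B :: "'a::real_vector \<Rightarrow> real"
  assumes "quadratic_form A" "quadratic_form B"
    and incl: "\<And>z. A z \<le> 0 \<Longrightarrow> B z \<le> 0"
    and x: "A x \<ge> 0" and y: "A y < 0"
  shows "B x * (- A y) \<le> A x * (- B y)"
proof (cases "A x = 0")
  case True
  thus ?thesis using incl[of x] y by (simp add: mult_nonpos_nonpos)
next
  case False
  obtain p where p: "\<And>x y s. A (x + s *\<^sub>R y) = A x + 2 * s * p x y + s\<^sup>2 * A y"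
    using quadratic_formE[OF assms(1)] by blast
  obtain \<beta> where \<beta>: "\<And>x y s. B (x + s *\<^sub>R y) = B x + 2 * s * \<beta> x y + s\<^sup>2 * B y"
    using quadratic_formE[OF assms(2)] by blast
  define d where "d = - A y"
  define w where "w = sqrt ((p x y)\<^sup>2 + A x * d)"
  have pos: "A x > 0" "d > 0" using False x y by (auto simp: d_def)
  have w2: "w\<^sup>2 = (p x y)\<^sup>2 + A x * d" using pos by (simp add: w_def)
  have wgt: "w > \<bar>p x y\<bar>"
    unfolding w_def using pos by (intro real_less_rsqrt) simp
  \<comment> \<open>the line through \<open>x\<close> in direction \<open>y\<close> crosses the null cone of \<open>A\<close> at these two parameters\<close>
  define s1 where "s1 = (p x y + w) / d"
  define s2 where "s2 = (p x y - w) / d"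
  have root: "A (x + s *\<^sub>R y) = 0" if "d * s = p x y + w \<or> d * s = p x y - w" for s
  proof -
    have "d * (A x + 2 * s * p x y - d * s\<^sup>2) = A x * d + 2 * (d * s) * p x y - (d * s)\<^sup>2"
      by (simp add: power2_eq_square algebra_simps)
    also have "\<dots> = w\<^sup>2 - (d * s - p x y)\<^sup>2"
      unfolding w2 by (simp add: power2_eq_square algebra_simps)
    also have "\<dots> = 0"
    proof -
      have "d * s - p x y = w \<or> d * s - p x y = - w" using that by linarith
      thus ?thesis by (metis diff_self power2_minus)
    qed
    finally show ?thesis using pos by (simp add: p d_def mult.commute[of _ "A y"])
  qed
  have B1: "B x + 2 * s1 * \<beta> x y + s1\<^sup>2 * B y \<le> 0"
    using incl[of "x + s1 *\<^sub>R y"] root[of s1] pos by (simp add: \<beta> s1_def)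
  have B2: "B x + 2 * s2 * \<beta> x y + s2\<^sup>2 * B y \<le> 0"
    using incl[of "x + s2 *\<^sub>R y"] root[of s2] pos by (simp add: \<beta> s2_def)
  have sgn: "s1 > 0" "s2 < 0" using wgt pos by (auto simp: s1_def s2_def field_simps)
  have "s1 * s2 = ((p x y)\<^sup>2 - w\<^sup>2) / d\<^sup>2"
    by (simp add: s1_def s2_def power2_eq_square algebra_simps)
  also have "(p x y)\<^sup>2 - w\<^sup>2 = - A x * d" unfolding w2 by simp
  finally have prod: "s1 * s2 = - A x / d"
    using pos by (simp add: power2_eq_square)
  \<comment> \<open>the weights cancel the mixed terms: \<open>- s2 * s1 + s1 * s2 = 0\<close>\<close>
  have "(- s2) * (B x + 2 * s1 * \<beta> x y + s1\<^sup>2 * B y) + s1 * (B x + 2 * s2 * \<beta> x y + s2\<^sup>2 * B y) \<le> 0"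
    by (rule add_nonpos_nonpos; rule mult_nonneg_nonpos) (use B1 B2 sgn in auto)
  hence "(s1 - s2) * (B x - (s1 * s2) * B y) \<le> 0"
    by (simp add: power2_eq_square algebra_simps)
  hence "B x - (s1 * s2) * B y \<le> 0" using sgn by (simp add: mult_le_0_iff)
  hence "B x + A x / d * B y \<le> 0" by (simp add: prod)
  hence "d * (B x + A x / d * B y) \<le> 0" using pos by (simp add: mult_le_0_iff)
  hence "d * B x + A x * B y \<le> 0" using pos by (simp add: algebra_simps)
  thus ?thesis by (simp add: d_def algebra_simps)
qed

text \<open>
  \<open>W n\<close> models the form at time \<open>n\<close> along an orbit and \<open>S n\<close> the energy at a time between \<open>n\<close> and
  \<open>n + 1\<close>: the energy is both the margin by which the nonpositive cones increase and, by
  smoothing, a bound for the next form on vectors of either sign.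
\<close>

locale squeezed_forms =
  fixes W S :: "nat \<Rightarrow> 'a::real_vector \<Rightarrow> real" and c C :: real
  assumes W_quadratic: "quadratic_form (W n)"
    and S_quadratic: "quadratic_form (S n)"
    and S_nonneg: "S n x \<ge> 0"
    and c_pos: "c > 0" and C_pos: "C > 0"
    and squeezed: "W n x \<le> 0 \<Longrightarrow> W (Suc n) x + c * S n x \<le> 0"
    and strict: "W n x < 0 \<Longrightarrow> W (Suc n) x < 0"
    and smoothing: "\<bar>W (Suc n) x\<bar> \<le> C * S n x"
begin

definition rate :: real where "rate = C / (C + c)"

lemma rate_bounds: "0 < rate" "rate < 1"
  using c_pos C_pos by (auto simp: rate_def)

lemma stays_negative: "W n x < 0 \<Longrightarrow> W (n + k) x < 0"
  by (induction k) (auto intro: strict)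

lemma stays_nonpositive: "W n x \<le> 0 \<Longrightarrow> W (n + k) x \<le> 0"
proof (induction k)
  case (Suc k)
  have "0 \<le> c * S (n + k) x" using S_nonneg c_pos by simp
  with squeezed[of "n + k" x] Suc show ?case by simp
qed auto

text \<open>
  The ratio comparison for \<open>A = W n\<close> and \<open>B = W (Suc n) + c * S n\<close>: the margin stays on the side
  of \<open>x\<close>, where it will be turned into decay.
\<close>

lemma step_ratio:
  assumes "W n x \<ge> 0" "W n y < 0"
  shows "(W (Suc n) x + c * S n x) * (- W n y) \<le> W n x * (- W (Suc n) y)"
proof -
  have "(W (Suc n) x + c * S n x) * (- W n y) \<le> W n x * (- (W (Suc n) y + c * S n y))"
    by (rule cone_inclusion_ratio[OF W_quadratic quadratic_form_add_scaled[OF W_quadratic S_quadratic]])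
      (use assms squeezed in auto)
  also have "\<dots> \<le> W n x * (- W (Suc n) y)"
    using assms S_nonneg c_pos by (intro mult_left_mono) auto
  finally show ?thesis .
qed

text \<open>
  While \<open>W x\<close> is nonnegative, \<open>c * S m x \<ge> (c / C) * W (Suc m) x\<close>; so each step lowers the
  quotient of \<open>W x\<close> by \<open>- W y\<close> by the factor \<open>1 / (1 + c / C)\<close>, which is \<open>rate\<close>.
\<close>

lemma dominated:
  assumes "\<And>k. k \<le> m \<Longrightarrow> W k x \<ge> 0" "W 0 y < 0"
  shows "W m x * (- W 0 y) \<le> rate ^ m * W 0 x * (- W m y)"
  using assms(1)
proof (induction m)
  case (Suc m)
  have neg: "W m y < 0" "W (Suc m) y < 0"
    using stays_negative[OF assms(2), of m] stays_negative[OF assms(2), of "Suc m"] by simp_all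
  have pos: "W m x \<ge> 0" "W (Suc m) x \<ge> 0" using Suc.prems by auto
  have "c / C * W (Suc m) x \<le> c * S m x"
    using smoothing[of m x] pos c_pos C_pos by (simp add: field_simps)
  hence "(1 + c / C) * W (Suc m) x * (- W m y) \<le> (W (Suc m) x + c * S m x) * (- W m y)"
    using neg by (intro mult_right_mono) (auto simp: algebra_simps)
  also have "\<dots> \<le> W m x * (- W (Suc m) y)" by (rule step_ratio[OF pos(1) neg(1)])
  finally have "rate * ((1 + c / C) * W (Suc m) x * (- W m y)) \<le> rate * (W m x * (- W (Suc m) y))"
    using rate_bounds by (intro mult_left_mono) auto
  moreover have "rate * (1 + c / C) = 1"
  proof -
    have "1 + c / C = (C + c) / C" using C_pos by (simp add: add_divide_distrib)
    thus ?thesis using c_pos C_pos by (simp add: rate_def)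
  qed
  ultimately have step: "W (Suc m) x * (- W m y) \<le> rate * (W m x * (- W (Suc m) y))"
    by (metis mult.assoc mult_1)
  have "W (Suc m) x * (- W 0 y) * (- W m y) = W (Suc m) x * (- W m y) * (- W 0 y)" by simp
  also have "\<dots> \<le> rate * (W m x * (- W (Suc m) y)) * (- W 0 y)"
    using step assms(2) by (intro mult_right_mono) auto
  also have "\<dots> = rate * (- W (Suc m) y) * (W m x * (- W 0 y))" by simp
  also have "\<dots> \<le> rate * (- W (Suc m) y) * (rate ^ m * W 0 x * (- W m y))"
    using Suc rate_bounds neg by (intro mult_left_mono) (auto simp: mult_le_0_iff)
  also have "\<dots> = rate ^ Suc m * W 0 x * (- W (Suc m) y) * (- W m y)" by simp
  finally show ?case using neg(1) by (simp add: mult_le_cancel_right)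
qed simp

text \<open>
  Domination for energies. In the application they are squares of seminorms, and they depend
  continuously on the base point even when the linear maps are only continuous as operators into
  the Hilbert space.
\<close>

lemma dominated_smooth:
  assumes "\<And>k. k \<le> Suc m \<Longrightarrow> W k x \<ge> 0" "W 0 y < 0"
  shows "c * S m x * (- W 0 y) \<le> rate ^ m * W 0 x * (- W (Suc m) y)"
proof -
  have neg: "W m y < 0" "W (Suc m) y < 0"
    using stays_negative[OF assms(2), of m] stays_negative[OF assms(2), of "Suc m"] by simp_all
  have pos: "W m x \<ge> 0" "W (Suc m) x \<ge> 0" using assms(1) by auto
  have "c * S m x * (- W m y) \<le> (W (Suc m) x + c * S m x) * (- W m y)"
    using pos neg by (intro mult_right_mono) auto
  also have "\<dots> \<le> W m x * (- W (Suc m) y)" by (rule step_ratio[OF pos(1) neg(1)])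
  finally have step: "c * S m x * (- W m y) \<le> W m x * (- W (Suc m) y)" .
  have "c * S m x * (- W 0 y) * (- W m y) = c * S m x * (- W m y) * (- W 0 y)" by simp
  also have "\<dots> \<le> W m x * (- W (Suc m) y) * (- W 0 y)"
    using step assms(2) by (intro mult_right_mono) auto
  also have "\<dots> = (- W (Suc m) y) * (W m x * (- W 0 y))" by simp
  also have "\<dots> \<le> (- W (Suc m) y) * (rate ^ m * W 0 x * (- W m y))"
    using neg assms(1) by (intro mult_left_mono dominated[OF _ assms(2)]) auto
  also have "\<dots> = rate ^ m * W 0 x * (- W (Suc m) y) * (- W m y)" by simp
  finally show ?thesis using neg(1) by (simp add: mult_le_cancel_right)
qed

text \<open>
  Meant for \<open>x = w + \<xi>\<close> and \<open>y = w - \<xi>\<close>, with \<open>\<xi>\<close> positive at all times and \<open>W m w \<ge> - \<epsilon>\<close>: the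
  parallelogram identity then gives \<open>sum\<close>. By domination \<open>W m x\<close> is at most half of \<open>- W m y\<close>,
  hence \<open>\<epsilon>\<close> has to pay for the rest.
\<close>

lemma difference_almost_null:
  assumes y: "W 0 y < 0" and small: "2 * rate ^ m * W 0 x \<le> - W 0 y"
    and sum: "W m x + W m y \<ge> - 2 * \<epsilon>"
  shows "- W m y \<le> 4 * \<epsilon>"
proof (cases "W m x \<le> 0")
  case True
  have "W m y < 0" using stays_negative[OF y, of m] by simp
  thus ?thesis using True sum by simp
next
  case False
  have pos: "W k x \<ge> 0" if "k \<le> m" for k
    using stays_nonpositive[of k x "m - k"] that False by force
  have neg: "W m y < 0" using stays_negative[OF y, of m] by simp
  have "2 * W m x * (- W 0 y) \<le> 2 * (rate ^ m * W 0 x * (- W m y))"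
    using dominated[of m x y] pos y by fastforce
  also have "\<dots> = 2 * rate ^ m * W 0 x * (- W m y)" by simp
  also have "\<dots> \<le> (- W 0 y) * (- W m y)"
    using small neg by (intro mult_right_mono) auto
  finally have "2 * W m x * (- W 0 y) \<le> (- W m y) * (- W 0 y)" by (simp only: mult.commute)
  hence "2 * W m x \<le> - W m y" using y by (meson mult_right_le_imp_le neg_0_less_iff_less)
  thus ?thesis using sum by simp
qed

text \<open>
  Bounding \<open>- W (Suc m) y\<close> by \<open>C * S m y\<close> leaves a comparison of energies alone, which carries
  over between neighbouring base points. The factor \<open>16\<close> becomes \<open>4\<close> for norms.
\<close>

lemma smooth_part_small:
  assumes x: "\<And>k. k \<le> Suc m \<Longrightarrow> W k x \<ge> 0" "W 0 x \<le> B" and y: "W 0 y \<le> - \<mu>" "\<mu> > 0"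
    and small: "16 * (rate ^ m * B * C) \<le> c * \<mu>"
  shows "16 * S m x \<le> S m y"
proof -
  have neg: "W 0 y < 0" using y by simp
  have "c * \<mu> * S m x \<le> c * S m x * (- W 0 y)"
    using mult_left_mono[OF y(1), of "c * S m x"] S_nonneg[of m x] c_pos
    by (simp add: ac_simps)
  also have "\<dots> \<le> rate ^ m * W 0 x * (- W (Suc m) y)" by (rule dominated_smooth[OF x(1) neg])
  also have "\<dots> \<le> rate ^ m * W 0 x * (C * S m y)"
    using smoothing[of m y] x(1)[of 0] rate_bounds by (intro mult_left_mono) auto
  also have "\<dots> \<le> rate ^ m * B * (C * S m y)"
    using x(2) rate_bounds S_nonneg[of m y] C_pos by (intro mult_right_mono mult_left_mono) auto
  finally have "16 * (c * \<mu> * S m x) \<le> 16 * (rate ^ m * B * C) * S m y" by simp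
  also have "\<dots> \<le> c * \<mu> * S m y" using small S_nonneg by (intro mult_right_mono) auto
  finally have "(c * \<mu>) * (16 * S m x) \<le> (c * \<mu>) * S m y" by simp
  thus ?thesis using c_pos y(2) by (simp only: mult_le_cancel_left_pos mult_pos_pos)
qed

lemma rate_power_small: "d > 0 \<Longrightarrow> eventually (\<lambda>m. rate ^ m * B \<le> d) sequentially"
proof -
  assume d: "d > 0"
  have "(\<lambda>m. rate ^ m * B) \<longlonglongrightarrow> 0 * B"
    using rate_bounds by (intro tendsto_mult LIMSEQ_power_zero tendsto_const) auto
  hence "eventually (\<lambda>m. rate ^ m * B < d) sequentially" using d by (intro order_tendstoD) auto
  thus ?thesis by (rule eventually_mono) simp
qed

lemma difference_nonneg_initial:
  assumes "\<And>n. W n x \<ge> 0" "\<And>n. W n y \<ge> 0"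
  shows "W 0 (x - y) \<ge> 0"
proof (rule ccontr)
  assume "\<not> W 0 (x - y) \<ge> 0"
  hence neg: "W 0 (x - y) < 0" by simp
  obtain m where m: "rate ^ m * (2 * W 0 (x + y)) \<le> - W 0 (x - y)"
    using rate_power_small[of "- W 0 (x - y)" "2 * W 0 (x + y)"] neg
    by (auto simp: eventually_sequentially)
  have "W m (x + y) + W m (x - y) \<ge> - 2 * 0"
    using quadratic_form_parallelogram[OF W_quadratic[of m], of x y] assms by simp
  hence "- W m (x - y) \<le> 4 * 0"
    using m by (intro difference_almost_null[OF neg, of m "x + y"]) (simp_all add: algebra_simps)
  with stays_negative[OF neg, of m] show False by simp
qed

lemma shifted: "squeezed_forms (\<lambda>n. W (n + k)) (\<lambda>n. S (n + k)) c C"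
  by unfold_locales
    (use W_quadratic S_quadratic S_nonneg c_pos C_pos squeezed strict smoothing in auto)

text \<open>
  For vectors that stay positive the case \<open>\<epsilon> = 0\<close> of almost-null differences, started at an
  arbitrary time \<open>k\<close>, excludes a negative difference.
\<close>

lemma difference_nonneg:
  assumes "\<And>n. W n x \<ge> 0" "\<And>n. W n y \<ge> 0"
  shows "W k (x - y) \<ge> 0"
  using squeezed_forms.difference_nonneg_initial[OF shifted[of k], of x y] assms by simp

end

section \<open>Splittings by negative subspaces of finite dimension\<close>

text \<open>
  This replaces inner product geometry on the finite-dimensional negative space: with such a
  spanning set, the orthogonal projection, the coercivity of the form and the compactness of balls
  are explicit.
\<close>

lemma orthonormal_spanning_set:
  fixes b :: "'a::real_vector \<Rightarrow> 'a \<Rightarrow> real"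
  assumes b: "bilinear b" "\<And>x y. b x y = b y x"
    and "finite B" and "\<And>u. u \<in> span B \<Longrightarrow> u \<noteq> 0 \<Longrightarrow> b u u < 0"
  shows "\<exists>F. finite F \<and> span F = span B \<and> (\<forall>e\<in>F. b e e = -1) \<and>
    (\<forall>e\<in>F. \<forall>e'\<in>F. e \<noteq> e' \<longrightarrow> b e e' = 0)"
  using assms(3,4)
proof (induction B rule: finite_induct)
  case empty
  show ?case by (intro exI[of _ "{}"]) simp
next
  case (insert a B)
  have "span B \<subseteq> span (insert a B)" by (intro span_mono) auto
  with insert obtain F where F: "finite F" "span F = span B" "\<And>e. e \<in> F \<Longrightarrow> b e e = -1"
      "\<And>e e'. e \<in> F \<Longrightarrow> e' \<in> F \<Longrightarrow> e \<noteq> e' \<Longrightarrow> b e e' = 0"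
    by (metis subsetD)
  \<comment> \<open>one step of the Gram-Schmidt process; the form is negative, hence the sign\<close>
  define s where "s = (\<Sum>e\<in>F. b e a *\<^sub>R e)"
  define a' where "a' = a + s"
  have s: "s \<in> span F" unfolding s_def by (intro span_sum span_scale span_base)
  have linb: "linear (b x)" for x using b(1) by (simp add: bilinear_def)
  have orth: "b e a' = 0" if "e \<in> F" for e
  proof -
    have "b e s = (\<Sum>e'\<in>F. b e' a * b e e')"
      unfolding s_def by (simp add: linear_sum[OF linb] linear_cmul[OF linb])
    also have "\<dots> = (\<Sum>e'\<in>F. if e' = e then - b e a else 0)"
      using F(3,4) that by (intro sum.cong) auto
    also have "\<dots> = - b e a" using F(1) that by simp
    finally show ?thesis by (simp add: a'_def linear_add[OF linb])
  qed
  have span': "span (insert a' F) = span (insert a B)"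
  proof -
    have "a' \<in> span (insert a F)"
      unfolding a'_def using s span_mono[of F "insert a F"] by (auto intro: span_add span_base)
    moreover have "a' - s \<in> span (insert a' F)"
      using s span_mono[of F "insert a' F"] by (intro span_diff) (auto intro: span_base)
    hence "a \<in> span (insert a' F)" by (simp add: a'_def)
    ultimately have "span (insert a' F) = span (insert a F)"
      unfolding span_eq by (auto intro: span_base)
    also have "\<dots> = span (insert a B)" using F(2) by (simp add: span_insert)
    finally show ?thesis .
  qed
  show ?case
  proof (cases "a' = 0")
    case True
    thus ?thesis using F span' by (intro exI[of _ F]) auto
  next
    case False
    have "a' \<in> span (insert a B)" using span' by (metis insertI1 span_base)
    hence neg: "b a' a' < 0" using insert.prems False by blast
    define r where "r = inverse (sqrt (- b a' a'))"
    have r: "r \<noteq> 0" "r\<^sup>2 * (- b a' a') = 1"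
      using neg by (auto simp: r_def power_inverse)
    define e where "e = r *\<^sub>R a'"
    have "b e e = r\<^sup>2 * b a' a'"
      by (simp add: e_def bilinear_lmul[OF b(1)] bilinear_rmul[OF b(1)] power2_eq_square)
    hence ee: "b e e = -1" using r(2) by simp
    have eo: "b e' e = 0" if "e' \<in> F" for e'
      using orth[OF that] by (simp add: e_def linear_cmul[OF linb])
    have "a' = inverse r *\<^sub>R e" using r by (simp add: e_def)
    hence "a' \<in> span (insert e F)" by (metis insertI1 span_base span_scale)
    moreover have "e \<in> span (insert a' F)" by (metis e_def insertI1 span_base span_scale)
    ultimately have "span (insert e F) = span (insert a' F)"
      unfolding span_eq by (auto intro: span_base)
    thus ?thesis using F ee eo b(2) span' by (intro exI[of _ "insert e F"]) auto
  qed
qed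

lemma compact_bounded_combinations:
  fixes F :: "'a::real_normed_vector set"
  assumes "finite F"
  shows "\<exists>D. compact D \<and> (\<forall>a. (\<forall>e\<in>F. \<bar>a e\<bar> \<le> M) \<longrightarrow> (\<Sum>e\<in>F. a e *\<^sub>R e) \<in> D)"
  using assms
proof (induction F rule: finite_induct)
  case empty
  show ?case by (intro exI[of _ "{0}"]) auto
next
  case (insert e F)
  obtain D where D: "compact D" "\<forall>a. (\<forall>e\<in>F. \<bar>a e\<bar> \<le> M) \<longrightarrow> (\<Sum>e\<in>F. a e *\<^sub>R e) \<in> D"
    using insert.IH by blast
  have "compact ((\<lambda>r. r *\<^sub>R e) ` {-M..M})"
    by (intro compact_continuous_image continuous_intros compact_Icc)
  from compact_sums[OF this D(1)] show ?case
  proof (intro exI conjI allI impI)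
    fix a assume a: "\<forall>e'\<in>insert e F. \<bar>a e'\<bar> \<le> M"
    hence "a e \<in> {-M..M}" by auto
    moreover have "(\<Sum>e'\<in>F. a e' *\<^sub>R e') \<in> D" using a D(2) by simp
    ultimately show "(\<Sum>e'\<in>insert e F. a e' *\<^sub>R e')
        \<in> {x + y |x y. x \<in> (\<lambda>r. r *\<^sub>R e) ` {-M..M} \<and> y \<in> D}"
      unfolding sum.insert[OF insert.hyps] by blast
  qed
qed

text \<open>
  The real part of the sesquilinear form; it determines the form, and the theory of real bilinear
  forms applies to it in the real and in the complex case alike.
\<close>

definition re_form :: "('q \<Rightarrow> 'e::real_normed_vector \<Rightarrow>\<^sub>L ('e \<Rightarrow>\<^sub>L complex)) \<Rightarrow> 'q \<Rightarrow> 'e \<Rightarrow> 'e \<Rightarrow> real"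
  where "re_form Q q w v = Re (pairing w (blinfun_apply (Q q) v))"

lemma re_form_bilinear: "bilinear (re_form Q q)"
  unfolding bilinear_def linear_iff re_form_def pairing_def
  by (simp add: blinfun.bilinear_simps)

lemma bounded_linear_re_form: "bounded_linear (re_form Q q w)"
  unfolding re_form_def pairing_def
  by (rule bounded_linear_compose[OF bounded_linear_Re
        bounded_linear_compose[OF blinfun.bounded_linear_left blinfun.bounded_linear_right]])

lemma Vform_re_form: "Vform Q q v = re_form Q q v v"
  by (simp add: Vform_def re_form_def)

lemma abs_re_form_le: "\<bar>re_form Q q w v\<bar> \<le> norm (Q q) * norm w * norm v"
proof -
  have "\<bar>re_form Q q w v\<bar> \<le> norm (blinfun_apply (blinfun_apply (Q q) v) w)"
    unfolding re_form_def pairing_def by (rule abs_Re_le_cmod)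
  also have "\<dots> \<le> norm (blinfun_apply (Q q) v) * norm w" by (rule norm_blinfun)
  also have "\<dots> \<le> norm (Q q) * norm v * norm w"
    by (intro mult_right_mono norm_blinfun) auto
  finally show ?thesis by (simp add: ac_simps)
qed

lemma abs_Vform_le: "\<bar>Vform Q q v\<bar> \<le> norm (Q q) * (norm v)\<^sup>2"
  using abs_re_form_le[of Q q v v] by (simp add: Vform_re_form power2_eq_square mult.assoc)

lemma Vform_scaleR: "Vform Q q (r *\<^sub>R v) = r\<^sup>2 * Vform Q q v"
  by (simp add: Vform_re_form bilinear_lmul[OF re_form_bilinear] bilinear_rmul[OF re_form_bilinear]
      power2_eq_square)

lemma continuous_on_Vform: "continuous_on S (Vform Q q)"
  unfolding Vform_def pairing_def
  by (intro continuous_intros)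

lemma tendsto_Vform: "(f \<longlongrightarrow> l) F \<Longrightarrow> ((\<lambda>x. Vform Q q (f x)) \<longlongrightarrow> Vform Q q l) F"
  using continuous_on_tendsto_compose[OF continuous_on_Vform[of UNIV Q q], of f l F] by simp

locale indefinite_forms =
  fixes K :: "complex set" and scl :: "complex \<Rightarrow> 'e::real_normed_vector \<Rightarrow> 'e"
    and j :: nat and Q :: "'q \<Rightarrow> 'e \<Rightarrow>\<^sub>L ('e \<Rightarrow>\<^sub>L complex)" and Em :: "'q \<Rightarrow> 'e set"
  assumes space: "normed_space_over K scl"
    and forms: "quadratic_forms K scl j Q Em"
begin

abbreviation V where "V \<equiv> Vform Q"
abbreviation b where "b \<equiv> re_form Q"
abbreviation \<pi>m where "\<pi>m \<equiv> proj Q Em"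
abbreviation \<pi>p where "\<pi>p \<equiv> proj_plus Q Em"
abbreviation Ep where "Ep \<equiv> E_plus Q Em"

lemma K_cases: "K = \<real> \<or> K = UNIV"
  using space unfolding normed_space_over_def by blast

lemma scl_of_real: "scl (complex_of_real r) v = r *\<^sub>R v"
  using space unfolding normed_space_over_def by blast

lemma of_real_in_K: "complex_of_real r \<in> K"
  using K_cases by auto

lemma scl_add_left: "x \<in> K \<Longrightarrow> y \<in> K \<Longrightarrow> scl (x + y) v = scl x v + scl y v"
  using space unfolding normed_space_over_def by blast

lemma scl_add_right: "x \<in> K \<Longrightarrow> scl x (v + w) = scl x v + scl x w"
  using space unfolding normed_space_over_def by blast

lemma scl_mult: "x \<in> K \<Longrightarrow> y \<in> K \<Longrightarrow> scl (x * y) v = scl x (scl y v)"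
  using space unfolding normed_space_over_def by blast

lemma scl_diff_right: assumes "x \<in> K" shows "scl x (v - w) = scl x v - scl x w"
  using scl_add_right[OF assms, of "v - w" w] by simp

lemma scl_zero: "x \<in> K \<Longrightarrow> scl x 0 = 0"
  using scl_add_right[of x 0 0] by simp

lemma subspace_over_real:
  assumes "subspace_over K scl X" shows "subspace X"
  unfolding subspace_def
proof (intro conjI ballI allI)
  fix r x assume "x \<in> X"
  hence "scl (complex_of_real r) x \<in> X"
    using assms of_real_in_K unfolding subspace_over_def by blast
  thus "r *\<^sub>R x \<in> X" by (simp add: scl_of_real)
qed (use assms in \<open>auto simp: subspace_over_def\<close>)

lemma linear_over_real:
  assumes "linear_over K scl scl f" shows "linear f"
proof (rule linearI)
  show "f (x + y) = f x + f y" for x y using assms unfolding linear_over_def by blast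
  show "f (r *\<^sub>R x) = r *\<^sub>R f x" for r x
    using assms of_real_in_K unfolding linear_over_def by (metis scl_of_real)
qed

lemmas forms_unfolded = forms[unfolded quadratic_forms_def]
lemmas forms_antidual = forms_unfolded[THEN conjunct1, rule_format]
lemmas pairing_scl_right = forms_unfolded[THEN conjunct2, THEN conjunct1, rule_format]
lemmas pairing_hermitian =
  forms_unfolded[THEN conjunct2, THEN conjunct2, THEN conjunct1, rule_format]
lemmas forms_splitting =
  forms_unfolded[THEN conjunct2, THEN conjunct2, THEN conjunct2, THEN conjunct1, rule_format]

lemma b_sym: "b q v w = b q w v"
  unfolding re_form_def by (subst pairing_hermitian) simp

lemma b_linear: "linear (b q w)"
  using re_form_bilinear[of Q q] by (simp add: bilinear_def)

lemma Vform_real: "pairing v (Q q v) = complex_of_real (V q v)"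
  unfolding Vform_def using pairing_hermitian[of v q v]
  by (metis Reals_cnj_iff complex_is_Real_iff of_real_Re)

lemma pairing_scl_left: "x \<in> K \<Longrightarrow> pairing (scl x w) (Q q v) = cnj x * pairing w (Q q v)"
  using forms_antidual[of q v] by (simp add: antidual_def pairing_def)

lemma pairing_in_K: "pairing w (Q q v) \<in> K"
  using forms_antidual[of q v] by (simp add: antidual_def pairing_def)

lemma Vform_scl:
  assumes "x \<in> K" shows "V q (scl x v) = (cmod x)\<^sup>2 * V q v"
proof -
  have "pairing (scl x v) (Q q (scl x v)) = (x * cnj x) * pairing v (Q q v)"
    by (simp add: pairing_scl_left[OF assms] pairing_scl_right[OF assms])
  also have "\<dots> = complex_of_real ((cmod x)\<^sup>2 * V q v)"
    by (simp add: Vform_real complex_mult_cnj cmod_power2)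
  finally show ?thesis by (simp add: Vform_def)
qed

lemma Em_negative: "v \<in> Em q \<Longrightarrow> v \<noteq> 0 \<Longrightarrow> V q v < 0"
  using forms_splitting[of q] by simp

lemma Em_subspace_over: "subspace_over K scl (Em q)" and Em_closed: "closed (Em q)"
  using forms_splitting[of q] unfolding direct_sum_over_def by auto

lemmas Em_subspace = subspace_over_real[OF Em_subspace_over]

text \<open>
  A complex basis \<open>e\<^sub>i\<close> gives the real spanning set of all \<open>e\<^sub>i\<close> and \<open>\<i> e\<^sub>i\<close>.
\<close>

lemma Em_span_finite: "\<exists>B. finite B \<and> Em q = span B"
proof -
  obtain e :: "nat \<Rightarrow> 'e" where
    e: "Em q = {v. \<exists>c. (\<forall>i<j. c i \<in> K) \<and> v = (\<Sum>i<j. scl (c i) (e i))}"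
    using forms_splitting[of q] unfolding has_dim_over_def by meson
  define B where "B = (\<lambda>i. e i) ` {..<j} \<union> (if K = UNIV then (\<lambda>i. scl \<i> (e i)) ` {..<j} else {})"
  have eE: "e i \<in> Em q" if "i < j" for i
  proof -
    have "(\<Sum>k<j. scl (complex_of_real (if k = i then 1 else 0)) (e k))
        = (\<Sum>k<j. if k = i then e k else 0)"
      unfolding scl_of_real by (intro sum.cong) auto
    also have "\<dots> = e i" using that by simp
    finally show ?thesis unfolding e
      by (auto intro!: exI[of _ "\<lambda>k. complex_of_real (if k = i then 1 else 0)"] of_real_in_K)
  qed
  have "B \<subseteq> Em q"
    using eE Em_subspace_over[of q] unfolding B_def subspace_over_def by auto
  hence "span B \<subseteq> Em q" by (intro span_minimal Em_subspace)
  moreover have "Em q \<subseteq> span B"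
  proof
    fix v assume "v \<in> Em q"
    then obtain c where c: "\<forall>i<j. c i \<in> K" "v = (\<Sum>i<j. scl (c i) (e i))" unfolding e by blast
    have "scl (c i) (e i) \<in> span B" if "i < j" for i
    proof -
      have base: "e i \<in> span B" using that by (auto simp: B_def intro: span_base)
      show ?thesis
      proof (cases "K = UNIV")
        case True
        hence base': "scl \<i> (e i) \<in> span B" using that by (auto simp: B_def intro: span_base)
        have "scl (c i) (e i) = scl (complex_of_real (Re (c i)) + complex_of_real (Im (c i)) * \<i>) (e i)"
          by (subst complex_eq) (simp add: mult.commute)
        also have "\<dots> = Re (c i) *\<^sub>R e i + Im (c i) *\<^sub>R scl \<i> (e i)"
          using True by (simp only: scl_add_left scl_mult UNIV_I scl_of_real)
        finally show ?thesis using base base' by (simp add: span_add span_scale)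
      next
        case False
        hence "c i \<in> \<real>" using c(1) that K_cases by auto
        then obtain r where "c i = complex_of_real r" by (auto simp: Reals_def)
        thus ?thesis using base by (simp add: scl_of_real span_scale)
      qed
    qed
    thus "v \<in> span B" unfolding c(2) by (intro span_sum) auto
  qed
  moreover have "finite B" by (simp add: B_def)
  ultimately show ?thesis by blast
qed

lemma Em_orthonormal:
  obtains F where "finite F" "Em q = span F" "\<And>e. e \<in> F \<Longrightarrow> b q e e = -1"
    "\<And>e e'. e \<in> F \<Longrightarrow> e' \<in> F \<Longrightarrow> e \<noteq> e' \<Longrightarrow> b q e e' = 0"
proof -
  obtain B where B: "finite B" "Em q = span B" using Em_span_finite by blast
  have "b q u u < 0" if "u \<in> span B" "u \<noteq> 0" for u
    using Em_negative[of u q] that B(2) by (simp add: Vform_re_form)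
  from orthonormal_spanning_set[OF re_form_bilinear b_sym B(1) this] B(2) that show ?thesis by metis
qed

text \<open>
  Orthogonality for the real part suffices: on a complex subspace, testing with \<open>\<i> w\<close> gives the
  imaginary part. Two candidates differ by a vector of \<open>E\<^sup>-(q)\<close> on which the form vanishes, hence
  by \<open>0\<close>.
\<close>

lemma proj_unique:
  assumes u: "u \<in> Em q" and orth: "\<And>w. w \<in> Em q \<Longrightarrow> b q w (v - u) = 0"
  shows "\<pi>m q v = u"
  unfolding proj_def
proof (rule the_equality, intro conjI ballI)
  fix w assume w: "w \<in> Em q"
  have Re: "Re (pairing w (Q q (v - u))) = 0" using orth[OF w] by (simp add: re_form_def)
  have Im: "Im (pairing w (Q q (v - u))) = 0"
  proof (cases "K = UNIV")
    case True
    hence "scl \<i> w \<in> Em q" using Em_subspace_over w unfolding subspace_over_def by blast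
    from orth[OF this] show ?thesis using True by (simp add: re_form_def pairing_scl_left)
  next
    case False
    hence "K = \<real>" using K_cases by blast
    thus ?thesis using pairing_in_K[of w q "v - u"] by (simp add: complex_is_Real_iff)
  qed
  show "pairing w (Q q v) = pairing w (Q q u)"
    using Re Im unfolding pairing_def by (simp add: blinfun.bilinear_simps complex_eq_iff)
next
  fix u' assume u': "u' \<in> Em q \<and> (\<forall>w\<in>Em q. pairing w (Q q v) = pairing w (Q q u'))"
  have d: "u - u' \<in> Em q" using u u' Em_subspace by (simp add: subspace_diff)
  have "pairing (u - u') (Q q (v - u')) = 0"
    using bspec[OF conjunct2[OF u'] d]
    by (simp add: pairing_def blinfun.diff_right blinfun.diff_left algebra_simps)
  hence "b q (u - u') (v - u') = 0" by (simp add: re_form_def)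
  moreover have "b q (u - u') (v - u) = 0" by (rule orth[OF d])
  ultimately have "V q (u - u') = 0"
    by (simp add: Vform_re_form linear_diff[OF b_linear])
  thus "u' = u" using Em_negative[OF d] by force
qed (rule u)

text \<open>
  The signs are those of the negative definite form: with \<open>b(e,e) = -1\<close>, the coefficient of \<open>e\<close> in
  the projection of \<open>v\<close> is \<open>- b(e,v)\<close>, and the form of the projection is minus the sum of squared
  coefficients.
\<close>

lemma Em_basis_exists:
  "\<exists>F. finite F \<and> Em q = span F \<and> (\<forall>v. \<pi>m q v = - (\<Sum>e\<in>F. b q e v *\<^sub>R e)) \<and>
    (\<forall>e\<in>F. \<forall>v. b q e (v - \<pi>m q v) = 0) \<and>
    (\<forall>v. V q (\<pi>m q v) = - (\<Sum>e\<in>F. (b q e v)\<^sup>2))"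
proof -
  obtain F where F: "finite F" "Em q = span F" "\<And>e. e \<in> F \<Longrightarrow> b q e e = -1"
    "\<And>e e'. e \<in> F \<Longrightarrow> e' \<in> F \<Longrightarrow> e \<noteq> e' \<Longrightarrow> b q e e' = 0" using Em_orthonormal by blast
  define p where "p v = - (\<Sum>e\<in>F. b q e v *\<^sub>R e)" for v
  have bs: "b q e (p v) = b q e v" if "e \<in> F" for e v
  proof -
    have "b q e (\<Sum>e'\<in>F. b q e' v *\<^sub>R e') = (\<Sum>e'\<in>F. b q e' v * b q e e')"
      by (simp add: linear_sum[OF b_linear] linear_cmul[OF b_linear])
    also have "\<dots> = (\<Sum>e'\<in>F. if e' = e then - b q e v else 0)"
      using F(3,4) that by (intro sum.cong) auto
    also have "\<dots> = - b q e v" using F(1) that by simp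
    finally show ?thesis by (simp add: p_def linear_neg[OF b_linear])
  qed
  have p: "\<pi>m q v = p v" for v
  proof (rule proj_unique)
    show "p v \<in> Em q" unfolding p_def F(2) by (intro span_neg span_sum span_scale span_base)
    fix w assume "w \<in> Em q"
    hence "w \<in> span F" using F(2) by simp
    thus "b q w (v - p v) = 0"
    proof (induction rule: span_induct_alt)
      case base show ?case by (simp add: bilinear_lzero[OF re_form_bilinear])
    next
      case (step r x y)
      thus ?case using bs[of x v]
        by (simp add: bilinear_ladd[OF re_form_bilinear] bilinear_lmul[OF re_form_bilinear]
            linear_diff[OF b_linear])
    qed
  qed
  have "V q (p v) = - (\<Sum>e\<in>F. (b q e v)\<^sup>2)" for v
  proof -
    have "V q (p v) = b q (p v) (- (\<Sum>e\<in>F. b q e v *\<^sub>R e))"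
      unfolding Vform_re_form by (subst (2) p_def) simp
    also have "\<dots> = - (\<Sum>e\<in>F. b q e v * b q e (p v))"
      by (simp add: linear_neg[OF b_linear] linear_sum[OF b_linear] linear_cmul[OF b_linear]
          b_sym[of q "p v"])
    also have "\<dots> = - (\<Sum>e\<in>F. (b q e v)\<^sup>2)" by (simp add: bs power2_eq_square)
    finally show ?thesis .
  qed
  hence "V q (\<pi>m q v) = - (\<Sum>e\<in>F. (b q e v)\<^sup>2)" for v by (simp add: p)
  moreover have "b q e (v - \<pi>m q v) = 0" if "e \<in> F" for e v
    using bs[OF that] by (simp add: linear_diff[OF b_linear] p)
  moreover have "\<pi>m q v = - (\<Sum>e\<in>F. b q e v *\<^sub>R e)" for v by (simp add: p p_def)
  ultimately show ?thesis using F(1,2) by (intro exI[of _ F]) simp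
qed

definition Em_basis :: "'q \<Rightarrow> 'e set" where
  "Em_basis q = (SOME F. finite F \<and> Em q = span F \<and>
    (\<forall>v. \<pi>m q v = - (\<Sum>e\<in>F. b q e v *\<^sub>R e)) \<and>
    (\<forall>e\<in>F. \<forall>v. b q e (v - \<pi>m q v) = 0) \<and>
    (\<forall>v. V q (\<pi>m q v) = - (\<Sum>e\<in>F. (b q e v)\<^sup>2)))"

lemma Em_basis:
  shows "finite (Em_basis q)" and "Em q = span (Em_basis q)"
    and "\<pi>m q v = - (\<Sum>e\<in>Em_basis q. b q e v *\<^sub>R e)"
    and "e \<in> Em_basis q \<Longrightarrow> b q e (v - \<pi>m q v) = 0"
    and "V q (\<pi>m q v) = - (\<Sum>e\<in>Em_basis q. (b q e v)\<^sup>2)"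
proof -
  note basis = someI_ex[OF Em_basis_exists[of q], folded Em_basis_def]
  show "finite (Em_basis q)" by (rule basis[THEN conjunct1])
  show "Em q = span (Em_basis q)" by (rule basis[THEN conjunct2, THEN conjunct1])
  show "\<pi>m q v = - (\<Sum>e\<in>Em_basis q. b q e v *\<^sub>R e)"
    by (rule basis[THEN conjunct2, THEN conjunct2, THEN conjunct1, rule_format])
  show "b q e (v - \<pi>m q v) = 0" if "e \<in> Em_basis q"
    using basis[THEN conjunct2, THEN conjunct2, THEN conjunct2, THEN conjunct1] that by blast
  show "V q (\<pi>m q v) = - (\<Sum>e\<in>Em_basis q. (b q e v)\<^sup>2)"
    by (rule basis[THEN conjunct2, THEN conjunct2, THEN conjunct2, THEN conjunct2, rule_format])
qed

lemma bounded_linear_proj: "bounded_linear (\<pi>m q)"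
proof -
  define F where "F = Em_basis q"
  note F = Em_basis[where q = q, folded F_def]
  have "bounded_linear (\<lambda>v. - (\<Sum>e\<in>F. b q e v *\<^sub>R e))"
    by (rule bounded_linear_minus, rule bounded_linear_sum, rule bounded_linear_scaleR_const,
        rule bounded_linear_re_form)
  thus ?thesis by (simp add: F(3)[abs_def])
qed

lemma proj_in_Em: "\<pi>m q v \<in> Em q"
proof -
  define F where "F = Em_basis q"
  note F = Em_basis[where q = q, folded F_def]
  show ?thesis unfolding F(2,3) by (intro span_neg span_sum span_scale span_base)
qed

lemma proj_orthogonal:
  assumes "w \<in> Em q" shows "b q w (v - \<pi>m q v) = 0"
proof -
  define F where "F = Em_basis q"
  note F = Em_basis[where q = q, folded F_def]
  from assms have "w \<in> span F" using F(2) by simp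
  thus ?thesis
    by (induction rule: span_induct_alt)
      (simp_all add: bilinear_lzero[OF re_form_bilinear] bilinear_ladd[OF re_form_bilinear]
         bilinear_lmul[OF re_form_bilinear] F(4))
qed

lemma proj_ident: "u \<in> Em q \<Longrightarrow> \<pi>m q u = u"
  by (rule proj_unique) (simp_all add: linear_0[OF b_linear])

lemma proj_linear_over: "linear_over K scl scl (\<pi>m q)"
  unfolding linear_over_def
proof (intro conjI allI ballI)
  show "\<pi>m q (v + w) = \<pi>m q v + \<pi>m q w" for v w
    by (rule linear_add[OF bounded_linear.linear[OF bounded_linear_proj]])
  fix x v assume x: "x \<in> K"
  show "\<pi>m q (scl x v) = scl x (\<pi>m q v)"
  proof (rule proj_unique)
    show "scl x (\<pi>m q v) \<in> Em q"
      using Em_subspace_over proj_in_Em x unfolding subspace_over_def by blast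
    fix w assume w: "w \<in> Em q"
    have "pairing w (Q q (v - \<pi>m q v)) = 0"
    proof -
      have "\<pi>m q (v - \<pi>m q v) = 0"
        using proj_ident[OF proj_in_Em]
        by (simp add: linear_diff[OF bounded_linear.linear[OF bounded_linear_proj]])
      show ?thesis
      proof (cases "K = UNIV")
        case True
        hence "scl \<i> w \<in> Em q" using Em_subspace_over w unfolding subspace_over_def by blast
        from proj_orthogonal[OF this, of v] proj_orthogonal[OF w, of v] show ?thesis
          using True by (simp add: re_form_def pairing_scl_left complex_eq_iff)
      next
        case False
        hence "pairing w (Q q (v - \<pi>m q v)) \<in> \<real>"
          using K_cases pairing_in_K[of w q "v - \<pi>m q v"] by simp
        thus ?thesis using proj_orthogonal[OF w, of v]
          by (simp add: re_form_def complex_is_Real_iff complex_eq_iff)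
      qed
    qed
    thus "b q w (scl x v - scl x (\<pi>m q v)) = 0"
      by (simp add: re_form_def pairing_scl_right[OF x] flip: scl_diff_right[OF x])
  qed
qed

lemma bounded_linear_proj_plus: "bounded_linear (\<pi>p q)"
  using bounded_linear_sub[OF bounded_linear_ident bounded_linear_proj, of q]
  by (simp add: proj_plus_def[abs_def])

lemma proj_plus_linear_over: "linear_over K scl scl (\<pi>p q)"
  using proj_linear_over[of q] unfolding linear_over_def proj_plus_def
  by (simp add: scl_diff_right)

lemmas proj_linear = bounded_linear.linear[OF bounded_linear_proj]
lemmas proj_plus_linear = bounded_linear.linear[OF bounded_linear_proj_plus]

lemma proj_plus_in_Ep: "\<pi>p q v \<in> Ep q"
  unfolding E_plus_def proj_plus_def
  by (simp add: linear_diff[OF proj_linear] proj_ident[OF proj_in_Em])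

lemma proj_plus_ident: "v \<in> Ep q \<Longrightarrow> \<pi>p q v = v"
  by (simp add: E_plus_def proj_plus_def)

lemma proj_plus_zero_iff: "\<pi>p q v = 0 \<longleftrightarrow> v \<in> Em q"
  using proj_ident[of v q] proj_in_Em[of q v] unfolding proj_plus_def by fastforce

lemma proj_sum: "\<pi>p q v + \<pi>m q v = v"
  by (simp add: proj_plus_def)

lemma direct_sum: "direct_sum_over K scl (Ep q) (Em q)"
  unfolding direct_sum_over_def
proof (intro conjI Em_subspace_over Em_closed allI)
  show "subspace_over K scl (Ep q)"
    using proj_linear_over[of q] linear_0[OF proj_linear[of q]] unfolding linear_over_def
    by (simp add: subspace_over_def E_plus_def scl_zero)
  show "closed (Ep q)"
    unfolding E_plus_def
    by (rule closed_Collect_eq[OF linear_continuous_on[OF bounded_linear_proj] continuous_on_const])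
  show "Ep q \<inter> Em q = {0}"
    using proj_ident linear_0[OF proj_linear] Em_subspace
    by (auto simp: E_plus_def subspace_0)
  show "\<exists>x\<in>Ep q. \<exists>y\<in>Em q. v = x + y" for v
    using proj_sum proj_plus_in_Ep proj_in_Em by metis
qed

lemmas Ep_subspace_over = direct_sum[unfolded direct_sum_over_def, THEN conjunct1]
lemmas Ep_subspace = subspace_over_real[OF Ep_subspace_over]

lemma V_split: "V q v = V q (\<pi>p q v) + V q (\<pi>m q v)"
proof -
  have "b q (\<pi>m q v) (\<pi>p q v) = 0"
    unfolding proj_plus_def by (rule proj_orthogonal[OF proj_in_Em])
  hence "b q (\<pi>p q v + \<pi>m q v) (\<pi>p q v + \<pi>m q v) = V q (\<pi>p q v) + V q (\<pi>m q v)"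
    using b_sym[of q "\<pi>p q v" "\<pi>m q v"]
    by (simp add: Vform_re_form bilinear_ladd[OF re_form_bilinear] bilinear_radd[OF re_form_bilinear])
  thus ?thesis by (simp add: proj_sum Vform_re_form)
qed

text \<open>
  In the orthonormal spanning set each coefficient of \<open>u\<close> is at most \<open>sqrt (- V u)\<close>.
\<close>

lemma Em_coercive: "\<exists>m>0. \<forall>u\<in>Em q. (norm u)\<^sup>2 \<le> m * - V q u"
proof -
  define F where "F = Em_basis q"
  note F = Em_basis[where q = q, folded F_def]
  define m where "m = (\<Sum>e\<in>F. norm e) + 1"
  have m: "m > 0" unfolding m_def by (intro add_nonneg_pos sum_nonneg) auto
  have "(norm u)\<^sup>2 \<le> m\<^sup>2 * - V q u" if u: "u \<in> Em q" for u
  proof -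
    have eq: "- V q u = (\<Sum>e\<in>F. (b q e u)\<^sup>2)" using F(5)[of u] proj_ident[OF u] by simp
    have nn: "0 \<le> - V q u" unfolding eq by (intro sum_nonneg) auto
    have "\<bar>b q e u\<bar> \<le> sqrt (- V q u)" if "e \<in> F" for e
    proof (rule real_le_rsqrt)
      have "(b q e u)\<^sup>2 \<le> (\<Sum>e\<in>F. (b q e u)\<^sup>2)"
        by (rule member_le_sum[of e F "\<lambda>e. (b q e u)\<^sup>2"]) (use that F(1) in auto)
      thus "\<bar>b q e u\<bar>\<^sup>2 \<le> - V q u" by (simp add: eq)
    qed
    hence "(\<Sum>e\<in>F. \<bar>b q e u\<bar> * norm e) \<le> (\<Sum>e\<in>F. sqrt (- V q u) * norm e)"
      by (intro sum_mono mult_right_mono) auto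
    moreover have "norm u \<le> (\<Sum>e\<in>F. \<bar>b q e u\<bar> * norm e)"
    proof -
      have "norm u = norm (\<Sum>e\<in>F. b q e u *\<^sub>R e)"
        using F(3)[of u] proj_ident[OF u] by (metis norm_minus_cancel)
      thus ?thesis using norm_sum[of "\<lambda>e. b q e u *\<^sub>R e" F] by simp
    qed
    ultimately have "norm u \<le> sqrt (- V q u) * (\<Sum>e\<in>F. norm e)"
      by (simp add: sum_distrib_left)
    also have "\<dots> \<le> sqrt (- V q u) * m"
      using nn by (intro mult_left_mono) (auto simp: m_def)
    finally have "norm u \<le> sqrt (- V q u) * m" .
    hence "(norm u)\<^sup>2 \<le> (sqrt (- V q u) * m)\<^sup>2" by (intro power_mono) auto
    thus ?thesis using nn by (simp add: power_mult_distrib mult.commute)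
  qed
  thus ?thesis using m by (intro exI[of _ "m\<^sup>2"]) auto
qed

lemma Em_compact: "compact (Em q \<inter> cball 0 R)"
proof -
  define F where "F = Em_basis q"
  note F = Em_basis[where q = q, folded F_def]
  define M where "M = (\<Sum>e\<in>F. norm (Q q) * norm e * \<bar>R\<bar>)"
  obtain D where D: "compact D" "\<And>a. (\<forall>e\<in>F. \<bar>a e\<bar> \<le> M) \<Longrightarrow> (\<Sum>e\<in>F. a e *\<^sub>R e) \<in> D"
    using compact_bounded_combinations[OF F(1)] by metis
  have "u \<in> D" if u: "u \<in> Em q \<inter> cball 0 R" for u
  proof -
    have "\<bar>- b q e u\<bar> \<le> M" if "e \<in> F" for e
    proof -
      have "\<bar>- b q e u\<bar> \<le> norm (Q q) * norm e * norm u" using abs_re_form_le by simp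
      also have "\<dots> \<le> norm (Q q) * norm e * \<bar>R\<bar>" using u by (intro mult_left_mono) auto
      also have "\<dots> \<le> M"
        unfolding M_def by (rule member_le_sum) (use that F(1) in auto)
      finally show ?thesis .
    qed
    hence "(\<Sum>e\<in>F. (- b q e u) *\<^sub>R e) \<in> D" by (intro D(2)) auto
    thus ?thesis using F(3)[of u] proj_ident[of u q] u by (simp add: sum_negf)
  qed
  hence "Em q \<inter> cball 0 R = D \<inter> (Em q \<inter> cball 0 R)" by blast
  thus ?thesis using compact_Int_closed[OF D(1)] Em_closed by (metis closed_Int closed_cball)
qed

lemma Em_shell_compact: "compact {u \<in> Em q. \<epsilon> \<le> norm u \<and> norm u \<le> R}"
proof -
  have "{u \<in> Em q. \<epsilon> \<le> norm u \<and> norm u \<le> R} = (Em q \<inter> cball 0 R) \<inter> - ball 0 \<epsilon>"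
    by auto
  moreover have "compact ((Em q \<inter> cball 0 R) \<inter> - ball 0 \<epsilon>)"
    by (rule compact_Int_closed[OF Em_compact]) (rule closed_Compl[OF open_ball])
  ultimately show ?thesis by simp
qed

text \<open>
  \<open>V v \<ge> 0\<close> means \<open>- V(\<Pi> v) \<le> V(\<Pi>\<^sup>+ v)\<close>, and the left-hand side is coercive. Sets with differences
  in the positive cone are therefore Lipschitz graphs over \<open>E\<^sup>+(q)\<close>.
\<close>

lemma positive_cone_bound: "\<exists>c>0. \<forall>v. V q v \<ge> 0 \<longrightarrow> norm v \<le> c * norm (\<pi>p q v)"
proof -
  obtain m where m: "m > 0" "\<And>u. u \<in> Em q \<Longrightarrow> (norm u)\<^sup>2 \<le> m * - V q u"
    using Em_coercive by blast
  define c where "c = 1 + sqrt (m * norm (Q q))"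
  have "norm v \<le> c * norm (\<pi>p q v)" if v: "V q v \<ge> 0" for v
  proof -
    have "(norm (\<pi>m q v))\<^sup>2 \<le> m * - V q (\<pi>m q v)" by (rule m(2)[OF proj_in_Em])
    also have "\<dots> \<le> m * (norm (Q q) * (norm (\<pi>p q v))\<^sup>2)"
      using v V_split[of q v] abs_Vform_le[of Q q "\<pi>p q v"] m(1) by (intro mult_left_mono) auto
    also have "\<dots> = (sqrt (m * norm (Q q)))\<^sup>2 * (norm (\<pi>p q v))\<^sup>2"
      using m(1) by (subst real_sqrt_pow2) auto
    also have "\<dots> = (sqrt (m * norm (Q q)) * norm (\<pi>p q v))\<^sup>2"
      by (rule power_mult_distrib[symmetric])
    finally have "norm (\<pi>m q v) \<le> sqrt (m * norm (Q q)) * norm (\<pi>p q v)"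
      by (rule power2_le_imp_le) (use m(1) in auto)
    moreover have "norm v \<le> norm (\<pi>p q v) + norm (\<pi>m q v)"
      using norm_triangle_ineq[of "\<pi>p q v" "\<pi>m q v"] by (simp add: proj_sum)
    ultimately show ?thesis by (simp add: c_def distrib_right)
  qed
  moreover have "c > 0" unfolding c_def by (rule add_pos_nonneg) (use m(1) in auto)
  ultimately show ?thesis by blast
qed

end

section \<open>Squeezing along the linearized semicocycle\<close>

lemma set_integral_ge_initial_bound:
  fixes F :: "real \<Rightarrow> real"
  assumes cont: "continuous_on {0..r} F" and nonneg: "\<And>s. s \<in> {0..r} \<Longrightarrow> F s \<ge> 0"
    and r: "r \<ge> 1" and low: "\<And>s. s \<in> {0..1} \<Longrightarrow> m \<le> F s"
  shows "m \<le> (LBINT s:{0..r}. F s)"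
proof -
  have int: "F integrable_on {0..r}" using cont by (rule integrable_continuous_interval)
  have int1: "F integrable_on {0..1}"
    using cont r by (intro integrable_continuous_interval) (auto elim: continuous_on_subset)
  have "m = integral {0..1::real} (\<lambda>_. m)" by simp
  also have "\<dots> \<le> integral {0..1} F"
    by (rule integral_le) (use int1 low in auto)
  also have "\<dots> \<le> integral {0..r} F"
    by (rule integral_subset_le) (use int int1 r nonneg in auto)
  also have "\<dots> = (LBINT s:{0..r}. F s)"
    by (rule set_borel_integral_eq_integral(2)[symmetric]) (rule borel_integrable_atLeastAtMost'[OF cont])
  finally show ?thesis .
qed

locale squeezed_cocycle = indefinite_forms K scl j Q Em
  for K and scl :: "complex \<Rightarrow> 'e::real_normed_vector \<Rightarrow> 'e" and j
    and Q :: "'q::metric_space \<Rightarrow> 'e \<Rightarrow>\<^sub>L ('e \<Rightarrow>\<^sub>L complex)" and Em +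
  fixes \<iota> :: "'e \<Rightarrow> 'h::real_inner" and \<theta> :: "real \<Rightarrow> 'q \<Rightarrow> 'q"
    and \<psi> :: "real \<Rightarrow> 'q \<Rightarrow> 'e \<Rightarrow> 'e" and \<delta> \<tau> am ap :: real and \<alpha>0 :: "'q \<Rightarrow> real"
    and \<gamma> :: real and L :: "real \<Rightarrow> 'q \<Rightarrow> 'e \<Rightarrow> 'e \<Rightarrow> 'e"
  assumes embedding: "bounded_linear \<iota>"
    and flow: "semiflow \<theta>"
    and cocycle: "semicocycle \<theta> \<psi>"
    and negative: "negative_squeezing \<iota> \<theta> \<psi> Q \<delta> \<tau> am ap \<alpha>0"
    and lipschitz: "uniform_lipschitz \<iota> \<psi>"
    and diff: "differentiability K scl \<iota> \<theta> \<psi> \<tau> \<gamma> L"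
begin

interpretation \<iota>: bounded_linear \<iota> by (rule embedding)

lemma \<theta>_add: "t \<ge> 0 \<Longrightarrow> s \<ge> 0 \<Longrightarrow> \<theta> (t + s) q = \<theta> t (\<theta> s q)" and \<theta>_zero [simp]: "\<theta> 0 q = q"
  using flow unfolding semiflow_def by auto

lemma \<psi>_add: "t \<ge> 0 \<Longrightarrow> s \<ge> 0 \<Longrightarrow> \<psi> (t + s) q v = \<psi> t (\<theta> s q) (\<psi> s q v)"
  and \<psi>_zero [simp]: "\<psi> 0 q v = v"
  using cocycle unfolding semicocycle_def by auto

lemma continuous_\<theta>: "continuous_on {0..} (\<lambda>t. \<theta> t q)"
proof -
  have c: "continuous_on ({0..} \<times> UNIV) (\<lambda>(t, q). \<theta> t q)"
    using flow unfolding semiflow_def by blast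
  have "continuous_on {0..} (\<lambda>t::real. (t, q))" by (intro continuous_intros)
  from continuous_on_compose2[OF c this] show ?thesis by auto
qed

lemma continuous_\<psi>: "continuous_on {0..} (\<lambda>t. \<psi> t q v)"
proof -
  have c: "continuous_on ({0..} \<times> UNIV \<times> UNIV) (\<lambda>(t, q, v). \<psi> t q v)"
    using cocycle unfolding semicocycle_def by blast
  have "continuous_on {0..} (\<lambda>t::real. (t, q, v))" by (intro continuous_intros)
  from continuous_on_compose2[OF c this] show ?thesis by auto
qed

lemmas diff_unfolded = diff[unfolded differentiability_def Let_def]
lemmas L_semicocycle = diff_unfolded[THEN conjunct1, THEN conjunct1]
lemmas L_lipschitz = diff_unfolded[THEN conjunct1, THEN conjunct2, THEN conjunct1]
lemmas L_linear_over = diff_unfolded[THEN conjunct2, THEN conjunct1, rule_format]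
lemmas limit_H = diff_unfolded[THEN conjunct2, THEN conjunct2, THEN conjunct1, rule_format]
lemmas limit_E = diff_unfolded[THEN conjunct2, THEN conjunct2, THEN conjunct2, THEN conjunct1, rule_format]
lemmas L_continuous_H =
  diff_unfolded[THEN conjunct2, THEN conjunct2, THEN conjunct2, THEN conjunct2, rule_format]

lemma L_add: "t \<ge> 0 \<Longrightarrow> s \<ge> 0 \<Longrightarrow> L (t + s) q v \<xi> = L t (\<theta> s q) (\<psi> s q v) (L s q v \<xi>)"
  and L_zero [simp]: "L 0 q v \<xi> = \<xi>"
  using L_semicocycle unfolding semicocycle_def skew_product_def by auto

lemma L_linear: "t \<ge> 0 \<Longrightarrow> linear (L t q v)"
  by (rule linear_over_real[OF L_linear_over])

lemma L_bounded_linear: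
  assumes "t \<ge> 0" shows "bounded_linear (L t q v)"
proof -
  have "t + 1 > 0" using assms by simp
  with L_lipschitz obtain l where "\<forall>p \<xi>1 \<xi>2. \<forall>s\<in>{0..t + 1}.
      norm (L s (fst p) (snd p) \<xi>1 - L s (fst p) (snd p) \<xi>2) \<le> l * norm (\<xi>1 - \<xi>2)"
    unfolding uniform_lipschitz_def by meson
  from this[rule_format, of t "(q, v)"] assms
  have l: "norm (L t q v \<xi>1 - L t q v \<xi>2) \<le> l * norm (\<xi>1 - \<xi>2)" for \<xi>1 \<xi>2 by simp
  have "norm (L t q v \<xi>) \<le> norm \<xi> * l" for \<xi>
    using l[of \<xi> 0] by (simp add: linear_0[OF L_linear[OF assms]] mult.commute)
  thus ?thesis
    by (intro bounded_linear_intro) (simp_all add: linear_add[OF L_linear[OF assms]]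
        linear_cmul[OF L_linear[OF assms]])
qed

definition real_quotient :: "real \<Rightarrow> 'q \<Rightarrow> 'e \<Rightarrow> real \<Rightarrow> 'e \<Rightarrow> 'e"
  where "real_quotient t q v h \<xi> = (\<psi> t q (v + h *\<^sub>R \<xi>) - \<psi> t q v) /\<^sub>R h"

lemma diff_quotient_real: "diff_quotient scl \<psi> t q v (complex_of_real h) \<xi> = real_quotient t q v h \<xi>"
  unfolding diff_quotient_def real_quotient_def of_real_inverse[symmetric] scl_of_real ..

text \<open>
  Restricting increments from \<open>K\<close> to real ones costs nothing: the differentials are linear over
  \<open>K\<close> by assumption, and all limits below are taken along real increments.
\<close>

lemma of_real_at_zero: "filterlim complex_of_real (at 0 within K) (at 0)"
  using of_real_in_K
  by (auto simp: filterlim_at eventually_at_filter intro!: tendsto_eq_intros)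

lemma uniform_limit_E:
  assumes "t \<ge> \<tau>" "bounded B"
  shows "uniform_limit B (real_quotient t q v) (L t q v) (at 0)"
proof -
  have *: "uniform_limit ({t} \<times> B) (\<lambda>h (t, \<xi>). diff_quotient scl \<psi> t q v h \<xi>)
      (\<lambda>(t, \<xi>). L t q v \<xi>) (at 0 within K)"
    by (rule limit_E) (use assms in auto)
  show ?thesis
  proof (rule uniform_limitI)
    fix e :: real assume "e > 0"
    from uniform_limitD[OF * this] have "\<forall>\<^sub>F h in at 0 within K.
        \<forall>\<xi>\<in>B. dist (diff_quotient scl \<psi> t q v h \<xi>) (L t q v \<xi>) < e" by simp
    from filterlim_iff[THEN iffD1, OF of_real_at_zero, rule_format, OF this]
    show "\<forall>\<^sub>F h in at 0. \<forall>\<xi>\<in>B. dist (real_quotient t q v h \<xi>) (L t q v \<xi>) < e"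
      by (simp add: diff_quotient_real)
  qed
qed

lemma pointwise_limit_E:
  assumes "t \<ge> \<tau>" shows "((\<lambda>h. real_quotient t q v h \<xi>) \<longlongrightarrow> L t q v \<xi>) (at 0)"
  by (rule tendsto_uniform_limitI[OF uniform_limit_E[OF assms, of "{\<xi>}"]]) auto

lemma pointwise_limit_H:
  assumes "t \<ge> 0" shows "((\<lambda>h. \<iota> (real_quotient t q v h \<xi>)) \<longlongrightarrow> \<iota> (L t q v \<xi>)) (at 0)"
proof -
  have "uniform_limit ({t} \<times> {\<xi>}) (\<lambda>h (t, \<xi>). \<iota> (diff_quotient scl \<psi> t q v h \<xi>))
      (\<lambda>(t, \<xi>). \<iota> (L t q v \<xi>)) (at 0 within K)"
    by (rule limit_H) (use assms in auto)
  from tendsto_uniform_limitI[OF this, of "(t, \<xi>)"]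
  have "((\<lambda>h. \<iota> (diff_quotient scl \<psi> t q v h \<xi>)) \<longlongrightarrow> \<iota> (L t q v \<xi>)) (at 0 within K)"
    by simp
  from filterlim_compose[OF this of_real_at_zero] show ?thesis by (simp add: diff_quotient_real)
qed

lemma negative_constants: "\<delta> > 0" "\<tau> \<ge> 0" "\<alpha>0 \<in> borel_measurable borel" "\<alpha>0 q \<in> {am..ap}"
  using negative unfolding negative_squeezing_def by auto

definition exponent_bound :: real where "exponent_bound = max \<bar>am\<bar> \<bar>ap\<bar>"

lemma \<alpha>0_bound: "\<bar>\<alpha>0 q\<bar> \<le> exponent_bound"
  using negative_constants(4)[of q] unfolding exponent_bound_def by auto

text \<open>
  The exponent is a Lebesgue integral of a bounded Borel function; its continuity makes the
  integrand of the squeezing inequality integrable, without which that integral would be \<open>0\<close> by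
  convention.
\<close>

lemma exponent_int_regular:
  assumes "T \<ge> 0"
  shows "continuous_on {0..T} (\<lambda>t. exponent_int \<alpha>0 \<theta> t q)"
    and "\<And>t. t \<in> {0..T} \<Longrightarrow> \<bar>exponent_int \<alpha>0 \<theta> t q\<bar> \<le> exponent_bound * t"
proof -
  \<comment> \<open>nothing is known about \<open>\<theta> s\<close> for negative \<open>s\<close>, hence the cut-off\<close>
  define f where "f s = \<alpha>0 (\<theta> (max 0 s) q)" for s
  have "continuous_on UNIV (\<lambda>s::real. \<theta> (max 0 s) q)"
    by (rule continuous_on_compose2[OF continuous_\<theta>, of UNIV "\<lambda>s. max 0 s"]) (auto intro!: continuous_intros)
  hence "(\<lambda>s. \<theta> (max 0 s) q) \<in> borel_measurable borel" by (rule borel_measurable_continuous_onI)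
  hence meas: "f \<in> borel_measurable lborel"
    unfolding f_def using measurable_compose[OF _ negative_constants(3)] by simp
  have int: "set_integrable lborel {0..t} f" for t
    unfolding set_integrable_def
  proof (rule integrableI_bounded_set_indicator)
    show "emeasure lborel {0..t} < \<infinity>" by (cases "0 \<le> t") auto
    show "AE x in lborel. x \<in> {0..t} \<longrightarrow> norm (f x) \<le> exponent_bound"
      using \<alpha>0_bound by (auto simp: f_def)
  qed (use meas in auto)
  have eq: "exponent_int \<alpha>0 \<theta> t q = integral {0..t} f" for t
  proof -
    have "exponent_int \<alpha>0 \<theta> t q = (LBINT s:{0..t}. f s)"
      unfolding exponent_int_def by (rule set_lebesgue_integral_cong) (auto simp: f_def)
    also have "\<dots> = integral {0..t} f" by (rule set_borel_integral_eq_integral(2)[OF int])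
    finally show ?thesis .
  qed
  have hk: "f integrable_on {0..t}" for t by (rule set_borel_integral_eq_integral(1)[OF int])
  show "continuous_on {0..T} (\<lambda>t. exponent_int \<alpha>0 \<theta> t q)"
    unfolding eq by (rule indefinite_integral_continuous_1[OF hk])
  fix t assume t: "t \<in> {0..T}"
  have "norm (integral {0..t} f) \<le> integral {0..t} (\<lambda>_. exponent_bound)"
    by (rule integral_norm_bound_integral[OF hk]) (use \<alpha>0_bound in \<open>auto simp: f_def\<close>)
  thus "\<bar>exponent_int \<alpha>0 \<theta> t q\<bar> \<le> exponent_bound * t" using t by (simp add: eq mult.commute)
qed

text \<open>
  Only a lower bound of the integral over the unit interval is kept, so that passing to the
  linearization involves limits at finitely many times instead of a limit under the integral.
\<close>

lemma negative_squeezing_discrete: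
  assumes r: "r \<ge> \<tau>" "r \<ge> 1" and neg: "V q (v1 - v2) \<le> 0"
    and low: "\<And>s. s \<in> {0..1} \<Longrightarrow> m \<le> (norm (\<iota> (\<psi> s q v1 - \<psi> s q v2)))\<^sup>2" and m: "m \<ge> 0"
  shows "V (\<theta> r q) (\<psi> r q v1 - \<psi> r q v2)
    \<le> exp (- 2 * exponent_bound * r) * (V q (v1 - v2) - \<delta> * exp (- 2 * exponent_bound) * m)"
proof -
  define a where "a s = exponent_int \<alpha>0 \<theta> s q" for s
  define D where "D s = \<psi> s q v1 - \<psi> s q v2" for s
  have M: "exponent_bound \<ge> 0" by (auto simp: exponent_bound_def)
  have a: "continuous_on {0..r} a" "\<And>s. s \<in> {0..r} \<Longrightarrow> \<bar>a s\<bar> \<le> exponent_bound * s"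
    unfolding a_def using exponent_int_regular[where T = r and q = q] r by auto
  have D: "continuous_on {0..r} (\<lambda>s. \<iota> (D s))"
    unfolding D_def by (intro \<iota>.continuous_on continuous_intros continuous_on_subset[OF continuous_\<psi>]) auto
  have "exp (- 2 * exponent_bound) * m \<le> (LBINT s:{0..r}. exp (2 * a s) * (norm (\<iota> (D s)))\<^sup>2)"
  proof (rule set_integral_ge_initial_bound)
    show "continuous_on {0..r} (\<lambda>s. exp (2 * a s) * (norm (\<iota> (D s)))\<^sup>2)"
      by (intro continuous_intros a(1) D)
    fix s :: real assume s: "s \<in> {0..1}"
    have "\<bar>a s\<bar> \<le> exponent_bound * s" using a(2)[of s] s r by simp
    also have "\<dots> \<le> exponent_bound * 1" using s M by (intro mult_left_mono) auto
    finally have "- 2 * exponent_bound \<le> 2 * a s" by simp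
    thus "exp (- 2 * exponent_bound) * m \<le> exp (2 * a s) * (norm (\<iota> (D s)))\<^sup>2"
      unfolding D_def using low[OF s] m by (intro mult_mono) auto
  qed (use r in auto)
  hence low': "\<delta> * (exp (- 2 * exponent_bound) * m)
      \<le> \<delta> * (LBINT s:{0..r}. exp (2 * a s) * (norm (\<iota> (D s)))\<^sup>2)"
    using negative_constants(1) by (intro mult_left_mono) auto
  have "squeeze \<iota> \<theta> Q \<delta> \<alpha>0 q r D"
    using negative neg r(1) unfolding negative_squeezing_def D_def by blast
  hence "exp (2 * a r) * V (\<theta> r q) (D r) - V q (D 0)
      \<le> - \<delta> * (LBINT s:{0..r}. exp (2 * a s) * (norm (\<iota> (D s)))\<^sup>2)"
    unfolding squeeze_def a_def .
  with low' have main: "exp (2 * a r) * V (\<theta> r q) (D r) \<le> V q (v1 - v2) - \<delta> * exp (- 2 * exponent_bound) * m"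
    (is "_ \<le> ?X") by (simp add: D_def mult.assoc)
  have "\<bar>a r\<bar> \<le> exponent_bound * r" using a(2)[of r] r by simp
  hence "exp (- 2 * exponent_bound * r) \<le> exp (- 2 * a r)" by simp
  moreover have "?X \<le> 0"
  proof -
    have "0 \<le> \<delta> * exp (- 2 * exponent_bound) * m" using m negative_constants(1) by simp
    with neg show ?thesis by linarith
  qed
  ultimately have "exp (- 2 * a r) * ?X \<le> exp (- 2 * exponent_bound * r) * ?X"
    by (rule mult_right_mono_neg)
  moreover have "exp (- 2 * a r) * (exp (2 * a r) * V (\<theta> r q) (D r)) \<le> exp (- 2 * a r) * ?X"
    using main by (intro mult_left_mono) auto
  moreover have "exp (- 2 * a r) * (exp (2 * a r) * V (\<theta> r q) (D r)) = V (\<theta> r q) (D r)"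
    by (simp add: mult.assoc[symmetric] exp_add[symmetric])
  ultimately show ?thesis unfolding D_def by linarith
qed

text \<open>
  All terms are homogeneous of degree two, so the inequality for \<open>v + h \<xi>\<close> and \<open>v\<close> can be divided
  by \<open>h\<^sup>2\<close>. At time \<open>r\<close> the quotients converge in \<open>E\<close>, as the form requires; at time \<open>r'\<close>
  convergence in the Hilbert norm is enough.
\<close>

lemma linear_squeezing_limit:
  assumes r: "r \<ge> \<tau>" and r': "r' \<ge> 0" and neg: "V q \<xi> \<le> 0"
    and nonlinear: "\<And>v1 v2. V q (v1 - v2) \<le> 0 \<Longrightarrow> V (\<theta> r q) (\<psi> r q v1 - \<psi> r q v2)
      \<le> x * V q (v1 - v2) - y * (norm (\<iota> (\<psi> r' q v1 - \<psi> r' q v2)))\<^sup>2"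
  shows "V (\<theta> r q) (L r q v \<xi>) \<le> x * V q \<xi> - y * (norm (\<iota> (L r' q v \<xi>)))\<^sup>2"
proof (rule tendsto_le[OF trivial_limit_at])
  show "((\<lambda>h. V (\<theta> r q) (real_quotient r q v h \<xi>)) \<longlongrightarrow> V (\<theta> r q) (L r q v \<xi>)) (at (0::real))"
    by (intro tendsto_Vform pointwise_limit_E r)
  show "((\<lambda>h. x * V q \<xi> - y * (norm (\<iota> (real_quotient r' q v h \<xi>)))\<^sup>2)
      \<longlongrightarrow> x * V q \<xi> - y * (norm (\<iota> (L r' q v \<xi>)))\<^sup>2) (at 0)"
    by (intro tendsto_intros pointwise_limit_H r')
  have "V (\<theta> r q) (real_quotient r q v h \<xi>) \<le> x * V q \<xi> - y * (norm (\<iota> (real_quotient r' q v h \<xi>)))\<^sup>2"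
    if "h \<noteq> 0" for h
  proof -
    have "V q (h *\<^sub>R \<xi>) \<le> 0" using neg by (simp add: Vform_scaleR mult_nonneg_nonpos)
    hence "V (\<theta> r q) (\<psi> r q (v + h *\<^sub>R \<xi>) - \<psi> r q v)
        \<le> x * V q (h *\<^sub>R \<xi>) - y * (norm (\<iota> (\<psi> r' q (v + h *\<^sub>R \<xi>) - \<psi> r' q v)))\<^sup>2"
      using nonlinear[of "v + h *\<^sub>R \<xi>" v] by simp
    hence "(inverse h)\<^sup>2 * V (\<theta> r q) (\<psi> r q (v + h *\<^sub>R \<xi>) - \<psi> r q v)
        \<le> (inverse h)\<^sup>2 * (x * V q (h *\<^sub>R \<xi>) - y * (norm (\<iota> (\<psi> r' q (v + h *\<^sub>R \<xi>) - \<psi> r' q v)))\<^sup>2)"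
      by (rule mult_left_mono) simp
    also have "\<dots> = x * V q \<xi> - y * (norm (\<iota> (real_quotient r' q v h \<xi>)))\<^sup>2"
      using that by (simp add: Vform_scaleR real_quotient_def \<iota>.scaleR power_mult_distrib
          power_inverse right_diff_distrib)
    finally show ?thesis by (simp add: real_quotient_def Vform_scaleR)
  qed
  thus "\<forall>\<^sub>F h in at 0. V (\<theta> r q) (real_quotient r q v h \<xi>)
      \<le> x * V q \<xi> - y * (norm (\<iota> (real_quotient r' q v h \<xi>)))\<^sup>2"
    by (auto simp: eventually_at_filter)
qed

lemma linear_stays_negative:
  assumes r: "r \<ge> \<tau>" "r \<ge> 1" and neg: "V q \<xi> < 0"
  shows "V (\<theta> r q) (L r q v \<xi>) < 0"
proof -
  have "V (\<theta> r q) (L r q v \<xi>)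
      \<le> exp (- 2 * exponent_bound * r) * V q \<xi> - 0 * (norm (\<iota> (L 0 q v \<xi>)))\<^sup>2"
    using r neg negative_squeezing_discrete[OF r, where q = q and m = 0]
    by (intro linear_squeezing_limit) auto
  also have "\<dots> < 0" using neg by (simp add: mult_pos_neg)
  finally show ?thesis .
qed

text \<open>
  The energy at \<open>r'\<close> is placed between two smoothing periods. The one before it, for the nonlinear
  semicocycle, bounds the energy by each Hilbert norm on the unit interval, hence by the
  dissipation integral; the one after it, for the linearization, bounds the norm in \<open>E\<close> at time
  \<open>H\<close> by the energy.
\<close>

lemma one_step_squeezing:
  obtains H r' c C where "H \<ge> \<tau>" "H \<ge> 1" "r' \<ge> 0" "c > 0" "C > 0"
    "\<And>q v \<xi>. V q \<xi> \<le> 0 \<Longrightarrow> V (\<theta> H q) (L H q v \<xi>) + c * (norm (\<iota> (L r' q v \<xi>)))\<^sup>2 \<le> 0"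
    "\<And>q v \<xi>. \<bar>V (\<theta> H q) (L H q v \<xi>)\<bar> \<le> C * (norm (\<iota> (L r' q v \<xi>)))\<^sup>2"
proof -
  obtain s1 l1 where l1: "s1 \<ge> 0" "l1 > 0" "\<forall>q v1 v2. \<forall>t\<in>{s1..s1 + 1}.
      norm (\<psi> t q v1 - \<psi> t q v2) \<le> l1 * norm (\<iota> v1 - \<iota> v2)"
    using lipschitz unfolding uniform_lipschitz_def by (meson zero_less_one)
  have "\<tau> + 1 > 0" using negative_constants(2) by simp
  with L_lipschitz obtain s2 l2 where l2: "s2 \<ge> 0" "l2 > 0" "\<forall>p v1 v2. \<forall>t\<in>{s2..s2 + (\<tau> + 1)}.
      norm (L t (fst p) (snd p) v1 - L t (fst p) (snd p) v2) \<le> l2 * norm (\<iota> v1 - \<iota> v2)"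
    unfolding uniform_lipschitz_def by meson
  obtain N where N: "N > 0" "\<And>x. norm (\<iota> x) \<le> norm x * N" using \<iota>.pos_bounded by blast
  obtain MQ where MQ: "\<And>q. norm (Q q) \<le> MQ"
    using forms_unfolded unfolding bdd_above_def by auto
  have MQ0: "MQ \<ge> 0" using MQ norm_ge_zero order_trans by blast
  \<comment> \<open>for \<open>s\<close> in the unit interval, \<open>r' - s\<close> lies in \<open>{s1..s1 + 1}\<close>, where \<open>\<psi>\<close> is smoothing\<close>
  define r' where "r' = s1 + 1"
  define H where "H = r' + (s2 + \<tau>)"
  define E where "E = exp (- 2 * exponent_bound * H)"
  define c where "c = E * \<delta> * exp (- 2 * exponent_bound) / (l1 * N)\<^sup>2"
  \<comment> \<open>the summand \<open>1\<close> ensures \<open>C > 0\<close>\<close>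
  define C where "C = MQ * l2\<^sup>2 + 1"
  have H: "H \<ge> \<tau>" "H \<ge> 1" "r' \<ge> 0"
    using l1 l2 negative_constants(2) by (auto simp: H_def r'_def)
  have c: "c > 0" using l1 N negative_constants(1) by (auto simp: c_def E_def)
  have C: "C > 0" using MQ0 by (simp add: C_def add_nonneg_pos)
  have nonlinear: "V (\<theta> H q) (\<psi> H q v1 - \<psi> H q v2)
      \<le> E * V q (v1 - v2) - c * (norm (\<iota> (\<psi> r' q v1 - \<psi> r' q v2)))\<^sup>2"
    if neg: "V q (v1 - v2) \<le> 0" for q v1 v2
  proof -
    define D where "D s = \<psi> s q v1 - \<psi> s q v2" for s
    define m where "m = (norm (\<iota> (D r')) / (l1 * N))\<^sup>2"
    have "m \<le> (norm (\<iota> (D s)))\<^sup>2" if s: "s \<in> {0..1}" for s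
    proof -
      have "D r' = \<psi> (r' - s) (\<theta> s q) (\<psi> s q v1) - \<psi> (r' - s) (\<theta> s q) (\<psi> s q v2)"
        using \<psi>_add[of "r' - s" s] s l1 by (simp add: D_def r'_def)
      also have "norm \<dots> \<le> l1 * norm (\<iota> (\<psi> s q v1) - \<iota> (\<psi> s q v2))"
        using l1(3) s by (auto simp: r'_def)
      finally have "norm (D r') \<le> l1 * norm (\<iota> (D s))" by (simp add: D_def \<iota>.diff)
      hence "norm (D r') * N \<le> l1 * norm (\<iota> (D s)) * N" using N by (intro mult_right_mono) auto
      with N(2)[of "D r'"] have "norm (\<iota> (D r')) \<le> norm (\<iota> (D s)) * (l1 * N)" by (simp add: ac_simps)
      hence "norm (\<iota> (D r')) / (l1 * N) \<le> norm (\<iota> (D s))"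
        using l1 N by (simp add: pos_divide_le_eq)
      thus ?thesis unfolding m_def using l1 N by (intro power_mono) auto
    qed
    hence "V (\<theta> H q) (\<psi> H q v1 - \<psi> H q v2)
        \<le> E * (V q (v1 - v2) - \<delta> * exp (- 2 * exponent_bound) * m)"
      unfolding E_def D_def
      by (intro negative_squeezing_discrete H neg) (auto simp: m_def)
    also have "\<dots> = E * V q (v1 - v2) - c * (norm (\<iota> (D r')))\<^sup>2"
      by (simp add: c_def m_def power_divide right_diff_distrib)
    finally show ?thesis by (simp add: D_def)
  qed
  have "V (\<theta> H q) (L H q v \<xi>) + c * (norm (\<iota> (L r' q v \<xi>)))\<^sup>2 \<le> 0" if neg: "V q \<xi> \<le> 0" for q v \<xi>
  proof -
    have "E * V q \<xi> \<le> 0" using neg by (simp add: E_def mult_nonneg_nonpos)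
    thus ?thesis using linear_squeezing_limit[OF H(1) H(3) neg nonlinear, of v] by simp
  qed
  moreover have "\<bar>V (\<theta> H q) (L H q v \<xi>)\<bar> \<le> C * (norm (\<iota> (L r' q v \<xi>)))\<^sup>2" for q v \<xi>
  proof -
    have t: "s2 + \<tau> \<ge> 0" using l2 negative_constants(2) by simp
    have eq: "L H q v \<xi> = L (s2 + \<tau>) (\<theta> r' q) (\<psi> r' q v) (L r' q v \<xi>)"
      using L_add[OF t H(3)] by (simp add: H_def add.commute)
    have "norm (L H q v \<xi>) \<le> l2 * norm (\<iota> (L r' q v \<xi>))"
      using l2(3)[rule_format, of "s2 + \<tau>" "(\<theta> r' q, \<psi> r' q v)" "L r' q v \<xi>" 0] negative_constants(2)
      by (simp add: eq linear_0[OF L_linear[OF t]])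
    hence "(norm (L H q v \<xi>))\<^sup>2 \<le> (l2 * norm (\<iota> (L r' q v \<xi>)))\<^sup>2" by (intro power_mono) auto
    hence "MQ * (norm (L H q v \<xi>))\<^sup>2 \<le> MQ * (l2 * norm (\<iota> (L r' q v \<xi>)))\<^sup>2"
      using MQ0 by (rule mult_left_mono)
    moreover have "\<bar>V (\<theta> H q) (L H q v \<xi>)\<bar> \<le> MQ * (norm (L H q v \<xi>))\<^sup>2"
      using abs_Vform_le[of Q "\<theta> H q" "L H q v \<xi>"] MQ[of "\<theta> H q"]
      by (meson mult_right_mono order_trans zero_le_power2)
    ultimately have "\<bar>V (\<theta> H q) (L H q v \<xi>)\<bar> \<le> MQ * l2\<^sup>2 * (norm (\<iota> (L r' q v \<xi>)))\<^sup>2"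
      by (simp add: power_mult_distrib)
    thus ?thesis by (simp add: C_def distrib_right add_increasing2)
  qed
  ultimately show ?thesis using that H c C by blast
qed

definition orbit_form :: "real \<Rightarrow> 'q \<Rightarrow> 'e \<Rightarrow> nat \<Rightarrow> 'e \<Rightarrow> real"
  where "orbit_form H q v n \<xi> = V (\<theta> (real n * H) q) (L (real n * H) q v \<xi>)"

definition orbit_energy :: "real \<Rightarrow> real \<Rightarrow> 'q \<Rightarrow> 'e \<Rightarrow> nat \<Rightarrow> 'e \<Rightarrow> real"
  where "orbit_energy H r' q v n \<xi> = (norm (\<iota> (L (real n * H + r') q v \<xi>)))\<^sup>2"

lemma orbit_form_zero: "orbit_form H q v 0 \<xi> = V q \<xi>"
  by (simp add: orbit_form_def)

text \<open>
  The constants of one step do not depend on the point of the skew-product, so they serve along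
  every orbit, and they can be compared at different points \<open>v\<close>.
\<close>

lemma squeezed_forms_along_orbit:
  "\<exists>H r' c C. H \<ge> \<tau> \<and> H \<ge> 1 \<and> r' \<ge> 0 \<and>
    (\<forall>q v. squeezed_forms (orbit_form H q v) (orbit_energy H r' q v) c C)"
proof -
  obtain H r' c C where H: "H \<ge> \<tau>" "H \<ge> 1" "r' \<ge> 0" "c > 0" "C > 0"
    and squeeze: "\<And>q v \<xi>. V q \<xi> \<le> 0 \<Longrightarrow> V (\<theta> H q) (L H q v \<xi>) + c * (norm (\<iota> (L r' q v \<xi>)))\<^sup>2 \<le> 0"
    and smooth: "\<And>q v \<xi>. \<bar>V (\<theta> H q) (L H q v \<xi>)\<bar> \<le> C * (norm (\<iota> (L r' q v \<xi>)))\<^sup>2"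
    using one_step_squeezing by metis
  have "squeezed_forms (orbit_form H q v) (orbit_energy H r' q v) c C" for q v
    unfolding orbit_form_def[abs_def] orbit_energy_def[abs_def]
  proof
    fix n \<xi>
    have n: "real n * H \<ge> 0" using H by simp
    have lin: "linear (L (real n * H) q v)" by (rule L_linear[OF n])
    have "bilinear (\<lambda>x y. b (\<theta> (real n * H) q) (L (real n * H) q v x) (L (real n * H) q v y))"
      using re_form_bilinear[of Q "\<theta> (real n * H) q"] lin
      unfolding bilinear_def linear_iff by simp
    thus "quadratic_form (\<lambda>\<xi>. V (\<theta> (real n * H) q) (L (real n * H) q v \<xi>))"
      unfolding quadratic_form_def using b_sym
      by (intro exI[of _ "\<lambda>x y. b (\<theta> (real n * H) q) (L (real n * H) q v x) (L (real n * H) q v y)"])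
        (simp add: Vform_re_form)
    have n': "real n * H + r' \<ge> 0" using H by simp
    have "bilinear (\<lambda>x y. \<iota> (L (real n * H + r') q v x) \<bullet> \<iota> (L (real n * H + r') q v y))"
      using L_linear[OF n', of q v] unfolding bilinear_def linear_iff
      by (simp add: \<iota>.add \<iota>.scaleR inner_add_left inner_add_right)
    thus "quadratic_form (\<lambda>\<xi>. (norm (\<iota> (L (real n * H + r') q v \<xi>)))\<^sup>2)"
      unfolding quadratic_form_def
      by (intro exI[of _ "\<lambda>x y. \<iota> (L (real n * H + r') q v x) \<bullet> \<iota> (L (real n * H + r') q v y)"])
        (simp add: power2_norm_eq_inner inner_commute)
    define q' v' \<xi>' where "q' = \<theta> (real n * H) q" and "v' = \<psi> (real n * H) q v"
      and "\<xi>' = L (real n * H) q v \<xi>"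
    have H0: "H \<ge> 0" using H by simp
    have S: "L (real (Suc n) * H) q v \<xi> = L H q' v' \<xi>'" "\<theta> (real (Suc n) * H) q = \<theta> H q'"
      "L (real n * H + r') q v \<xi> = L r' q' v' \<xi>'"
      using L_add[OF H0 n, of q v \<xi>] \<theta>_add[OF H0 n, of q] L_add[OF H(3) n, of q v \<xi>]
      by (simp_all add: q'_def v'_def \<xi>'_def distrib_right add.commute)
    show "V (\<theta> (real (Suc n) * H) q) (L (real (Suc n) * H) q v \<xi>)
        + c * (norm (\<iota> (L (real n * H + r') q v \<xi>)))\<^sup>2 \<le> 0"
      if "V (\<theta> (real n * H) q) (L (real n * H) q v \<xi>) \<le> 0"
      unfolding S by (rule squeeze) (use that in \<open>simp add: q'_def \<xi>'_def\<close>)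
    show "V (\<theta> (real (Suc n) * H) q) (L (real (Suc n) * H) q v \<xi>) < 0"
      if "V (\<theta> (real n * H) q) (L (real n * H) q v \<xi>) < 0"
      unfolding S using that H by (intro linear_stays_negative) (auto simp: q'_def \<xi>'_def)
    show "\<bar>V (\<theta> (real (Suc n) * H) q) (L (real (Suc n) * H) q v \<xi>)\<bar>
        \<le> C * (norm (\<iota> (L (real n * H + r') q v \<xi>)))\<^sup>2"
      unfolding S by (rule smooth)
  qed (use H in auto)
  thus ?thesis using H by blast
qed

section \<open>Positive classes of the linearized semicocycle\<close>

abbreviation N where "N \<equiv> lin_pos_class \<theta> L Q"

text \<open>
  A vector that is negative at some time stays negative at all times that are later by at least
  \<open>max \<tau> 1\<close>; so nonnegativity has to be tested at arbitrarily late times only.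
\<close>

lemma lin_pos_classI:
  assumes late: "\<And>t. t \<ge> 0 \<Longrightarrow> \<exists>s \<ge> t + max \<tau> 1. V (\<theta> s q) (L s q v \<xi>) \<ge> 0"
  shows "\<xi> \<in> N q v"
  unfolding lin_pos_class_def
proof (intro CollectI allI impI, rule ccontr)
  fix t :: real assume t: "t \<ge> 0" and "\<not> V (\<theta> t q) (L t q v \<xi>) \<ge> 0"
  hence neg: "V (\<theta> t q) (L t q v \<xi>) < 0" by simp
  obtain s where s: "s \<ge> t + max \<tau> 1" "V (\<theta> s q) (L s q v \<xi>) \<ge> 0" using late[OF t] by blast
  have "V (\<theta> (s - t) (\<theta> t q)) (L (s - t) (\<theta> t q) (\<psi> t q v) (L t q v \<xi>)) < 0"
    by (rule linear_stays_negative) (use s neg in auto)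
  with s t show False using \<theta>_add[of "s - t" t q] L_add[of "s - t" t q v \<xi>] by simp
qed

lemma lin_pos_classI_late:
  assumes "\<And>t. t \<ge> \<tau> \<Longrightarrow> V (\<theta> t q) (L t q v \<xi>) \<ge> 0"
  shows "\<xi> \<in> N q v"
proof (rule lin_pos_classI)
  fix t :: real assume "t \<ge> 0"
  thus "\<exists>s \<ge> t + max \<tau> 1. V (\<theta> s q) (L s q v \<xi>) \<ge> 0"
    by (intro exI[of _ "t + max \<tau> 1"] conjI assms) auto
qed

lemma lin_pos_class_orbit_iff:
  assumes H: "H \<ge> \<tau>" "H \<ge> 1"
  shows "\<xi> \<in> N q v \<longleftrightarrow> (\<forall>n. orbit_form H q v n \<xi> \<ge> 0)"
proof
  assume "\<xi> \<in> N q v"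
  thus "\<forall>n. orbit_form H q v n \<xi> \<ge> 0"
    using H by (simp add: lin_pos_class_def orbit_form_def)
next
  assume pos: "\<forall>n. orbit_form H q v n \<xi> \<ge> 0"
  show "\<xi> \<in> N q v"
  proof (rule lin_pos_classI)
    fix t :: real
    obtain n :: nat where "real n > t + max \<tau> 1" using reals_Archimedean2 by blast
    moreover have "real n \<le> real n * H" using H by (simp add: mult_le_cancel_left1)
    ultimately show "\<exists>s \<ge> t + max \<tau> 1. V (\<theta> s q) (L s q v \<xi>) \<ge> 0"
      using pos by (intro exI[of _ "real n * H"]) (auto simp: orbit_form_def)
  qed
qed

lemma lin_pos_class_nonneg: "\<xi> \<in> N q v \<Longrightarrow> V q \<xi> \<ge> 0"
  unfolding lin_pos_class_def by (drule CollectD, drule spec[of _ 0]) simp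

lemma lin_pos_class_scl:
  assumes "x \<in> K" "\<xi> \<in> N q v" shows "scl x \<xi> \<in> N q v"
proof -
  have "L t q v (scl x \<xi>) = scl x (L t q v \<xi>)" if "t \<ge> 0" for t
    using L_linear_over[OF that, of q v] assms(1) unfolding linear_over_def by blast
  thus ?thesis using assms by (simp add: lin_pos_class_def Vform_scl)
qed

lemma lin_pos_class_diff:
  assumes "\<xi>1 \<in> N q v" "\<xi>2 \<in> N q v" shows "\<xi>1 - \<xi>2 \<in> N q v"
proof -
  obtain H r' c C where H: "H \<ge> \<tau>" "H \<ge> 1"
    and sf: "squeezed_forms (orbit_form H q v) (orbit_energy H r' q v) c C"
    using squeezed_forms_along_orbit by blast
  show ?thesis
    using assms squeezed_forms.difference_nonneg[OF sf] unfolding lin_pos_class_orbit_iff[OF H] by blast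
qed

lemma lin_pos_class_subspace_over: "subspace_over K scl (N q v)"
  unfolding subspace_over_def
proof (intro conjI ballI lin_pos_class_scl)
  show zero: "0 \<in> N q v"
    by (simp add: lin_pos_class_def linear_0[OF L_linear] Vform_def pairing_def blinfun.zero_right)
  fix x y assume "x \<in> N q v" "y \<in> N q v"
  from lin_pos_class_diff[OF this(1) lin_pos_class_diff[OF zero this(2)]]
  show "x + y \<in> N q v" by simp
qed

lemmas lin_pos_class_subspace = subspace_over_real[OF lin_pos_class_subspace_over]

lemma lin_pos_class_Em: "\<xi> \<in> N q v \<Longrightarrow> \<xi> \<in> Em q \<Longrightarrow> \<xi> = 0"
  using lin_pos_class_nonneg Em_negative by fastforce

lemma lin_pos_class_inj: "inj_on (\<pi>p q) (N q v)"
proof (rule inj_onI)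
  fix x y assume "x \<in> N q v" "y \<in> N q v" "\<pi>p q x = \<pi>p q y"
  hence "x - y \<in> N q v" "x - y \<in> Em q"
    by (simp_all add: lin_pos_class_diff linear_diff[OF proj_plus_linear] flip: proj_plus_zero_iff)
  thus "x = y" using lin_pos_class_Em by force
qed

lemma continuous_orbit_form: "H \<ge> 0 \<Longrightarrow> continuous_on X (orbit_form H q v n)"
  unfolding orbit_form_def[abs_def]
  by (rule continuous_on_compose2[OF continuous_on_Vform linear_continuous_on[OF L_bounded_linear]]) auto

text \<open>
  Let \<open>y = w - \<xi>\<close>. If \<open>W\<^sub>T(w)\<close> exceeded \<open>- \<mu>\<close>, then domination would keep \<open>W\<^sub>T(y)\<close> above \<open>- 4 \<mu>\<close>;
  but \<open>W\<^sub>T\<close> is bounded away from \<open>0\<close> on the compact shell in which \<open>y\<close> lies. The time \<open>T\<close> is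
  chosen first, from \<open>\<epsilon>\<close> and \<open>R\<close>, and then \<open>\<mu>\<close> from \<open>T\<close>.
\<close>

lemma class_gap:
  assumes \<epsilon>: "\<epsilon> > 0"
  shows "\<exists>T\<ge>\<tau>. \<exists>\<mu>>0. \<forall>\<xi> w. \<xi> \<in> N q v \<and> norm \<xi> \<le> R \<and> norm w \<le> R \<and> w - \<xi> \<in> Em q \<and>
    \<epsilon> \<le> norm (w - \<xi>) \<longrightarrow> V (\<theta> T q) (L T q v w) \<le> - \<mu>"
proof -
  obtain H r' c C where H: "H \<ge> \<tau>" "H \<ge> 1"
    and "squeezed_forms (orbit_form H q v) (orbit_energy H r' q v) c C"
    using squeezed_forms_along_orbit by blast
  then interpret squeezed_forms "orbit_form H q v" "orbit_energy H r' q v" c C by simp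
  obtain m0 where m0: "m0 > 0" "\<And>u. u \<in> Em q \<Longrightarrow> (norm u)\<^sup>2 \<le> m0 * - V q u"
    using Em_coercive by blast
  define B where "B = 2 * (norm (Q q) * (2 * R)\<^sup>2)"
  \<comment> \<open>\<open>m \<ge> 1\<close> yields \<open>T \<ge> H \<ge> \<tau>\<close>\<close>
  have "eventually (\<lambda>m. rate ^ m * B \<le> \<epsilon>\<^sup>2 / m0 \<and> m \<ge> 1) sequentially"
    using \<epsilon> m0 by (intro eventually_conj rate_power_small eventually_ge_at_top) auto
  from eventually_happens'[OF sequentially_bot this]
  obtain m where m: "rate ^ m * B \<le> \<epsilon>\<^sup>2 / m0" "m \<ge> 1" by blast
  define T where "T = real m * H"
  have "1 * H \<le> real m * H" using m H by (intro mult_right_mono) auto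
  hence T: "T \<ge> \<tau>" using H unfolding T_def by linarith
  define shell where "shell = {u \<in> Em q. \<epsilon> \<le> norm u \<and> norm u \<le> 2 * R}"
  have shell_neg: "orbit_form H q v 0 y < 0" "orbit_form H q v m y < 0" if "y \<in> shell" for y
  proof -
    have "y \<in> Em q" "y \<noteq> 0" using that \<epsilon> by (auto simp: shell_def)
    thus "orbit_form H q v 0 y < 0" by (simp add: orbit_form_zero Em_negative)
    from stays_negative[OF this, of m] show "orbit_form H q v m y < 0" by simp
  qed
  obtain \<mu> where \<mu>: "\<mu> > 0" "\<And>y. y \<in> shell \<Longrightarrow> orbit_form H q v m y \<le> - 4 * \<mu>"
  proof (cases "shell = {}")
    case True
    thus ?thesis using that[of 1] by simp
  next
    case False
    have "compact shell" unfolding shell_def by (rule Em_shell_compact)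
    then obtain y0 where y0: "y0 \<in> shell" "\<forall>y\<in>shell. orbit_form H q v m y \<le> orbit_form H q v m y0"
      using continuous_attains_sup[of shell "orbit_form H q v m"] False continuous_orbit_form[of H] H
      by fastforce
    show ?thesis using that[of "- orbit_form H q v m y0 / 4"] y0 shell_neg(2)[of y0] by simp
  qed
  have "V (\<theta> T q) (L T q v w) \<le> - \<mu>"
    if \<xi>: "\<xi> \<in> N q v" "norm \<xi> \<le> R" and w: "norm w \<le> R" "w - \<xi> \<in> Em q" "\<epsilon> \<le> norm (w - \<xi>)" for \<xi> w
  proof -
    have R: "norm (w - \<xi>) \<le> 2 * R" "norm (w + \<xi>) \<le> 2 * R"
      using norm_triangle_ineq4[of w \<xi>] norm_triangle_ineq[of w \<xi>] \<xi> w by auto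
    have y: "w - \<xi> \<in> shell" using R w by (simp add: shell_def)
    have "\<bar>V q (w + \<xi>)\<bar> \<le> norm (Q q) * (norm (w + \<xi>))\<^sup>2" by (rule abs_Vform_le)
    also have "\<dots> \<le> norm (Q q) * (2 * R)\<^sup>2" using R by (intro mult_left_mono power_mono) auto
    finally have "2 * V q (w + \<xi>) \<le> B" unfolding B_def by simp
    hence "rate ^ m * (2 * V q (w + \<xi>)) \<le> rate ^ m * B"
      using rate_bounds by (intro mult_left_mono) auto
    also have "\<dots> \<le> \<epsilon>\<^sup>2 / m0" by (rule m)
    also have "\<dots> \<le> (norm (w - \<xi>))\<^sup>2 / m0"
      using w(3) \<epsilon> m0(1) by (intro divide_right_mono power_mono) auto
    also have "\<dots> \<le> - V q (w - \<xi>)" using m0(2)[OF w(2)] m0(1) by (simp add: pos_divide_le_eq mult.commute)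
    finally have small: "2 * rate ^ m * orbit_form H q v 0 (w + \<xi>) \<le> - orbit_form H q v 0 (w - \<xi>)"
      by (simp add: orbit_form_zero)
    have "orbit_form H q v m \<xi> \<ge> 0" using \<xi>(1) lin_pos_class_orbit_iff[OF H] by blast
    hence "orbit_form H q v m (w + \<xi>) + orbit_form H q v m (w - \<xi>) \<ge> - 2 * - orbit_form H q v m w"
      using quadratic_form_parallelogram[OF W_quadratic[of m], of w \<xi>] by simp
    from difference_almost_null[OF shell_neg(1)[OF y] small this]
    have "orbit_form H q v m w \<le> - \<mu>" using \<mu>(2)[OF y] by simp
    thus ?thesis by (simp add: orbit_form_def T_def)
  qed
  thus ?thesis using T \<mu>(1) by blast
qed

text \<open>
  Let \<open>\<sigma>\<close> and \<open>\<sigma>'\<close> be the Hilbert norms at a time \<open>T\<close> for the points \<open>v\<close> and \<open>v'\<close>, and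
  \<open>y = \<xi>' - \<xi>\<close>. Domination at \<open>v\<close> and at \<open>v'\<close> gives \<open>4 \<sigma>(\<xi>) \<le> \<sigma>(y)\<close> and \<open>4 \<sigma>'(\<xi>') \<le> \<sigma>'(y)\<close>. As
  \<open>\<sigma>'\<close> differs from \<open>\<sigma>\<close> by at most \<open>\<kappa>\<close>, the triangle inequality makes \<open>\<sigma>(y)\<close> at most \<open>3 \<kappa>\<close>, which
  is too small for an element \<open>y\<close> of the compact shell.
\<close>

lemma class_stability:
  assumes \<epsilon>: "\<epsilon> > 0"
  shows "\<exists>T\<ge>0. \<exists>\<kappa>>0. \<forall>v' \<xi> \<xi>'.
    (\<forall>x. norm x \<le> 2 * R \<longrightarrow> norm (\<iota> (L T q v' x) - \<iota> (L T q v x)) \<le> \<kappa>) \<and>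
    \<xi> \<in> N q v \<and> \<xi>' \<in> N q v' \<and> norm \<xi> \<le> R \<and> norm \<xi>' \<le> R \<and> \<xi>' - \<xi> \<in> Em q \<longrightarrow> norm (\<xi>' - \<xi>) < \<epsilon>"
proof -
  obtain H r' c C where H: "H \<ge> \<tau>" "H \<ge> 1" "r' \<ge> 0"
    and sf: "\<forall>v. squeezed_forms (orbit_form H q v) (orbit_energy H r' q v) c C"
    using squeezed_forms_along_orbit by blast
  interpret squeezed_forms "orbit_form H q v" "orbit_energy H r' q v" c C using sf by blast
  obtain m0 where m0: "m0 > 0" "\<And>u. u \<in> Em q \<Longrightarrow> (norm u)\<^sup>2 \<le> m0 * - V q u"
    using Em_coercive by blast
  define B where "B = norm (Q q) * R\<^sup>2"
  define \<mu> where "\<mu> = \<epsilon>\<^sup>2 / m0"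
  have \<mu>: "\<mu> > 0" using \<epsilon> m0 by (simp add: \<mu>_def)
  have "eventually (\<lambda>m. rate ^ m * (16 * (B * C)) \<le> c * \<mu>) sequentially"
    using \<mu> c_pos by (intro rate_power_small) auto
  from eventually_happens'[OF sequentially_bot this]
  obtain m where "rate ^ m * (16 * (B * C)) \<le> c * \<mu>" by blast
  hence m: "16 * (rate ^ m * B * C) \<le> c * \<mu>" by (simp add: ac_simps)
  define T where "T = real m * H + r'"
  have T: "T \<ge> 0" using H by (simp add: T_def)
  define shell where "shell = {u \<in> Em q. \<epsilon> \<le> norm u \<and> norm u \<le> 2 * R}"
  have shell_neg: "V q y \<le> - \<mu>" if "y \<in> shell" for y
  proof -
    have "\<epsilon>\<^sup>2 \<le> (norm y)\<^sup>2" using that \<epsilon> by (intro power_mono) (auto simp: shell_def)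
    also have "\<dots> \<le> m0 * - V q y" using that by (intro m0) (auto simp: shell_def)
    finally have "\<epsilon>\<^sup>2 / m0 \<le> - V q y"
      using m0(1) by (metis mult.commute pos_divide_le_eq)
    thus ?thesis by (simp add: \<mu>_def)
  qed
  define \<sigma> where "\<sigma> u x = norm (\<iota> (L T q u x))" for u x
  have energy: "orbit_energy H r' q u m x = (\<sigma> u x)\<^sup>2" for u x
    by (simp add: orbit_energy_def T_def \<sigma>_def)
  have "\<sigma> v y > 0" if "y \<in> shell" for y
  proof -
    have "orbit_form H q v 0 y < 0" using shell_neg[OF that] \<mu> by (simp add: orbit_form_zero)
    from stays_negative[OF this, of "Suc m"] have "0 < \<bar>orbit_form H q v (Suc m) y\<bar>" by simp
    also have "\<dots> \<le> C * (\<sigma> v y)\<^sup>2" using smoothing[of m y] by (simp add: energy)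
    finally have "\<sigma> v y \<noteq> 0" using C_pos by auto
    thus ?thesis by (simp add: \<sigma>_def)
  qed
  moreover have "continuous_on shell (\<sigma> v)"
    unfolding \<sigma>_def by (intro continuous_intros \<iota>.continuous_on linear_continuous_on L_bounded_linear T)
  moreover have "compact shell" unfolding shell_def by (rule Em_shell_compact)
  ultimately obtain s0 where s0: "s0 > 0" "\<And>y. y \<in> shell \<Longrightarrow> s0 \<le> \<sigma> v y"
    using continuous_attains_inf[of shell "\<sigma> v"] by (cases "shell = {}") (use zero_less_one in \<open>blast+\<close>)
  have "norm (\<xi>' - \<xi>) < \<epsilon>"
    if close: "\<And>x. norm x \<le> 2 * R \<Longrightarrow> norm (\<iota> (L T q v' x) - \<iota> (L T q v x)) \<le> s0 / 4"
      and \<xi>: "\<xi> \<in> N q v" "norm \<xi> \<le> R" and \<xi>': "\<xi>' \<in> N q v'" "norm \<xi>' \<le> R"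
      and y: "\<xi>' - \<xi> \<in> Em q" for v' \<xi> \<xi>'
  proof (rule ccontr)
    assume "\<not> norm (\<xi>' - \<xi>) < \<epsilon>"
    moreover have R: "norm (\<xi>' - \<xi>) \<le> 2 * R" "norm \<xi>' \<le> 2 * R"
      using norm_triangle_ineq4[of \<xi>' \<xi>] \<xi> \<xi>' norm_ge_zero[of \<xi>] by linarith+
    ultimately have shell: "\<xi>' - \<xi> \<in> shell" using y by (simp add: shell_def)
    \<comment> \<open>at either base point the energy of a positive vector is a small part of that of a negative one\<close>
    have small: "4 * \<sigma> u x \<le> \<sigma> u (\<xi>' - \<xi>)" if x: "x \<in> N q u" "norm x \<le> R" for u x
    proof -
      have "V q x \<le> norm (Q q) * (norm x)\<^sup>2" using abs_Vform_le[of Q q x] by simp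
      also have "\<dots> \<le> B" unfolding B_def using x by (intro mult_left_mono power_mono) auto
      finally have B: "orbit_form H q u 0 x \<le> B" by (simp add: orbit_form_zero)
      have "16 * orbit_energy H r' q u m x \<le> orbit_energy H r' q u m (\<xi>' - \<xi>)"
        using x(1) lin_pos_class_orbit_iff[OF H(1,2)] B shell_neg[OF shell] \<mu> m
        by (intro squeezed_forms.smooth_part_small[OF sf[rule_format, of u], of m x B "\<xi>' - \<xi>" \<mu>])
          (auto simp: orbit_form_zero)
      hence "(4 * \<sigma> u x)\<^sup>2 \<le> (\<sigma> u (\<xi>' - \<xi>))\<^sup>2" by (simp add: energy power_mult_distrib)
      thus ?thesis by (rule power2_le_imp_le) (simp add: \<sigma>_def)
    qed
    have "\<sigma> v (\<xi>' - \<xi>) \<le> \<sigma> v \<xi>' + \<sigma> v \<xi>"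
      unfolding \<sigma>_def using norm_triangle_ineq4 by (simp add: linear_diff[OF L_linear[OF T]] \<iota>.diff)
    moreover have "\<sigma> v \<xi>' \<le> \<sigma> v' \<xi>' + s0 / 4" "\<sigma> v' (\<xi>' - \<xi>) \<le> \<sigma> v (\<xi>' - \<xi>) + s0 / 4"
      using close[OF R(2)] close[OF R(1)] norm_triangle_sub[of "\<iota> (L T q v \<xi>')" "\<iota> (L T q v' \<xi>')"]
        norm_triangle_sub[of "\<iota> (L T q v' (\<xi>' - \<xi>))" "\<iota> (L T q v (\<xi>' - \<xi>))"]
        norm_minus_commute[of "\<iota> (L T q v \<xi>')" "\<iota> (L T q v' \<xi>')"]
      unfolding \<sigma>_def by linarith+
    moreover have "s0 \<le> \<sigma> v (\<xi>' - \<xi>)" by (rule s0(2)[OF shell])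
    ultimately show False using small[OF \<xi>] small[OF \<xi>'] s0(1) by linarith
  qed
  thus ?thesis using T s0(1) by (intro exI[of _ T] conjI exI[of _ "s0 / 4"]) auto
qed

text \<open>
  The limit in the differentiability property is uniform over bounded sets of directions, so the
  direction \<open>w z\<close> may vary along the filter without converging.
\<close>

lemma quotient_asymptotically_nonneg:
  fixes h :: "'z \<Rightarrow> real"
  assumes t: "t \<ge> \<tau>" and \<mu>: "\<mu> > 0" and h: "(h \<longlongrightarrow> 0) F" and h0: "eventually (\<lambda>z. h z \<noteq> 0) F"
    and w: "eventually (\<lambda>z. norm (w z) \<le> R) F"
    and pos: "eventually (\<lambda>z. V (\<theta> t q) (\<psi> t q (v + h z *\<^sub>R w z) - \<psi> t q v) \<ge> 0) F"
  shows "eventually (\<lambda>z. V (\<theta> t q) (L t q v (w z)) > - \<mu>) F"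
proof -
  have t0: "t \<ge> 0" using t negative_constants(2) by simp
  obtain l where l: "\<And>x. norm (L t q v x) \<le> norm x * l" "l > 0"
    using bounded_linear.pos_bounded[OF L_bounded_linear[OF t0]] by blast
  define A where "A = norm (Q (\<theta> t q)) * (2 * \<bar>R\<bar> * l + 1) + 1"
  have A: "A > 0" unfolding A_def using l(2) by (intro add_nonneg_pos mult_nonneg_nonneg) auto
  define e where "e = min 1 (\<mu> / A)"
  have e: "e > 0" "e \<le> 1" "e * A \<le> \<mu>" using \<mu> A by (auto simp: e_def min_def field_simps)
  have h_lim: "filterlim h (at 0) F" using h h0 by (simp add: filterlim_at)
  have "\<forall>\<^sub>F k in at 0. \<forall>x\<in>cball 0 R. dist (real_quotient t q v k x) (L t q v x) < e"
    by (rule uniform_limitD[OF uniform_limit_E[OF t bounded_cball] e(1)])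
  from eventually_compose_filterlim[OF this h_lim]
  have "\<forall>\<^sub>F z in F. \<forall>x\<in>cball 0 R. dist (real_quotient t q v (h z) x) (L t q v x) < e" .
  thus ?thesis using h0 w pos
  proof eventually_elim
    case (elim z)
    define d where "d = real_quotient t q v (h z) (w z)"
    define l0 where "l0 = L t q v (w z)"
    have dl: "norm (d - l0) < e" using elim by (auto simp: d_def l0_def dist_norm)
    have "norm l0 \<le> norm (w z) * l" unfolding l0_def by (rule l(1))
    also have "\<dots> \<le> \<bar>R\<bar> * l" using elim l(2) by (intro mult_right_mono) auto
    finally have l0: "norm l0 \<le> \<bar>R\<bar> * l" .
    have "norm (d + l0) = norm ((d - l0) + 2 *\<^sub>R l0)" by (simp add: scaleR_2)
    also have "\<dots> \<le> norm (d - l0) + norm (2 *\<^sub>R l0)" by (rule norm_triangle_ineq)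
    also have "\<dots> \<le> 1 + 2 * (\<bar>R\<bar> * l)" using dl e(2) l0 by simp
    finally have sum: "norm (d + l0) \<le> 2 * \<bar>R\<bar> * l + 1" by simp
    have "V (\<theta> t q) d \<ge> 0"
      using elim unfolding d_def real_quotient_def by (simp add: Vform_scaleR)
    moreover have "V (\<theta> t q) d - V (\<theta> t q) l0 = b (\<theta> t q) (d - l0) (d + l0)"
      using b_sym[of "\<theta> t q" d l0]
      by (simp add: Vform_re_form bilinear_lsub[OF re_form_bilinear] bilinear_radd[OF re_form_bilinear])
    moreover have "\<bar>b (\<theta> t q) (d - l0) (d + l0)\<bar> < \<mu>"
    proof -
      have "\<bar>b (\<theta> t q) (d - l0) (d + l0)\<bar> \<le> norm (Q (\<theta> t q)) * norm (d - l0) * norm (d + l0)"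
        by (rule abs_re_form_le)
      also have "\<dots> \<le> norm (Q (\<theta> t q)) * e * (2 * \<bar>R\<bar> * l + 1)"
        using dl e(1) sum by (intro mult_mono mult_nonneg_nonneg) auto
      also have "\<dots> < e * A" using e(1) by (simp add: A_def algebra_simps)
      finally show ?thesis using e(3) by simp
    qed
    ultimately show ?case unfolding l0_def by linarith
  qed
qed

lemma \<psi>_has_derivative:
  assumes t: "t \<ge> \<tau>" shows "(\<psi> t q has_derivative L t q v) (at v within X)"
proof (rule has_derivative_at_withinI)
  have t0: "t \<ge> 0" using t negative_constants(2) by simp
  interpret Lt: bounded_linear "L t q v" by (rule L_bounded_linear[OF t0])
  show "(\<psi> t q has_derivative L t q v) (at v)"
    unfolding has_derivative_at_within
  proof (intro conjI Lt.bounded_linear tendstoI)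
    fix e :: real assume e: "e > 0"
    have "\<forall>\<^sub>F h in at 0. \<forall>\<xi>\<in>cball 0 1. dist (real_quotient t q v h \<xi>) (L t q v \<xi>) < e"
      by (rule uniform_limitD[OF uniform_limit_E[OF t bounded_cball] e])
    moreover have "filterlim (\<lambda>y. norm (y - v)) (at 0) (at v)"
      unfolding filterlim_at
      by (auto simp: eventually_at_filter intro!: tendsto_eq_intros)
    ultimately have "\<forall>\<^sub>F y in at v. \<forall>\<xi>\<in>cball 0 1.
        dist (real_quotient t q v (norm (y - v)) \<xi>) (L t q v \<xi>) < e"
      by (rule eventually_compose_filterlim)
    moreover have "\<forall>\<^sub>F y in at v. y \<noteq> v" by (simp add: eventually_at_filter)
    ultimately show "\<forall>\<^sub>F y in at v. dist ((\<psi> t q y - \<psi> t q v - L t q v (y - v)) /\<^sub>R norm (y - v)) 0 < e"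
    proof eventually_elim
      case (elim y)
      define x where "x = (y - v) /\<^sub>R norm (y - v)"
      have x: "norm (y - v) *\<^sub>R x = y - v" "norm x \<le> 1" using elim(2) by (auto simp: x_def)
      have "dist (real_quotient t q v (norm (y - v)) x) (L t q v x) < e" using elim(1) x(2) by simp
      thus ?case
        by (simp add: real_quotient_def x(1) dist_norm scaleR_diff_right)
          (simp add: x_def Lt.scaleR)
    qed
  qed
qed

text \<open>
  The maps preserve positivity by the semicocycle identities; the differentiability and the two
  kinds of continuity are those of the linearization on the whole space.
\<close>

lemma time_map_C1_between:
  assumes t: "t \<ge> \<tau>"
  shows "C1_between K scl \<iota> (pos_class \<theta> \<psi> Q q v0) (lin_pos_class \<theta> L Q q)
    (pos_class \<theta> \<psi> Q (\<theta> t q) (\<psi> t q v0)) (lin_pos_class \<theta> L Q (\<theta> t q)) (\<psi> t q) (L t q)"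
proof -
  have t0: "t \<ge> 0" using t negative_constants(2) by simp
  have maps: "\<psi> t q ` pos_class \<theta> \<psi> Q q v0 \<subseteq> pos_class \<theta> \<psi> Q (\<theta> t q) (\<psi> t q v0)"
  proof
    fix x assume "x \<in> \<psi> t q ` pos_class \<theta> \<psi> Q q v0"
    then obtain v where v: "v \<in> pos_class \<theta> \<psi> Q q v0" "x = \<psi> t q v" by blast
    have "V (\<theta> s (\<theta> t q)) (\<psi> s (\<theta> t q) x - \<psi> s (\<theta> t q) (\<psi> t q v0)) \<ge> 0" if s: "s \<ge> 0" for s
    proof -
      have "V (\<theta> (s + t) q) (\<psi> (s + t) q v - \<psi> (s + t) q v0) \<ge> 0"
        using v(1) s t0 by (simp add: pos_class_def)
      thus ?thesis by (simp add: \<theta>_add[OF s t0] \<psi>_add[OF s t0] v(2))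
    qed
    thus "x \<in> pos_class \<theta> \<psi> Q (\<theta> t q) (\<psi> t q v0)" by (simp add: pos_class_def)
  qed
  have tangent: "L t q v ` N q v \<subseteq> N (\<theta> t q) (\<psi> t q v)" for v
  proof
    fix x assume "x \<in> L t q v ` N q v"
    then obtain \<xi> where \<xi>: "\<xi> \<in> N q v" "x = L t q v \<xi>" by blast
    have "V (\<theta> s (\<theta> t q)) (L s (\<theta> t q) (\<psi> t q v) x) \<ge> 0" if s: "s \<ge> 0" for s
    proof -
      have "V (\<theta> (s + t) q) (L (s + t) q v \<xi>) \<ge> 0"
        using \<xi>(1) s t0 by (simp add: lin_pos_class_def)
      thus ?thesis by (simp add: \<theta>_add[OF s t0] L_add[OF s t0] \<xi>(2))
    qed
    thus "x \<in> N (\<theta> t q) (\<psi> t q v)" by (simp add: lin_pos_class_def)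
  qed
  have joint: "continuous_on X (\<lambda>(v, \<xi>). L t q v \<xi>)" for X
  proof -
    have c: "continuous_on ({0..} \<times> UNIV \<times> UNIV) (\<lambda>(t, p, \<xi>). L t (fst p) (snd p) \<xi>)"
      using L_semicocycle unfolding semicocycle_def by blast
    have "continuous_on X (\<lambda>x::'e \<times> 'e. (t, (q, fst x), snd x))" by (intro continuous_intros)
    from continuous_on_compose2[OF c this] t0 show ?thesis by (simp add: case_prod_unfold image_subset_iff)
  qed
  have norm: "continuous_on X (\<lambda>v. Blinfun (\<lambda>\<xi>. \<iota> (L t q v \<xi>)))" for X
    using L_continuous_H[OF t0, of q] by (rule continuous_on_subset) simp
  show ?thesis
    unfolding C1_between_def
    by (intro conjI ballI maps tangent joint norm \<psi>_has_derivative[OF t] L_linear_over[OF t0])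
qed

end

section \<open>The positive class as a graph\<close>

lemma norm_blinfun_le_unit_ball:
  fixes f :: "'a::real_normed_vector \<Rightarrow>\<^sub>L 'b::real_normed_vector"
  assumes "e \<ge> 0" "\<And>x. norm x \<le> 1 \<Longrightarrow> norm (blinfun_apply f x) \<le> e"
  shows "norm f \<le> e"
proof (rule norm_blinfun_bound[OF assms(1)])
  fix x
  show "norm (blinfun_apply f x) \<le> e * norm x"
  proof (cases "x = 0")
    case False
    have "norm (blinfun_apply f (x /\<^sub>R norm x)) \<le> e" by (rule assms(2)) (use False in simp)
    thus ?thesis using False by (simp add: blinfun.scaleR_right divide_simps mult.commute)
  qed (simp add: blinfun.zero_right)
qed

locale positive_class_graph =
  squeezed_cocycle K scl j Q Em \<iota> \<theta> \<psi> \<delta> \<tau> am ap \<alpha>0 \<gamma> L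
  for K and scl :: "complex \<Rightarrow> 'e::real_normed_vector \<Rightarrow> 'e" and j
    and Q :: "'q::metric_space \<Rightarrow> 'e \<Rightarrow>\<^sub>L ('e \<Rightarrow>\<^sub>L complex)" and Em
    and \<iota> :: "'e \<Rightarrow> 'h::real_inner" and \<theta> \<psi> \<delta> \<tau> am ap \<alpha>0 \<gamma> L +
  fixes q :: 'q and VV :: "'e set" and \<Phi> :: "'e \<Rightarrow> 'e"
  assumes equivalent: "v \<in> VV \<Longrightarrow> w \<in> VV \<Longrightarrow> t \<ge> 0 \<Longrightarrow> Vform Q (\<theta> t q) (\<psi> t q v - \<psi> t q w) \<ge> 0"
    and homeo: "homeomorphism VV (E_plus Q Em q) (proj_plus Q Em q) \<Phi>"
begin

lemma \<Phi>_in: "\<zeta> \<in> Ep q \<Longrightarrow> \<Phi> \<zeta> \<in> VV"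
  and proj_\<Phi>: "\<zeta> \<in> Ep q \<Longrightarrow> \<pi>p q (\<Phi> \<zeta>) = \<zeta>"
  and \<Phi>_proj: "v \<in> VV \<Longrightarrow> \<Phi> (\<pi>p q v) = v"
  and continuous_\<Phi>: "continuous_on (Ep q) \<Phi>"
  using homeo unfolding homeomorphism_def by blast+

lemma \<Phi>_lipschitz: "\<exists>c>0. \<forall>\<zeta>\<in>Ep q. \<forall>\<zeta>'\<in>Ep q. norm (\<Phi> \<zeta> - \<Phi> \<zeta>') \<le> c * norm (\<zeta> - \<zeta>')"
proof -
  obtain c where c: "c > 0" "\<forall>v. V q v \<ge> 0 \<longrightarrow> norm v \<le> c * norm (\<pi>p q v)"
    using positive_cone_bound by blast
  have "norm (\<Phi> \<zeta> - \<Phi> \<zeta>') \<le> c * norm (\<zeta> - \<zeta>')" if "\<zeta> \<in> Ep q" "\<zeta>' \<in> Ep q" for \<zeta> \<zeta>'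
  proof -
    have "V q (\<Phi> \<zeta> - \<Phi> \<zeta>') \<ge> 0" using equivalent[OF \<Phi>_in[OF that(1)] \<Phi>_in[OF that(2)], of 0] by simp
    hence "norm (\<Phi> \<zeta> - \<Phi> \<zeta>') \<le> c * norm (\<pi>p q (\<Phi> \<zeta> - \<Phi> \<zeta>'))" using c(2) by blast
    thus ?thesis using that by (simp add: linear_diff[OF proj_plus_linear] proj_\<Phi>)
  qed
  thus ?thesis using c(1) by blast
qed

text \<open>
  Given a direction \<open>\<eta>\<close>, the difference quotients of \<open>\<Phi>\<close> have the component \<open>\<eta>\<close> in \<open>E\<^sup>+(q)\<close> and
  bounded components in the finite-dimensional \<open>E\<^sup>-(q)\<close>. A limit point exists, and it inherits
  nonnegativity from the nonlinear differences.
\<close>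

lemma lin_pos_class_surj:
  assumes v: "v \<in> VV" and \<eta>: "\<eta> \<in> Ep q"
  shows "\<exists>\<xi>\<in>N q v. \<pi>p q \<xi> = \<eta>"
proof -
  obtain c where c: "c > 0" "\<forall>\<zeta>\<in>Ep q. \<forall>\<zeta>'\<in>Ep q. norm (\<Phi> \<zeta> - \<Phi> \<zeta>') \<le> c * norm (\<zeta> - \<zeta>')"
    using \<Phi>_lipschitz by blast
  obtain p where p: "\<And>x. norm (\<pi>m q x) \<le> norm x * p" "p > 0"
    using bounded_linear.pos_bounded[OF bounded_linear_proj] by blast
  define \<zeta> where "\<zeta> = \<pi>p q v"
  have \<zeta>: "\<zeta> \<in> Ep q" "\<Phi> \<zeta> = v" using v by (auto simp: \<zeta>_def proj_plus_in_Ep \<Phi>_proj)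
  define h where "h n = inverse (real (Suc n))" for n
  have h: "h n > 0" for n by (simp add: h_def)
  have in_Ep: "\<zeta> + h n *\<^sub>R \<eta> \<in> Ep q" for n
    using Ep_subspace \<zeta>(1) \<eta> by (intro subspace_add subspace_scale) auto
  define w where "w n = (\<Phi> (\<zeta> + h n *\<^sub>R \<eta>) - v) /\<^sub>R h n" for n
  define R where "R = c * norm \<eta>"
  have w_bound: "norm (w n) \<le> R" for n
  proof -
    have "norm (\<Phi> (\<zeta> + h n *\<^sub>R \<eta>) - \<Phi> \<zeta>) \<le> c * norm (\<zeta> + h n *\<^sub>R \<eta> - \<zeta>)"
      using c(2) in_Ep \<zeta>(1) by blast
    hence "norm (\<Phi> (\<zeta> + h n *\<^sub>R \<eta>) - v) \<le> h n * R" using h[of n] by (simp add: \<zeta>(2) R_def ac_simps)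
    thus ?thesis using h[of n] by (simp add: w_def divide_simps mult.commute)
  qed
  have w_plus: "\<pi>p q (w n) = \<eta>" for n
    using proj_\<Phi>[OF in_Ep[of n]] h[of n]
    by (simp add: w_def linear_cmul[OF proj_plus_linear] linear_diff[OF proj_plus_linear] \<zeta>_def[symmetric])
  have "\<pi>m q (w n) \<in> Em q \<inter> cball 0 (R * p)" for n
    using order_trans[OF p(1)[of "w n"] mult_right_mono[OF w_bound[of n], of p]] p(2) proj_in_Em by simp
  then obtain u r where u: "u \<in> Em q \<inter> cball 0 (R * p)" "strict_mono r"
      "((\<lambda>n. \<pi>m q (w n)) \<circ> r) \<longlonglongrightarrow> u"
    using Em_compact[of q "R * p", unfolded compact_def] by meson
  define \<xi> where "\<xi> = \<eta> + u"
  have w_lim: "(\<lambda>n. w (r n)) \<longlonglongrightarrow> \<xi>"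
  proof -
    have "w n = \<eta> + \<pi>m q (w n)" for n using proj_sum[of q "w n"] w_plus[of n] by simp
    hence "(\<lambda>n. w (r n)) = (\<lambda>n. \<eta> + ((\<lambda>n. \<pi>m q (w n)) \<circ> r) n)" by auto
    thus ?thesis unfolding \<xi>_def using tendsto_add[OF tendsto_const u(3), of \<eta>] by simp
  qed
  have h_lim: "(\<lambda>n. h (r n)) \<longlonglongrightarrow> 0"
    using LIMSEQ_subseq_LIMSEQ[OF LIMSEQ_inverse_real_of_nat u(2)] by (simp add: h_def o_def)
  have "\<xi> \<in> N q v"
  proof (rule lin_pos_classI_late)
    fix t assume t: "t \<ge> \<tau>"
    hence t0: "t \<ge> 0" using negative_constants(2) by simp
    have lim: "(\<lambda>n. V (\<theta> t q) (L t q v (w (r n)))) \<longlonglongrightarrow> V (\<theta> t q) (L t q v \<xi>)"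
      by (intro tendsto_Vform bounded_linear.tendsto[OF L_bounded_linear[OF t0]] w_lim)
    show "V (\<theta> t q) (L t q v \<xi>) \<ge> 0"
    proof (rule field_le_epsilon)
      fix \<mu> :: real assume \<mu>: "\<mu> > 0"
      have "eventually (\<lambda>n. V (\<theta> t q) (L t q v (w (r n))) > - \<mu>) sequentially"
      proof (rule quotient_asymptotically_nonneg[OF t \<mu> h_lim, where R = R])
        have "v + h k *\<^sub>R w k = \<Phi> (\<zeta> + h k *\<^sub>R \<eta>)" for k using h[of k] by (simp add: w_def)
        thus "\<forall>\<^sub>F n in sequentially. V (\<theta> t q) (\<psi> t q (v + h (r n) *\<^sub>R w (r n)) - \<psi> t q v) \<ge> 0"
          using equivalent[OF \<Phi>_in[OF in_Ep] v t0] by simp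
      qed (use h w_bound in \<open>auto simp: less_imp_neq[symmetric]\<close>)
      hence "eventually (\<lambda>n. - \<mu> \<le> V (\<theta> t q) (L t q v (w (r n)))) sequentially"
        by (rule eventually_mono) simp
      from tendsto_lowerbound[OF lim this] show "0 \<le> V (\<theta> t q) (L t q v \<xi>) + \<mu>" by simp
    qed
  qed
  moreover have "\<pi>p q \<xi> = \<eta>"
    using u(1) \<eta> by (simp add: \<xi>_def linear_add[OF proj_plus_linear] proj_plus_ident proj_plus_zero_iff)
  ultimately show ?thesis by blast
qed

abbreviation \<Phi>' where "\<Phi>' \<equiv> lin_Phi \<theta> L Q Em q"

text \<open>
  \<open>\<Phi>' v\<close> is specified on \<open>E\<^sup>+(q)\<close> only; the projector extends it to a bounded operator on the
  whole space.
\<close>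

definition D\<Phi> :: "'e \<Rightarrow> 'e \<Rightarrow> 'e" where "D\<Phi> v \<xi> = \<Phi>' v (\<pi>p q \<xi>)"

lemma lin_bij: "v \<in> VV \<Longrightarrow> bij_betw (\<pi>p q) (N q v) (Ep q)"
proof (rule bij_betw_imageI[OF lin_pos_class_inj])
  assume v: "v \<in> VV"
  show "\<pi>p q ` N q v = Ep q"
  proof (intro equalityI subsetI)
    fix \<eta> assume "\<eta> \<in> Ep q"
    from lin_pos_class_surj[OF v this] show "\<eta> \<in> \<pi>p q ` N q v" by force
  qed (use proj_plus_in_Ep in auto)
qed

context
  fixes v assumes v: "v \<in> VV"
begin

lemma D\<Phi>_in: "D\<Phi> v \<xi> \<in> N q v" and proj_D\<Phi>: "\<pi>p q (D\<Phi> v \<xi>) = \<pi>p q \<xi>"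
proof -
  have img: "\<pi>p q ` N q v = Ep q" using lin_bij[OF v] by (simp add: bij_betw_def)
  show "D\<Phi> v \<xi> \<in> N q v" unfolding D\<Phi>_def lin_Phi_def
    by (rule the_inv_into_into[OF lin_pos_class_inj]) (auto simp: img proj_plus_in_Ep)
  show "\<pi>p q (D\<Phi> v \<xi>) = \<pi>p q \<xi>" unfolding D\<Phi>_def lin_Phi_def
    by (rule f_the_inv_into_f[OF lin_pos_class_inj]) (auto simp: img proj_plus_in_Ep)
qed

lemma D\<Phi>_unique: "\<xi> \<in> N q v \<Longrightarrow> \<pi>p q \<xi> = \<pi>p q x \<Longrightarrow> D\<Phi> v x = \<xi>"
  by (rule inj_onD[OF lin_pos_class_inj]) (auto simp: D\<Phi>_in proj_D\<Phi>)

lemma D\<Phi>_linear_over: "linear_over K scl scl (D\<Phi> v)"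
  unfolding linear_over_def
proof (intro conjI allI ballI)
  show "D\<Phi> v (x + y) = D\<Phi> v x + D\<Phi> v y" for x y
    by (rule D\<Phi>_unique) (simp_all add: subspace_add[OF lin_pos_class_subspace] D\<Phi>_in
        linear_add[OF proj_plus_linear] proj_D\<Phi>)
  show "D\<Phi> v (scl a x) = scl a (D\<Phi> v x)" if "a \<in> K" for a x
    using proj_plus_linear_over[of q] that unfolding linear_over_def
    by (intro D\<Phi>_unique) (simp_all add: lin_pos_class_scl D\<Phi>_in proj_D\<Phi>)
qed

end

lemma D\<Phi>_bounded: "\<exists>c>0. \<forall>v\<in>VV. \<forall>\<xi>. norm (D\<Phi> v \<xi>) \<le> c * norm \<xi>"
proof -
  obtain c where c: "c > 0" "\<forall>v. V q v \<ge> 0 \<longrightarrow> norm v \<le> c * norm (\<pi>p q v)"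
    using positive_cone_bound by blast
  obtain p where p: "\<And>x. norm (\<pi>p q x) \<le> norm x * p" "p > 0"
    using bounded_linear.pos_bounded[OF bounded_linear_proj_plus] by blast
  have "norm (D\<Phi> v \<xi>) \<le> c * p * norm \<xi>" if v: "v \<in> VV" for v \<xi>
  proof -
    have "norm (D\<Phi> v \<xi>) \<le> c * norm (\<pi>p q (D\<Phi> v \<xi>))"
      using c(2) lin_pos_class_nonneg[OF D\<Phi>_in[OF v]] by blast
    also have "\<dots> \<le> c * (norm \<xi> * p)"
      unfolding proj_D\<Phi>[OF v] using c(1) p(1) by (intro mult_left_mono) auto
    finally show ?thesis by (simp add: ac_simps)
  qed
  thus ?thesis using c(1) p(2) by (intro exI[of _ "c * p"]) auto
qed

lemma D\<Phi>_bounded_linear: "v \<in> VV \<Longrightarrow> bounded_linear (D\<Phi> v)"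
proof -
  assume v: "v \<in> VV"
  obtain c where "\<forall>v\<in>VV. \<forall>\<xi>. norm (D\<Phi> v \<xi>) \<le> c * norm \<xi>" using D\<Phi>_bounded by blast
  with v show ?thesis
    using linear_over_real[OF D\<Phi>_linear_over[OF v]]
    by (intro bounded_linear_intro[of _ c]) (auto simp: linear_add linear_cmul mult.commute)
qed

lemma lin_homeomorphism:
  assumes v: "v \<in> VV" shows "homeomorphism (N q v) (Ep q) (\<pi>p q) (\<Phi>' v)"
proof -
  have eq: "\<Phi>' v x = D\<Phi> v x" if "x \<in> Ep q" for x using that by (simp add: D\<Phi>_def proj_plus_ident)
  have inv: "D\<Phi> v (\<pi>p q \<xi>) = \<xi>" if "\<xi> \<in> N q v" for \<xi>
    by (rule D\<Phi>_unique[OF v that]) (simp add: proj_plus_ident proj_plus_in_Ep)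
  show ?thesis
  proof (rule homeomorphismI)
    show "continuous_on (N q v) (\<pi>p q)" by (rule linear_continuous_on[OF bounded_linear_proj_plus])
    have "continuous_on (Ep q) (D\<Phi> v)" by (rule linear_continuous_on[OF D\<Phi>_bounded_linear[OF v]])
    thus "continuous_on (Ep q) (\<Phi>' v)" by (rule continuous_on_eq) (simp add: eq)
  qed (auto simp: eq proj_plus_in_Ep D\<Phi>_in[OF v] proj_D\<Phi>[OF v] inv proj_plus_ident)
qed

text \<open>
  The normalized remainder is \<open>w - \<xi>\<close>, where \<open>w\<close> is a difference quotient of \<open>\<Phi>\<close> and \<open>\<xi>\<close> the
  vector of the linear class over the same direction. It lies in \<open>E\<^sup>-(q)\<close>, and the form of \<open>w\<close> at
  time \<open>T\<close> is asymptotically nonnegative; so the remainder cannot stay away from \<open>0\<close>.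
\<close>

lemma \<Phi>_has_derivative:
  assumes \<zeta>: "\<zeta> \<in> Ep q"
  shows "(\<Phi> has_derivative D\<Phi> (\<Phi> \<zeta>)) (at \<zeta> within Ep q)"
  unfolding has_derivative_at_within
proof (intro conjI)
  define v where "v = \<Phi> \<zeta>"
  have v: "v \<in> VV" using \<Phi>_in[OF \<zeta>] by (simp add: v_def)
  show "bounded_linear (D\<Phi> (\<Phi> \<zeta>))" using D\<Phi>_bounded_linear[OF v] by (simp add: v_def)
  interpret D: bounded_linear "D\<Phi> v" by (rule D\<Phi>_bounded_linear[OF v])
  obtain c1 where c1: "c1 > 0" "\<forall>\<zeta>\<in>Ep q. \<forall>\<zeta>'\<in>Ep q. norm (\<Phi> \<zeta> - \<Phi> \<zeta>') \<le> c1 * norm (\<zeta> - \<zeta>')"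
    using \<Phi>_lipschitz by blast
  obtain c2 where c2: "c2 > 0" "\<forall>v\<in>VV. \<forall>\<xi>. norm (D\<Phi> v \<xi>) \<le> c2 * norm \<xi>" using D\<Phi>_bounded by blast
  define R where "R = max c1 c2"
  let ?F = "at \<zeta> within Ep q"
  define h where "h z = norm (z - \<zeta>)" for z
  define w where "w z = (\<Phi> z - v) /\<^sub>R h z" for z
  define \<xi> where "\<xi> z = D\<Phi> v ((z - \<zeta>) /\<^sub>R h z)" for z
  have near: "eventually (\<lambda>z. z \<in> Ep q \<and> z \<noteq> \<zeta>) ?F" by (simp add: eventually_at_filter)
  have h_lim: "(h \<longlongrightarrow> 0) ?F"
    unfolding h_def by (rule tendsto_eq_intros refl | simp)+
  have h_pos: "h z > 0" if "z \<noteq> \<zeta>" for z using that by (simp add: h_def)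
  have w_bound: "norm (w z) \<le> R" if "z \<in> Ep q" "z \<noteq> \<zeta>" for z
  proof -
    have "norm (\<Phi> z - v) \<le> c1 * h z" unfolding v_def h_def using c1 that \<zeta> by blast
    also have "\<dots> \<le> R * h z" using h_pos[OF that(2)] by (intro mult_right_mono) (auto simp: R_def)
    finally show ?thesis using h_pos[OF that(2)] by (simp add: w_def divide_simps mult.commute)
  qed
  have \<xi>_bound: "norm (\<xi> z) \<le> R" if "z \<noteq> \<zeta>" for z
  proof -
    have "norm (\<xi> z) \<le> c2 * norm ((z - \<zeta>) /\<^sub>R h z)" unfolding \<xi>_def using c2 v by blast
    also have "\<dots> = c2" using h_pos[OF that] by (simp add: h_def)
    finally show ?thesis by (simp add: R_def)
  qed
  have diff_Em: "w z - \<xi> z \<in> Em q" if "z \<in> Ep q" for z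
  proof -
    have "z - \<zeta> \<in> Ep q" using that \<zeta> Ep_subspace by (simp add: subspace_diff)
    hence "\<pi>p q (\<xi> z) = (z - \<zeta>) /\<^sub>R h z"
      by (simp add: \<xi>_def proj_D\<Phi>[OF v] linear_cmul[OF proj_plus_linear] proj_plus_ident)
    moreover have "\<pi>p q (w z) = (z - \<zeta>) /\<^sub>R h z"
      using that \<zeta> by (simp add: w_def v_def linear_cmul[OF proj_plus_linear]
          linear_diff[OF proj_plus_linear] proj_\<Phi>)
    ultimately show ?thesis
      by (simp add: linear_diff[OF proj_plus_linear] flip: proj_plus_zero_iff)
  qed
  have "((\<lambda>z. w z - \<xi> z) \<longlongrightarrow> 0) ?F"
  proof (rule tendstoI)
    fix \<epsilon> :: real assume "\<epsilon> > 0"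
    from class_gap[OF this, of q v R] obtain T \<mu> where T: "T \<ge> \<tau>" "\<mu> > 0"
      and gap: "\<And>\<xi> w. \<xi> \<in> N q v \<and> norm \<xi> \<le> R \<and> norm w \<le> R \<and> w - \<xi> \<in> Em q \<and>
        \<epsilon> \<le> norm (w - \<xi>) \<longrightarrow> V (\<theta> T q) (L T q v w) \<le> - \<mu>" by meson
    have "T \<ge> 0" using T(1) negative_constants(2) by simp
    have "eventually (\<lambda>z. V (\<theta> T q) (L T q v (w z)) > - \<mu>) ?F"
    proof (rule quotient_asymptotically_nonneg[OF T h_lim])
      show "eventually (\<lambda>z. h z \<noteq> 0) ?F" using near by (rule eventually_mono) (auto simp: h_def)
      show "eventually (\<lambda>z. norm (w z) \<le> R) ?F" using near by (rule eventually_mono) (auto intro: w_bound)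
      show "eventually (\<lambda>z. V (\<theta> T q) (\<psi> T q (v + h z *\<^sub>R w z) - \<psi> T q v) \<ge> 0) ?F"
        using near
      proof (rule eventually_mono)
        fix z assume z: "z \<in> Ep q \<and> z \<noteq> \<zeta>"
        hence "v + h z *\<^sub>R w z = \<Phi> z" using h_pos[of z] by (simp add: w_def)
        thus "V (\<theta> T q) (\<psi> T q (v + h z *\<^sub>R w z) - \<psi> T q v) \<ge> 0"
          using equivalent[OF \<Phi>_in v \<open>T \<ge> 0\<close>, of z] z by simp
      qed
    qed
    thus "eventually (\<lambda>z. dist (w z - \<xi> z) 0 < \<epsilon>) ?F"
      using near
    proof eventually_elim
      case (elim z)
      have "\<xi> z \<in> N q v" unfolding \<xi>_def by (rule D\<Phi>_in[OF v])
      with gap[of "\<xi> z" "w z"] elim w_bound[of z] \<xi>_bound[of z] diff_Em[of z] show ?case by force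
    qed
  qed
  moreover have "w z - \<xi> z = (\<Phi> z - \<Phi> \<zeta> - D\<Phi> (\<Phi> \<zeta>) (z - \<zeta>)) /\<^sub>R norm (z - \<zeta>)" for z
  proof -
    have "\<xi> z = D\<Phi> v (z - \<zeta>) /\<^sub>R h z" unfolding \<xi>_def by (rule D.scaleR)
    thus ?thesis by (simp only: w_def v_def h_def scaleR_diff_right)
  qed
  ultimately show "((\<lambda>z. (\<Phi> z - \<Phi> \<zeta> - D\<Phi> (\<Phi> \<zeta>) (z - \<zeta>)) /\<^sub>R norm (z - \<zeta>)) \<longlongrightarrow> 0) ?F"
    by simp
qed

lemma L_H_close:
  assumes "T \<ge> 0" "\<kappa> > 0" "R \<ge> 0"
  shows "eventually (\<lambda>v'. \<forall>x. norm x \<le> R \<longrightarrow> norm (\<iota> (L T q v' x) - \<iota> (L T q v x)) \<le> \<kappa>) (at v within X)"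
proof -
  have bl: "bounded_linear (\<lambda>\<xi>. \<iota> (L T q u \<xi>))" for u
    by (rule bounded_linear_compose[OF embedding L_bounded_linear[OF assms(1)]])
  define f where "f u = Blinfun (\<lambda>\<xi>. \<iota> (L T q u \<xi>))" for u
  have f: "blinfun_apply (f u) x = \<iota> (L T q u x)" for u x
    by (simp add: f_def bounded_linear_Blinfun_apply[OF bl])
  have "continuous_on UNIV f" unfolding f_def by (rule L_continuous_H[OF assms(1)])
  hence "(f \<longlongrightarrow> f v) (at v within X)"
    by (meson UNIV_I continuous_on_def subset_UNIV tendsto_within_subset)
  moreover have "\<kappa> / (R + 1) > 0" using assms by simp
  ultimately have "eventually (\<lambda>v'. dist (f v') (f v) < \<kappa> / (R + 1)) (at v within X)"
    by (rule tendstoD)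
  thus ?thesis
  proof (rule eventually_mono)
    fix v' assume d: "dist (f v') (f v) < \<kappa> / (R + 1)"
    show "\<forall>x. norm x \<le> R \<longrightarrow> norm (\<iota> (L T q v' x) - \<iota> (L T q v x)) \<le> \<kappa>"
    proof (intro allI impI)
      fix x :: 'e assume x: "norm x \<le> R"
      have "norm (\<iota> (L T q v' x) - \<iota> (L T q v x)) = norm (blinfun_apply (f v' - f v) x)"
        by (simp add: blinfun.diff_left f)
      also have "\<dots> \<le> norm (f v' - f v) * norm x" by (rule norm_blinfun)
      also have "\<dots> \<le> \<kappa> / (R + 1) * (R + 1)"
        using d x assms by (intro mult_mono) (auto simp: dist_norm)
      also have "\<dots> = \<kappa>" using assms by simp
      finally show "norm (\<iota> (L T q v' x) - \<iota> (L T q v x)) \<le> \<kappa>" .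
    qed
  qed
qed

lemma D\<Phi>_continuous: "continuous_on VV (\<lambda>v. Blinfun (D\<Phi> v))"
  unfolding continuous_on_def
proof (intro ballI tendstoI)
  fix v and e :: real assume v: "v \<in> VV" and e: "e > 0"
  obtain R where R: "R > 0" "\<forall>v\<in>VV. \<forall>\<xi>. norm (D\<Phi> v \<xi>) \<le> R * norm \<xi>" using D\<Phi>_bounded by blast
  have R1: "norm (D\<Phi> u x) \<le> R" if "u \<in> VV" "norm x \<le> 1" for u x
    using order_trans[OF R(2)[rule_format, OF that(1), of x] mult_left_mono[OF that(2), of R]] R(1) by simp
  have e2: "e / 2 > 0" using e by simp
  from class_stability[OF e2, of R q v] obtain T \<kappa> where T: "T \<ge> 0" "\<kappa> > 0"
    and stable: "\<And>v' \<xi> \<xi>'. (\<forall>x. norm x \<le> 2 * R \<longrightarrow> norm (\<iota> (L T q v' x) - \<iota> (L T q v x)) \<le> \<kappa>) \<and>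
      \<xi> \<in> N q v \<and> \<xi>' \<in> N q v' \<and> norm \<xi> \<le> R \<and> norm \<xi>' \<le> R \<and> \<xi>' - \<xi> \<in> Em q \<longrightarrow>
      norm (\<xi>' - \<xi>) < e / 2" by meson
  have "2 * R \<ge> 0" using R(1) by simp
  from L_H_close[OF T this, of v VV]
  have "eventually (\<lambda>v'. (\<forall>x. norm x \<le> 2 * R \<longrightarrow> norm (\<iota> (L T q v' x) - \<iota> (L T q v x)) \<le> \<kappa>)
      \<and> v' \<in> VV) (at v within VV)"
    by (intro eventually_conj) (auto simp: eventually_at_filter)
  thus "eventually (\<lambda>v'. dist (Blinfun (D\<Phi> v')) (Blinfun (D\<Phi> v)) < e) (at v within VV)"
  proof (rule eventually_mono)
    fix v' assume v': "(\<forall>x. norm x \<le> 2 * R \<longrightarrow> norm (\<iota> (L T q v' x) - \<iota> (L T q v x)) \<le> \<kappa>) \<and> v' \<in> VV"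
    have "norm (Blinfun (D\<Phi> v') - Blinfun (D\<Phi> v)) \<le> e / 2"
    proof (rule norm_blinfun_le_unit_ball)
      fix x :: 'e assume x: "norm x \<le> 1"
      have "D\<Phi> v' x - D\<Phi> v x \<in> Em q"
        using proj_D\<Phi>[OF v, of x] proj_D\<Phi>[of v' x] v'
        by (simp add: linear_diff[OF proj_plus_linear] flip: proj_plus_zero_iff)
      hence "norm (D\<Phi> v' x - D\<Phi> v x) < e / 2"
        using stable[of v' "D\<Phi> v x" "D\<Phi> v' x"] v v' R1[OF _ x] D\<Phi>_in by simp
      thus "norm (blinfun_apply (Blinfun (D\<Phi> v') - Blinfun (D\<Phi> v)) x) \<le> e / 2"
        using v v' by (simp add: blinfun.diff_left bounded_linear_Blinfun_apply[OF D\<Phi>_bounded_linear])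
    qed (use e in auto)
    thus "dist (Blinfun (D\<Phi> v')) (Blinfun (D\<Phi> v)) < e" using e by (simp add: dist_norm)
  qed
qed

lemma \<Phi>_C1: "C1_on K scl scl (Ep q) \<Phi> (\<lambda>\<zeta>. D\<Phi> (\<Phi> \<zeta>))"
  unfolding C1_on_def
proof (intro conjI ballI \<Phi>_has_derivative D\<Phi>_linear_over \<Phi>_in)
  show "continuous_on (Ep q) (\<lambda>\<zeta>. Blinfun (D\<Phi> (\<Phi> \<zeta>)))"
    by (rule continuous_on_compose2[OF D\<Phi>_continuous continuous_\<Phi>]) (auto intro: \<Phi>_in)
qed

section \<open>Manifold structure and tangent spaces\<close>

lemma \<Phi>_proj_has_derivative:
  assumes "(f has_derivative f') (at x within X)"
  shows "((\<lambda>y. \<Phi> (\<pi>p q (f y))) has_derivative (\<lambda>\<xi>. D\<Phi> (\<Phi> (\<pi>p q (f x))) (f' \<xi>))) (at x within X)"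
proof -
  have P: "((\<lambda>y. \<pi>p q (f y)) has_derivative (\<lambda>\<xi>. \<pi>p q (f' \<xi>))) (at x within X)"
    by (rule bounded_linear.has_derivative[OF bounded_linear_proj_plus assms])
  have "(\<Phi> has_derivative D\<Phi> (\<Phi> (\<pi>p q (f x)))) (at (\<pi>p q (f x)) within (\<lambda>y. \<pi>p q (f y)) ` X)"
    by (rule has_derivative_subset[OF \<Phi>_has_derivative]) (auto simp: proj_plus_in_Ep)
  from has_derivative_in_compose[OF P this] show ?thesis
    by (simp add: D\<Phi>_def proj_plus_ident proj_plus_in_Ep)
qed

text \<open>
  For \<open>s = -1\<close> this shear flattens \<open>VV\<close> onto \<open>E\<^sup>+(q)\<close>, and for \<open>s = 1\<close> it is the inverse, because
  shears along \<open>E\<^sup>-(q)\<close> do not change the projection to \<open>E\<^sup>+(q)\<close>.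
\<close>

lemma graph_shear_C1:
  "C1_on K scl scl UNIV (\<lambda>v. v + s *\<^sub>R \<pi>m q (\<Phi> (\<pi>p q v)))
    (\<lambda>v \<xi>. \<xi> + s *\<^sub>R \<pi>m q (D\<Phi> (\<Phi> (\<pi>p q v)) \<xi>))"
  unfolding C1_on_def
proof (intro conjI ballI)
  fix v
  have v: "\<Phi> (\<pi>p q v) \<in> VV" by (intro \<Phi>_in proj_plus_in_Ep)
  have "((\<lambda>v. \<pi>m q (\<Phi> (\<pi>p q v))) has_derivative (\<lambda>\<xi>. \<pi>m q (D\<Phi> (\<Phi> (\<pi>p q v)) \<xi>))) (at v)"
    using bounded_linear.has_derivative[OF bounded_linear_proj \<Phi>_proj_has_derivative[OF has_derivative_ident]]
    by simp
  thus "((\<lambda>v. v + s *\<^sub>R \<pi>m q (\<Phi> (\<pi>p q v))) has_derivative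
      (\<lambda>\<xi>. \<xi> + s *\<^sub>R \<pi>m q (D\<Phi> (\<Phi> (\<pi>p q v)) \<xi>))) (at v)"
    by (intro has_derivative_add has_derivative_ident has_derivative_scaleR_right)
  have scl_s: "scl a (s *\<^sub>R x) = s *\<^sub>R scl a x" if "a \<in> K" for a x
    using scl_mult[OF that of_real_in_K, of s x] scl_mult[OF of_real_in_K that, of s x]
    by (simp add: scl_of_real mult.commute)
  show "linear_over K scl scl (\<lambda>\<xi>. \<xi> + s *\<^sub>R \<pi>m q (D\<Phi> (\<Phi> (\<pi>p q v)) \<xi>))"
    using D\<Phi>_linear_over[OF v] proj_linear_over[of q] unfolding linear_over_def
    by (simp add: scaleR_add_right scl_add_right scl_s)
next
  have "Blinfun (\<lambda>\<xi>. \<xi> + s *\<^sub>R \<pi>m q (D\<Phi> (\<Phi> (\<pi>p q v)) \<xi>))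
      = id_blinfun + s *\<^sub>R (Blinfun (\<pi>m q) o\<^sub>L Blinfun (D\<Phi> (\<Phi> (\<pi>p q v))))" for v
  proof -
    have v: "\<Phi> (\<pi>p q v) \<in> VV" by (intro \<Phi>_in proj_plus_in_Ep)
    have eq: "(\<lambda>\<xi>. \<xi> + s *\<^sub>R \<pi>m q (D\<Phi> (\<Phi> (\<pi>p q v)) \<xi>))
        = blinfun_apply (id_blinfun + s *\<^sub>R (Blinfun (\<pi>m q) o\<^sub>L Blinfun (D\<Phi> (\<Phi> (\<pi>p q v)))))"
      by (rule ext) (simp add: blinfun.add_left blinfun.scaleR_left
          bounded_linear_Blinfun_apply[OF D\<Phi>_bounded_linear[OF v]]
          bounded_linear_Blinfun_apply[OF bounded_linear_proj])
    show ?thesis unfolding eq by (rule blinfun_apply_inverse)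
  qed
  moreover have "continuous_on UNIV (\<lambda>v. Blinfun (D\<Phi> (\<Phi> (\<pi>p q v))))"
  proof (rule continuous_on_compose2[OF D\<Phi>_continuous])
    show "continuous_on UNIV (\<lambda>v. \<Phi> (\<pi>p q v))"
      by (rule continuous_on_compose2[OF continuous_\<Phi> linear_continuous_on[OF bounded_linear_proj_plus]])
        (auto intro: proj_plus_in_Ep)
  qed (auto intro: \<Phi>_in proj_plus_in_Ep)
  ultimately show "continuous_on UNIV (\<lambda>v. Blinfun (\<lambda>\<xi>. \<xi> + s *\<^sub>R \<pi>m q (D\<Phi> (\<Phi> (\<pi>p q v)) \<xi>)))"
    by (simp add: continuous_intros)
qed

lemma VV_C1_submanifold: "C1_submanifold K scl VV"
  unfolding C1_submanifold_def
proof (intro ballI exI conjI)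
  let ?h = "\<lambda>s v. v + s *\<^sub>R \<pi>m q (\<Phi> (\<pi>p q v))" and ?h' = "\<lambda>s v \<xi>. \<xi> + s *\<^sub>R \<pi>m q (D\<Phi> (\<Phi> (\<pi>p q v)) \<xi>)"
  fix p assume "p \<in> VV"
  show "open (UNIV :: 'e set)" "open (UNIV :: 'e set)" "p \<in> UNIV" by auto
  show "direct_sum_over K scl (Ep q) (Em q)" by (rule direct_sum)
  show C1: "C1_on K scl scl UNIV (?h (-1)) (?h' (-1))" "C1_on K scl scl UNIV (?h 1) (?h' 1)"
    by (rule graph_shear_C1)+
  have pp: "\<pi>p q (?h s v) = \<pi>p q v" for s v
    by (simp add: linear_add[OF proj_plus_linear] linear_cmul[OF proj_plus_linear]
        proj_plus_zero_iff[THEN iffD2, OF proj_in_Em])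
  have inv: "?h s (?h (- s) v) = v" for s v by (subst pp) simp
  have cont: "continuous_on UNIV (?h s)" for s
  proof (rule continuous_at_imp_continuous_on, rule ballI)
    fix v
    have "(?h s has_derivative ?h' s v) (at v)"
      using graph_shear_C1[of s] unfolding C1_on_def by simp
    thus "isCont (?h s) v" by (rule has_derivative_continuous)
  qed
  show "homeomorphism UNIV UNIV (?h (-1)) (?h 1)"
  proof (rule homeomorphismI[OF cont cont])
    show "?h 1 (?h (-1) v) = v" "?h (-1) (?h 1 v) = v" for v
      using inv[where s = 1] inv[where s = "-1"] by (simp_all only: minus_minus)
  qed (rule subset_UNIV)+
  show "?h (-1) ` (UNIV \<inter> VV) = UNIV \<inter> Ep q"
  proof (intro equalityI subsetI)
    fix x assume "x \<in> ?h (-1) ` (UNIV \<inter> VV)"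
    then obtain v where "v \<in> VV" "x = ?h (-1) v" by auto
    hence "x = v - \<pi>m q v" by (simp add: \<Phi>_proj)
    hence "x = \<pi>p q v" by (simp add: proj_plus_def)
    thus "x \<in> UNIV \<inter> Ep q" by (simp add: proj_plus_in_Ep)
  next
    fix x assume "x \<in> UNIV \<inter> Ep q"
    hence x: "x \<in> Ep q" by simp
    have "?h (-1) (\<Phi> x) = \<Phi> x - \<pi>m q (\<Phi> x)" by (simp add: proj_\<Phi>[OF x])
    also have "\<dots> = x" using proj_\<Phi>[OF x] by (simp add: proj_plus_def)
    finally have "x = ?h (-1) (\<Phi> x)" by (rule sym)
    moreover have "\<Phi> x \<in> UNIV \<inter> VV" using \<Phi>_in[OF x] by simp
    ultimately show "x \<in> ?h (-1) ` (UNIV \<inter> VV)" by (rule image_eqI)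
  qed
qed

text \<open>
  A curve \<open>g\<close> in \<open>VV\<close> satisfies \<open>g = \<Phi>(\<Pi>\<^sup>+ g)\<close>, so its velocity is a value of the differential of
  \<open>\<Phi>\<close>. Conversely \<open>s \<mapsto> \<Phi>(\<Pi>\<^sup>+(v + s \<xi>))\<close> has the velocity \<open>\<xi>\<close> if \<open>\<xi>\<close> is in the linear class.
\<close>

lemma tangent_space_eq:
  assumes v: "v \<in> VV" shows "tangent_space VV v = N q v"
proof (intro equalityI subsetI)
  fix \<xi> assume "\<xi> \<in> tangent_space VV v"
  then obtain \<epsilon> and g :: "real \<Rightarrow> 'e" where g: "\<epsilon> > 0" "g ` {-\<epsilon><..<\<epsilon>} \<subseteq> VV" "g 0 = v"
      "(g has_vector_derivative \<xi>) (at 0)"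
    unfolding tangent_space_def by blast
  have "((\<lambda>s. \<Phi> (\<pi>p q (g s))) has_derivative (\<lambda>s. D\<Phi> (\<Phi> (\<pi>p q (g 0))) (s *\<^sub>R \<xi>))) (at 0)"
    by (rule \<Phi>_proj_has_derivative) (use g(4) in \<open>simp add: has_vector_derivative_def\<close>)
  hence "((\<lambda>s. \<Phi> (\<pi>p q (g s))) has_derivative (\<lambda>s. s *\<^sub>R D\<Phi> v \<xi>)) (at 0)"
    using linear_cmul[OF linear_over_real[OF D\<Phi>_linear_over[OF v]]] by (simp add: g(3) \<Phi>_proj[OF v])
  moreover have "eventually (\<lambda>s. \<Phi> (\<pi>p q (g s)) = g s) (at 0)"
  proof (rule eventually_at_in_open'[THEN eventually_mono])
    show "open {-\<epsilon><..<\<epsilon>}" "0 \<in> {-\<epsilon><..<\<epsilon>}" using g(1) by auto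
    show "\<Phi> (\<pi>p q (g s)) = g s" if "s \<in> {-\<epsilon><..<\<epsilon>}" for s
      using g(2) that by (intro \<Phi>_proj) blast
  qed
  moreover have "\<Phi> (\<pi>p q (g 0)) = g 0" by (simp add: g(3) \<Phi>_proj[OF v])
  ultimately have "(g has_vector_derivative D\<Phi> v \<xi>) (at 0)"
    unfolding has_vector_derivative_def by (rule has_derivative_transform_eventually) simp
  hence "D\<Phi> v \<xi> = \<xi>" using g(4) by (rule vector_derivative_unique_at)
  thus "\<xi> \<in> N q v" using D\<Phi>_in[OF v, of \<xi>] by simp
next
  fix \<xi> assume \<xi>: "\<xi> \<in> N q v"
  define g where "g s = \<Phi> (\<pi>p q (v + s *\<^sub>R \<xi>))" for s :: real
  have gV: "g s \<in> VV" for s unfolding g_def by (intro \<Phi>_in proj_plus_in_Ep)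
  have g0: "g 0 = v" by (simp add: g_def \<Phi>_proj[OF v])
  have deriv: "(g has_vector_derivative D\<Phi> (g s) \<xi>) (at s)" for s
  proof -
    have "((\<lambda>s. \<Phi> (\<pi>p q (v + s *\<^sub>R \<xi>))) has_derivative (\<lambda>r. D\<Phi> (\<Phi> (\<pi>p q (v + s *\<^sub>R \<xi>))) (r *\<^sub>R \<xi>))) (at s)"
      by (rule \<Phi>_proj_has_derivative) (auto intro!: derivative_eq_intros)
    thus ?thesis unfolding has_vector_derivative_def
      using linear_cmul[OF linear_over_real[OF D\<Phi>_linear_over[OF gV[of s]]]]
      by (simp add: g_def[abs_def])
  qed
  have contg: "continuous_on X g" for X
    unfolding g_def
    by (rule continuous_on_compose2[OF continuous_\<Phi> continuous_on_compose2[OF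
        linear_continuous_on[OF bounded_linear_proj_plus, of UNIV]]])
      (auto intro!: continuous_intros proj_plus_in_Ep)
  have "continuous_on X (\<lambda>s. D\<Phi> (g s) \<xi>)" for X
  proof -
    have "continuous_on X (\<lambda>s. blinfun_apply (Blinfun (D\<Phi> (g s))) \<xi>)"
      by (intro continuous_intros continuous_on_compose2[OF D\<Phi>_continuous contg]) (auto simp: gV)
    thus ?thesis by (simp add: bounded_linear_Blinfun_apply[OF D\<Phi>_bounded_linear[OF gV]])
  qed
  hence "g C1_differentiable_on {-1<..<1}"
    unfolding C1_differentiable_on_def using deriv by (intro exI[of _ "\<lambda>s. D\<Phi> (g s) \<xi>"]) auto
  moreover have "D\<Phi> (g 0) \<xi> = \<xi>" unfolding g0 by (rule D\<Phi>_unique[OF v \<xi> refl])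
  ultimately show "\<xi> \<in> tangent_space VV v"
    unfolding tangent_space_def using deriv[of 0] gV g0
    by (intro CollectI exI[of _ 1] exI[of _ g]) auto
qed

end

theorem theorem3p3p2:
  fixes K :: "complex set"
    and scl :: "complex \<Rightarrow> 'e::banach \<Rightarrow> 'e"
    and sclH :: "complex \<Rightarrow> 'h::{real_inner,complete_space} \<Rightarrow> 'h"
    and \<iota> :: "'e \<Rightarrow> 'h"
    and \<theta> :: "real \<Rightarrow> 'q::complete_space \<Rightarrow> 'q"
    and \<psi> :: "real \<Rightarrow> 'q \<Rightarrow> 'e \<Rightarrow> 'e"
    and Q :: "'q \<Rightarrow> 'e \<Rightarrow>\<^sub>L ('e \<Rightarrow>\<^sub>L complex)"
    and Em :: "'q \<Rightarrow> 'e set"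
    and j :: nat
    and \<delta> \<tau> am ap bm bp :: real
    and \<alpha>0 \<beta>0 :: "'q \<Rightarrow> real"
    and L :: "real \<Rightarrow> 'q \<Rightarrow> 'e \<Rightarrow> 'e \<Rightarrow> 'e"
    and q :: 'q and v0 :: 'e
  assumes E: "normed_space_over K scl"
    and H: "hilbert_space_over K sclH"
    and embedding: "continuous_embedding K scl sclH \<iota>"
    and flow: "semiflow \<theta>"
    and cocycle: "semicocycle \<theta> \<psi>"
    and forms: "quadratic_forms K scl j Q Em"
    and negative: "negative_squeezing \<iota> \<theta> \<psi> Q \<delta> \<tau> am ap \<alpha>0"
    and positive: "strengthened_positive_squeezing K scl \<iota> \<theta> \<psi> Q \<delta> \<tau> am ap \<alpha>0 bm bp \<beta>0 L"
    and lipschitz: "uniform_lipschitz \<iota> \<psi>"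
    and projectors: "bounded_projectors Q Em"
    and diff: "differentiability K scl \<iota> \<theta> \<psi> \<tau> ap L"
    and equivalence: "equiv UNIV {(v, w). w \<in> pos_class \<theta> \<psi> Q q v}"
    and homeo: "homeomorphism (pos_class \<theta> \<psi> Q q v0) (E_plus Q Em q)
      (proj_plus Q Em q) (Phi \<theta> \<psi> Q Em q v0)"
  shows "let VV = pos_class \<theta> \<psi> Q q v0;
             VV' = lin_pos_class \<theta> L Q q;
             \<Phi> = Phi \<theta> \<psi> Q Em q v0;
             \<Phi>' = lin_Phi \<theta> L Q Em q
         in C1_submanifold K scl VV \<and>
            (\<forall>v\<in>VV. subspace_over K scl (VV' v) \<and>
               homeomorphism (VV' v) (E_plus Q Em q) (proj_plus Q Em q) (\<Phi>' v)) \<and>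
            C1_on K scl scl (E_plus Q Em q) \<Phi> (\<lambda>\<zeta> \<xi>. \<Phi>' (\<Phi> \<zeta>) (proj_plus Q Em q \<xi>)) \<and>
            (\<forall>v\<in>VV. tangent_space VV v = VV' v) \<and>
            (\<forall>t\<ge>\<tau>. C1_between K scl \<iota> VV VV'
               (pos_class \<theta> \<psi> Q (\<theta> t q) (\<psi> t q v0)) (lin_pos_class \<theta> L Q (\<theta> t q))
               (\<psi> t q) (L t q))"
proof -
  have bl: "bounded_linear \<iota>" using embedding by (simp add: continuous_embedding_def)
  have equivalent: "Vform Q (\<theta> t q) (\<psi> t q v - \<psi> t q w) \<ge> 0"
    if vw: "v \<in> pos_class \<theta> \<psi> Q q v0" "w \<in> pos_class \<theta> \<psi> Q q v0" and t: "t \<ge> 0" for v w t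
  proof -
    have "(v0, w) \<in> {(v, w). w \<in> pos_class \<theta> \<psi> Q q v}" "(v0, v) \<in> {(v, w). w \<in> pos_class \<theta> \<psi> Q q v}"
      using vw by auto
    hence "(w, v) \<in> {(v, w). w \<in> pos_class \<theta> \<psi> Q q v}"
      using equivalence by (meson equivE symD transD)
    thus ?thesis using t by (simp add: pos_class_def)
  qed
  interpret positive_class_graph K scl j Q Em \<iota> \<theta> \<psi> \<delta> \<tau> am ap \<alpha>0 ap L q
    "pos_class \<theta> \<psi> Q q v0" "Phi \<theta> \<psi> Q Em q v0"
    by (intro positive_class_graph.intro squeezed_cocycle.intro indefinite_forms.intro
        squeezed_cocycle_axioms.intro positive_class_graph_axioms.intro
        E forms bl flow cocycle negative lipschitz diff homeo equivalent)
  have manifold: "C1_submanifold K scl (pos_class \<theta> \<psi> Q q v0)" by (rule VV_C1_submanifold)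
  have linear: "\<forall>v\<in>pos_class \<theta> \<psi> Q q v0. subspace_over K scl (lin_pos_class \<theta> L Q q v) \<and>
      homeomorphism (lin_pos_class \<theta> L Q q v) (E_plus Q Em q) (proj_plus Q Em q) (lin_Phi \<theta> L Q Em q v)"
    by (intro ballI conjI lin_pos_class_subspace_over lin_homeomorphism)
  have graph: "C1_on K scl scl (E_plus Q Em q) (Phi \<theta> \<psi> Q Em q v0)
      (\<lambda>\<zeta> \<xi>. lin_Phi \<theta> L Q Em q (Phi \<theta> \<psi> Q Em q v0 \<zeta>) (proj_plus Q Em q \<xi>))"
    using \<Phi>_C1 by (simp only: D\<Phi>_def[abs_def])
  have tangent: "\<forall>v\<in>pos_class \<theta> \<psi> Q q v0.
      tangent_space (pos_class \<theta> \<psi> Q q v0) v = lin_pos_class \<theta> L Q q v"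
    by (intro ballI tangent_space_eq)
  have time_map: "\<forall>t\<ge>\<tau>. C1_between K scl \<iota> (pos_class \<theta> \<psi> Q q v0) (lin_pos_class \<theta> L Q q)
      (pos_class \<theta> \<psi> Q (\<theta> t q) (\<psi> t q v0)) (lin_pos_class \<theta> L Q (\<theta> t q)) (\<psi> t q) (L t q)"
    by (intro allI impI time_map_C1_between)
  show ?thesis
    unfolding Let_def by (intro conjI manifold linear graph tangent time_map)
qed

end
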